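(* Let $(L,A)$ be a Lie pair with decomposition $L\cong A\oplus B$, let $\mathscr A$ be a local Artinian $\mathbb K$-algebra with residue field $\mathbb K$ and maximal ideal $\mathfrak m_{\mathscr A}$. For any $b\in\Gamma(B)\otimes\mathfrak m_{\mathscr A}$, let $\mathrm{ad}_b=[b,\cdot]_L\in\mathrm{Der}(L)\otimes\mathfrak m_{\mathscr A}$. Then the $\mathrm{Der}(L)\otimes\mathfrak m_{\mathscr A}$-gauge action by $\mathrm{ad}_b$ coincides with the gauge action by $b$, i.e. $$e^{\mathrm{ad}_b}*\xi=e^b*\xi,\qquad\forall\,\xi\in\mathrm{MC}_{\mathscr A}\big(\Omega_A^\bullet(B)\big).$$
   Context: **Lie pairs.** $\mathbb K$ is $\mathbb R$ or $\mathbb C$. A Lie algebroid over a smooth manifold $M$ is a $\mathbb K$-vector bundle $E\to M$ with anchor $\rho_E:E\to TM\otimes_{\mathbb R}\mathbb K$ and a $\mathbb K$-Lie bracket $[\cdot,\cdot]_E$ on $\Gamma(E)$ such that $\rho_E$ is a Lie algebra homomorphism on sections and $[u,fv]_E=(\rho_E(u)f)v+f[u,v]_E$. A Lie pair $(L,A)$ is a Lie algebroid $L$ with a Lie subalgebroid $A$ over the same base. Choosing a complement, identify $B=L/A$ with a subbundle of $L$, $L\cong A\oplus B$, with projections $\mathrm{pr}_A,\mathrm{pr}_B$. For $a\in\Gamma(A)$, $b,b'\in\Gamma(B)$ set $\nabla_ab=\mathrm{pr}_B[a,b]_L$, $\eth_ba=\mathrm{pr}_A[b,a]_L$, $[b,b']_B=\mathrm{pr}_B[b,b']_L$,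 $\beta(b,b')=\mathrm{pr}_A[b,b']_L$. $\eth_b$ acts on $\Gamma(A^\vee)$ by $\langle\eth_bu,a\rangle=\rho_L(b)\langle u,a\rangle-\langle u,\eth_ba\rangle$, on functions by $\rho_L(b)$, and extends as a derivation to $\Gamma(\Lambda^\bullet A^\vee)$. **The $L_{\leqslant3}$ algebra $\mathfrak g=\Omega_A^\bullet(B)$.** $\Omega_A^k=\Gamma(\Lambda^kA^\vee)$, $\Omega_A^k(B)=\Gamma(\Lambda^kA^\vee\otimes B)$ (degree $k$, so $\mathfrak g^0=\Gamma(B)$), with $\omega\cdot(\lambda\otimes b)=(\omega\wedge\lambda)\otimes b$. The brackets are graded skew-symmetric and given by: $[\cdot]_1=d_A^{\mathrm{Bott}}$, $(d_A^{\mathrm{Bott}}X)(a_1,\dots,a_{k+1})=\sum_i(-1)^{i+1}\nabla_{a_i}(X(\dots,\hat a_i,\dots))+\sum_{i<j}(-1)^{i+j}X([a_i,a_j]_A,\dots,\hat a_i,\dots,\hat a_j,\dots)$; $[b,b']_2=[b,b']_B$ and $[X,\omega\cdot Y]_2=(\rho_1(X)\omega)\cdot Y+(-1)^{|\omega||X|}\omega\cdot[X,Y]_2$ with $\rho_1(\lambda\otimes b)\omega=\lambda\wedge\eth_b\omega$; $[b,b',b'']_3=0$ and $[X,Y,\omega\cdot Z]_3=(\rho_2(X,Y)\omega)\cdot Z+(-1)^{|\omega|(|X|+|Y|+1)}\omega\cdot[X,Y,Z]_3$ with $\rho_2(\lambda\otimes b,\lambda'\otimes b')\omega=(-1)^{|\lambda|+|\lambda'|+1}\lambda\wedge\lambda'\wedge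 i_{\beta(b,b')}\omega$; $[\cdots]_k=0$ for $k\geqslant4$. **The action of $\mathrm{Der}(L)$.** A derivation of $L$ is an operator $\delta:\Gamma(L)\to\Gamma(L)$ with a symbol $s\in\mathscr X(M)\otimes\mathbb K$ such that $\delta(fu)=s(f)u+f\delta(u)$, $[s,\rho_L(u)]=\rho_L(\delta(u))$, $\delta[u,v]_L=[\delta(u),v]_L+[u,\delta(v)]_L$; these form the Lie algebra $\mathrm{Der}(L)$. $\mathrm{Der}(L)$ acts on $\Omega^\bullet_A(B)$ with action maps $\mu_0=\kappa$, $\mu_n(\delta,X_1,\dots,X_n)=\delta\triangleright(X_1,\dots,X_n)$ given by (with $\mathrm{Sh}(p,q)$ the $(p,q)$-shuffles, sums over shuffles with a negative index being zero): - $\kappa(\delta)(a)=-\mathrm{pr}_B\delta(a)$; - for $X\in\Omega_A^k(B)$: $(\delta\triangleright X)(a_1,\dots,a_k)=-\sum_{j=1}^kX(a_1,\dots,\mathrm{pr}_A\delta(a_j),\dots,a_k)+\mathrm{pr}_B\delta(X(a_1,\dots,a_k))$; - for $X\in\Omega_A^i(B)$, $Y\in\Omega_A^j(B)$: $(\delta\triangleright(X,Y))(a_1,\dots,a_{i+j-1})=(-1)^{i+1}\sum_{\sigma\in\mathrm{Sh}(i,j-1)}\mathrm{sgn}(\sigma)Y(\mathrm{pr}_A\delta(X(a_{\sigma(1)},\dots,a_{\sigma(i)})),a_{\sigma(i+1)},\dots)+\sum_{\sigma\in\mathrm{Sh}(i-1,j)}\mathrm{sgn}(\sigma)X(\mathrm{pr}_A\delta(Y(a_{\sigma(i)},\dots,a_{\sigma(i+j-1)})),a_{\sigma(1)},\dots,a_{\sigma(i-1)})$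 (so it is zero if $i=j=0$); - $\mu_n=0$ for $n\geqslant3$. All brackets and action maps are extended $\mathscr A$-multilinearly to $\mathfrak g\otimes\mathfrak m_{\mathscr A}$ and $\mathrm{Der}(L)\otimes\mathfrak m_{\mathscr A}$, and $[\cdot,\cdot]_L$ to $\Gamma(L)\otimes\mathfrak m_{\mathscr A}$. **Maurer–Cartan elements and gauge actions.** $\mathrm{MC}_{\mathscr A}(\mathfrak g)$ is the set of $\xi\in\mathfrak g^1\otimes\mathfrak m_{\mathscr A}$ with $\sum_{k\geqslant1}\frac1{k!}[\xi,\dots,\xi]_k=0$. Put $[g_1,\dots,g_i]^\xi_i=\sum_{k\geqslant0}\frac1{k!}[\xi,\dots,\xi,g_1,\dots,g_i]_{i+k}$ ($\xi$ repeated $k$ times). Gauge action: for $b\in\mathfrak g^0\otimes\mathfrak m_{\mathscr A}$, $e^b*\xi:=\xi-\sum_{k\geqslant1}\frac1{k!}e^k_\xi(b)$, where $e^1_\xi(b)=[b]^\xi_1$ and $$e^{k+1}_\xi(b)=\sum_{n=1}^k\frac1{n!}\sum_{k_1+\cdots+k_n=k,\ k_i\geqslant1}\frac{k!}{k_1!\cdots k_n!}[b,e^{k_1}_\xi(b),\dots,e^{k_n}_\xi(b)]^\xi_{n+1}.$$ $\mathfrak h$-gauge action, for $\mathfrak h=\mathrm{Der}(L)$: for $h\in\mathfrak h\otimes\mathfrak m_{\mathscr A}$, $e^h*\xi:=\xi-\sum_{k\geqslant1}\frac1{k!}e^k_\xi(h)$, where $e^1_\xi(h)=\kappa(h)+\sum_{i\geqslant1}\frac{(-1)^i}{i!}h\triangleright(\xi,\dots,\xi)$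 ($i$ copies of $\xi$) and $$e^{k+1}_\xi(h)=\sum_{n=1}^k\frac1{n!}\sum_{k_1+\cdots+k_n=k,\ k_i\geqslant1}\frac{k!}{k_1!\cdots k_n!}\sum_{j\geqslant0}\frac{(-1)^j}{j!}\,h\triangleright\big(\underbrace{\xi,\dots,\xi}_{j},e^{k_1}_\xi(h),\dots,e^{k_n}_\xi(h)\big).$$ *)

theory Defs
  imports "HOL-Analysis.Analysis" "HOL-Library.Function_Algebras"
    "HOL-Library.Groups_Big_Fun" "HOL-Combinatorics.Permutations"
begin

section \<open>The ground field\<close>

text \<open>The type variable \<open>'k\<close> of the ground field ranges over this class, whose members are
  the real field and (up to isomorphism of normed fields) the complex field.\<close>

class real_or_complex_field = real_normed_field +
  assumes real_or_complex:
    "(\<forall>x. \<exists>a::real. x = a *\<^sub>R 1) \<or>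
     (\<exists>j. j * j = - 1 \<and> (\<forall>x. \<exists>(a::real) (b::real). x = a *\<^sub>R 1 + b *\<^sub>R j))"

instance real :: real_or_complex_field
  by standard auto

instance complex :: real_or_complex_field
proof
  have "\<i> * \<i> = - 1 \<and> (\<forall>x. \<exists>a b. x = a *\<^sub>R (1::complex) + b *\<^sub>R \<i>)"
    by (metis complex_eq i_squared mult.commute scaleR_conv_of_real mult.right_neutral)
  then show "(\<forall>x. \<exists>a. x = a *\<^sub>R (1::complex)) \<or>
     (\<exists>j. j * j = - 1 \<and> (\<forall>x. \<exists>a b. x = a *\<^sub>R (1::complex) + b *\<^sub>R j))"
    by blast
qed

text \<open>Sections, forms and elements of tensor products are all (iterated) functions into the
  ambient space of the fibres; they are scaled pointwise.\<close>

definition pw :: "('k \<Rightarrow> 'w \<Rightarrow> 'w) \<Rightarrow> 'k \<Rightarrow> ('z \<Rightarrow> 'w) \<Rightarrow> 'z \<Rightarrow> 'w" where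
  "pw s c F = (\<lambda>z. s c (F z))"


section \<open>Smooth manifolds and vector bundles\<close>

text \<open>\<open>\<real>\<^sup>n\<close> for a natural number \<open>n\<close> (possibly \<open>0\<close>), with the product topology.\<close>

definition Rn :: "nat \<Rightarrow> (nat \<Rightarrow> real) set" where
  "Rn n = {x. \<forall>i\<ge>n. x i = 0}"

text \<open>Frechet differentiability at \<open>x\<close> of a function on an open subset \<open>S\<close> of \<open>Rn n\<close>, the partial
  derivatives at \<open>x\<close> being \<open>D 0 x, \<dots>, D (n - 1) x\<close>.\<close>

definition has_partials_at ::
  "nat \<Rightarrow> (nat \<Rightarrow> real) set \<Rightarrow> ((nat \<Rightarrow> real) \<Rightarrow> 'w::real_normed_vector)
    \<Rightarrow> (nat \<Rightarrow> (nat \<Rightarrow> real) \<Rightarrow> 'w) \<Rightarrow> (nat \<Rightarrow> real) \<Rightarrow> bool" where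
  "has_partials_at n S f D x \<longleftrightarrow>
    (\<forall>e>0. \<exists>d>0. \<forall>y\<in>S. (\<forall>i<n. \<bar>y i - x i\<bar> < d) \<longrightarrow>
       norm (f y - f x - (\<Sum>i<n. (y i - x i) *\<^sub>R D i x)) \<le> e * (\<Sum>i<n. \<bar>y i - x i\<bar>))"

primrec Ck_on ::
  "nat \<Rightarrow> nat \<Rightarrow> (nat \<Rightarrow> real) set \<Rightarrow> ((nat \<Rightarrow> real) \<Rightarrow> 'w::real_normed_vector) \<Rightarrow> bool" where
  "Ck_on n 0 S f \<longleftrightarrow> continuous_on S f"
| "Ck_on n (Suc k) S f \<longleftrightarrow>
    (\<exists>D. (\<forall>x\<in>S. has_partials_at n S f D x) \<and> (\<forall>i<n. Ck_on n k S (D i)))"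

definition smooth_Rn ::
  "nat \<Rightarrow> (nat \<Rightarrow> real) set \<Rightarrow> ((nat \<Rightarrow> real) \<Rightarrow> 'w::real_normed_vector) \<Rightarrow> bool" where
  "smooth_Rn n S f \<longleftrightarrow> (\<forall>k. Ck_on n k S f)"

text \<open>The underlying space of a manifold is a whole type \<open>'m\<close>, Hausdorff and second countable
  by its type class; \<open>charts\<close> is a smooth atlas.\<close>

record 'm manifold =
  mdim :: nat
  charts :: "('m set \<times> ('m \<Rightarrow> nat \<Rightarrow> real)) set"

definition smooth_manifold ::
  "('m::{t2_space,second_countable_topology}, 'z) manifold_scheme \<Rightarrow> bool" where
  "smooth_manifold M \<longleftrightarrow>
    (\<forall>(U, \<phi>) \<in> charts M. open U \<and> openin (top_of_set (Rn (mdim M))) (\<phi> ` U) \<and>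
       homeomorphism U (\<phi> ` U) \<phi> (inv_into U \<phi>)) \<and>
    (\<Union>(U, \<phi>) \<in> charts M. U) = UNIV \<and>
    (\<forall>(U, \<phi>) \<in> charts M. \<forall>(V, \<psi>) \<in> charts M. \<forall>i < mdim M.
       smooth_Rn (mdim M) (\<phi> ` (U \<inter> V)) (\<lambda>y. \<psi> (inv_into U \<phi> y) i))"

definition smooth_on ::
  "('m::{t2_space,second_countable_topology}, 'z) manifold_scheme \<Rightarrow> 'm set
    \<Rightarrow> ('m \<Rightarrow> 'k::real_or_complex_field) \<Rightarrow> bool" where
  "smooth_on M W f \<longleftrightarrow>
    (\<forall>(U, \<phi>) \<in> charts M. smooth_Rn (mdim M) (\<phi> ` (U \<inter> W)) (\<lambda>y. f (inv_into U \<phi> y)))"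

definition Cinf ::
  "('m::{t2_space,second_countable_topology}, 'z) manifold_scheme
    \<Rightarrow> ('m \<Rightarrow> 'k::real_or_complex_field) set" where
  "Cinf M = {f. smooth_on M UNIV f}"

text \<open>The fibres of a \<open>'k\<close>-vector bundle are finite-dimensional subspaces of an arbitrary
  \<open>'k\<close>-vector space with carrier \<open>'v\<close> and scalar multiplication \<open>scl\<close>. This ambient space is
  only a container (for instance the direct sum of all the fibres); it has no topology. The smooth
  structure is a collection of local frames with smooth transition functions.\<close>

record ('m, 'k, 'v) vbundle = "'m manifold" +
  scl :: "'k \<Rightarrow> 'v \<Rightarrow> 'v"
  fib :: "'m \<Rightarrow> 'v set"
  frames :: "('m set \<times> ('m \<Rightarrow> 'v) list) set"

definition is_basis ::
  "('k::field \<Rightarrow> 'v::ab_group_add \<Rightarrow> 'v) \<Rightarrow> 'v list \<Rightarrow> 'v set \<Rightarrow> bool" where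
  "is_basis s vs V \<longleftrightarrow>
    distinct vs \<and> \<not> module.dependent s (set vs) \<and> module.span s (set vs) = V"

definition local_section ::
  "('m::{t2_space,second_countable_topology}, 'k::real_or_complex_field, 'v::ab_group_add, 'z)
     vbundle_scheme \<Rightarrow> 'm set \<Rightarrow> ('m \<Rightarrow> 'v) \<Rightarrow> bool" where
  "local_section E W u \<longleftrightarrow>
    (\<forall>x\<in>W. u x \<in> fib E x) \<and>
    (\<forall>(U, es) \<in> frames E. \<exists>g. (\<forall>i < length es. smooth_on E (U \<inter> W) (g i)) \<and>
       (\<forall>x \<in> U \<inter> W. u x = (\<Sum>i < length es. scl E (g i x) ((es ! i) x))))"

definition vector_bundle ::
  "('m::{t2_space,second_countable_topology}, 'k::real_or_complex_field, 'v::ab_group_add, 'z)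
     vbundle_scheme \<Rightarrow> bool" where
  "vector_bundle E \<longleftrightarrow>
    smooth_manifold E \<and> vector_space (scl E) \<and>
    (\<forall>x. module.subspace (scl E) (fib E x)) \<and>
    (\<Union>(U, es) \<in> frames E. U) = UNIV \<and>
    (\<forall>(U, es) \<in> frames E. open U \<and>
       (\<forall>x\<in>U. is_basis (scl E) (map (\<lambda>e. e x) es) (fib E x)) \<and>
       (\<forall>e \<in> set es. local_section E U e))"

definition subbundle ::
  "('m::{t2_space,second_countable_topology}, 'k::real_or_complex_field, 'v::ab_group_add, 'z)
     vbundle_scheme \<Rightarrow> ('m \<Rightarrow> 'v set) \<Rightarrow> bool" where
  "subbundle E F \<longleftrightarrow>
    (\<forall>x. module.subspace (scl E) (F x) \<and> F x \<subseteq> fib E x) \<and>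
    (\<forall>p. \<exists>U es. open U \<and> p \<in> U \<and> (\<forall>e \<in> set es. local_section E U e) \<and>
       (\<forall>x\<in>U. is_basis (scl E) (map (\<lambda>e. e x) es) (F x)))"

definition Gam ::
  "('m::{t2_space,second_countable_topology}, 'k::real_or_complex_field, 'v::ab_group_add, 'z)
     vbundle_scheme \<Rightarrow> ('m \<Rightarrow> 'v) set" where
  "Gam E = {u. local_section E UNIV u}"

definition smul ::
  "('m::{t2_space,second_countable_topology}, 'k::real_or_complex_field, 'v::ab_group_add, 'z)
     vbundle_scheme \<Rightarrow> ('m \<Rightarrow> 'k) \<Rightarrow> ('m \<Rightarrow> 'v) \<Rightarrow> 'm \<Rightarrow> 'v" where
  "smul E f u = (\<lambda>x. scl E (f x) (u x))"

text \<open>Elements of \<open>T\<^sub>x M \<otimes>\<^sub>\<real> \<bbbK>\<close> are the \<open>\<bbbK>\<close>-linear point derivations of \<open>C\<^sup>\<infinity>(M, \<bbbK>)\<close> at \<open>x\<close>. Only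
  the values of a tangent vector on smooth functions are ever used.\<close>

definition tangent_vec ::
  "('m::{t2_space,second_countable_topology}, 'z) manifold_scheme \<Rightarrow> 'm
    \<Rightarrow> (('m \<Rightarrow> 'k::real_or_complex_field) \<Rightarrow> 'k) \<Rightarrow> bool" where
  "tangent_vec M x D \<longleftrightarrow>
    (\<forall>f\<in>Cinf M. \<forall>g\<in>Cinf M. D (\<lambda>y. f y + g y) = D f + D g \<and>
       D (\<lambda>y. f y * g y) = D f * g x + f x * D g) \<and>
    (\<forall>c. \<forall>f\<in>Cinf M. D (\<lambda>y. c * f y) = c * D f)"

definition vfields ::
  "('m::{t2_space,second_countable_topology}, 'z) manifold_scheme
    \<Rightarrow> ('m \<Rightarrow> ('m \<Rightarrow> 'k::real_or_complex_field) \<Rightarrow> 'k) set" where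
  "vfields M =
    {s. (\<forall>x. tangent_vec M x (s x)) \<and> (\<forall>f\<in>Cinf M. (\<lambda>x. s x f) \<in> Cinf M)}"


section \<open>Lie algebroids, Lie pairs and derivations\<close>

record ('m, 'k, 'v) algebroid = "('m, 'k, 'v) vbundle" +
  anchor :: "'m \<Rightarrow> 'v \<Rightarrow> ('m \<Rightarrow> 'k) \<Rightarrow> 'k"
  brk :: "('m \<Rightarrow> 'v) \<Rightarrow> ('m \<Rightarrow> 'v) \<Rightarrow> 'm \<Rightarrow> 'v"

definition rho ::
  "('m::{t2_space,second_countable_topology}, 'k::real_or_complex_field, 'v::ab_group_add, 'z)
     algebroid_scheme \<Rightarrow> ('m \<Rightarrow> 'v) \<Rightarrow> ('m \<Rightarrow> 'k) \<Rightarrow> 'm \<Rightarrow> 'k" where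
  "rho E u f = (\<lambda>x. anchor E x (u x) f)"

definition lie_algebroid ::
  "('m::{t2_space,second_countable_topology}, 'k::real_or_complex_field, 'v::ab_group_add, 'z)
     algebroid_scheme \<Rightarrow> bool" where
  "lie_algebroid E \<longleftrightarrow>
    vector_bundle E \<and>
    (\<comment> \<open>the anchor is a smooth bundle map into \<open>TM \<otimes>\<^sub>\<real> \<bbbK>\<close>\<close>
     (\<forall>x. \<forall>v\<in>fib E x. tangent_vec E x (anchor E x v)) \<and>
     (\<forall>x. \<forall>v\<in>fib E x. \<forall>w\<in>fib E x. \<forall>f\<in>Cinf E.
        anchor E x (v + w) f = anchor E x v f + anchor E x w f) \<and>
     (\<forall>x. \<forall>v\<in>fib E x. \<forall>c. \<forall>f\<in>Cinf E. anchor E x (scl E c v) f = c * anchor E x v f) \<and>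
     (\<forall>u\<in>Gam E. \<forall>f\<in>Cinf E. rho E u f \<in> Cinf E)) \<and>
    (\<comment> \<open>\<open>\<Gamma>(E)\<close> is a \<open>\<bbbK>\<close>-Lie algebra\<close>
     (\<forall>u\<in>Gam E. \<forall>v\<in>Gam E. brk E u v \<in> Gam E) \<and>
     (\<forall>u\<in>Gam E. \<forall>v\<in>Gam E. \<forall>w\<in>Gam E.
        brk E (u + v) w = brk E u w + brk E v w \<and> brk E w (u + v) = brk E w u + brk E w v) \<and>
     (\<forall>u\<in>Gam E. \<forall>v\<in>Gam E. \<forall>c.
        brk E (pw (scl E) c u) v = pw (scl E) c (brk E u v) \<and>
        brk E u (pw (scl E) c v) = pw (scl E) c (brk E u v)) \<and>
     (\<forall>u\<in>Gam E. brk E u u = 0) \<and>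
     (\<forall>u\<in>Gam E. \<forall>v\<in>Gam E. \<forall>w\<in>Gam E.
        brk E u (brk E v w) + brk E v (brk E w u) + brk E w (brk E u v) = 0)) \<and>
    (\<forall>u\<in>Gam E. \<forall>v\<in>Gam E. \<forall>f\<in>Cinf E.
       rho E (brk E u v) f = rho E u (rho E v f) - rho E v (rho E u f)) \<and>
    (\<forall>u\<in>Gam E. \<forall>v\<in>Gam E. \<forall>f\<in>Cinf E.
       brk E u (smul E f v) = smul E (rho E u f) v + smul E f (brk E u v))"

text \<open>A Lie pair \<open>(L, A)\<close> together with a complement \<open>B\<close> of \<open>A\<close> in \<open>L\<close>.\<close>

record ('m, 'k, 'v) lie_pair = "('m, 'k, 'v) algebroid" +
  subA :: "'m \<Rightarrow> 'v set"
  subB :: "'m \<Rightarrow> 'v set"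

definition GamA ::
  "('m::{t2_space,second_countable_topology}, 'k::real_or_complex_field, 'v::ab_group_add)
     lie_pair \<Rightarrow> ('m \<Rightarrow> 'v) set" where
  "GamA P = {u \<in> Gam P. \<forall>x. u x \<in> subA P x}"

definition GamB ::
  "('m::{t2_space,second_countable_topology}, 'k::real_or_complex_field, 'v::ab_group_add)
     lie_pair \<Rightarrow> ('m \<Rightarrow> 'v) set" where
  "GamB P = {u \<in> Gam P. \<forall>x. u x \<in> subB P x}"

definition prA ::
  "('m::{t2_space,second_countable_topology}, 'k::real_or_complex_field, 'v::ab_group_add)
     lie_pair \<Rightarrow> ('m \<Rightarrow> 'v) \<Rightarrow> 'm \<Rightarrow> 'v" where
  "prA P u = (\<lambda>x. THE a. a \<in> subA P x \<and> u x - a \<in> subB P x)"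

definition prB ::
  "('m::{t2_space,second_countable_topology}, 'k::real_or_complex_field, 'v::ab_group_add)
     lie_pair \<Rightarrow> ('m \<Rightarrow> 'v) \<Rightarrow> 'm \<Rightarrow> 'v" where
  "prB P u = (\<lambda>x. THE b. b \<in> subB P x \<and> u x - b \<in> subA P x)"

text \<open>In the last condition, \<open>L \<cong> A \<oplus> B\<close> is an isomorphism of vector bundles, so the projections
  are smooth.\<close>

definition split_lie_pair ::
  "('m::{t2_space,second_countable_topology}, 'k::real_or_complex_field, 'v::ab_group_add)
     lie_pair \<Rightarrow> bool" where
  "split_lie_pair P \<longleftrightarrow>
    lie_algebroid P \<and>
    subbundle P (subA P) \<and> (\<forall>u\<in>GamA P. \<forall>v\<in>GamA P. brk P u v \<in> GamA P) \<and>
    subbundle P (subB P) \<and>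
    (\<forall>x. subA P x \<inter> subB P x = {0} \<and>
       fib P x = {a + b | a b. a \<in> subA P x \<and> b \<in> subB P x}) \<and>
    (\<forall>u\<in>Gam P. prA P u \<in> GamA P \<and> prB P u \<in> GamB P)"

text \<open>Derivations are operators on \<open>\<Gamma>(L)\<close>; as HOL functions they are normalised to be \<open>0\<close>
  outside \<open>\<Gamma>(L)\<close>, so that equal operators are equal functions.\<close>

definition DerL ::
  "('m::{t2_space,second_countable_topology}, 'k::real_or_complex_field, 'v::ab_group_add, 'z)
     algebroid_scheme \<Rightarrow> (('m \<Rightarrow> 'v) \<Rightarrow> 'm \<Rightarrow> 'v) set" where
  "DerL E = {\<delta>.
    (\<forall>u. u \<notin> Gam E \<longrightarrow> \<delta> u = 0) \<and> (\<forall>u\<in>Gam E. \<delta> u \<in> Gam E) \<and>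
    (\<forall>u\<in>Gam E. \<forall>v\<in>Gam E. \<delta> (u + v) = \<delta> u + \<delta> v) \<and>
    (\<forall>u\<in>Gam E. \<forall>c. \<delta> (pw (scl E) c u) = pw (scl E) c (\<delta> u)) \<and>
    (\<forall>u\<in>Gam E. \<forall>v\<in>Gam E. \<delta> (brk E u v) = brk E (\<delta> u) v + brk E u (\<delta> v)) \<and>
    (\<exists>s \<in> vfields E.
       (\<forall>u\<in>Gam E. \<forall>f\<in>Cinf E. \<delta> (smul E f u) = smul E (\<lambda>x. s x f) u + smul E f (\<delta> u)) \<and>
       (\<forall>u\<in>Gam E. \<forall>f\<in>Cinf E. \<forall>x. s x (rho E u f) - rho E u (\<lambda>y. s y f) x = rho E (\<delta> u) f x))}"

definition ad ::
  "('m::{t2_space,second_countable_topology}, 'k::real_or_complex_field, 'v::ab_group_add, 'z)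
     algebroid_scheme \<Rightarrow> ('m \<Rightarrow> 'v) \<Rightarrow> ('m \<Rightarrow> 'v) \<Rightarrow> 'm \<Rightarrow> 'v" where
  "ad E b = (\<lambda>u. if u \<in> Gam E then brk E b u else 0)"


section \<open>The graded space of \<open>B\<close>-valued \<open>A\<close>-forms\<close>

text \<open>\<open>\<Omega>\<^sub>A\<^sup>k = \<Gamma>(\<Lambda>\<^sup>k A\<^sup>\<or>)\<close> and \<open>\<Omega>\<^sub>A\<^sup>k(B) = \<Gamma>(\<Lambda>\<^sup>k A\<^sup>\<or> \<otimes> B)\<close> are the alternating
  \<open>C\<^sup>\<infinity>(M, \<bbbK>)\<close>-multilinear maps from \<open>\<Gamma>(A)\<^sup>k\<close> to \<open>C\<^sup>\<infinity>(M, \<bbbK>)\<close> and \<open>\<Gamma>(B)\<close>. Arguments are lists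
  of sections, and a \<open>k\<close>-form is \<open>0\<close> on all lists other than lists of length \<open>k\<close> in \<open>\<Gamma>(A)\<close>. Forms
  of all degrees thus share one type, in which the sum over the degrees is direct. In
  \<open>alt_forms\<close>, \<open>W\<close> is the target module and \<open>s\<close> its module structure.\<close>

definition alt_forms ::
  "('m::{t2_space,second_countable_topology}, 'k::real_or_complex_field, 'v::ab_group_add)
     lie_pair \<Rightarrow> (('m \<Rightarrow> 'k) \<Rightarrow> 'w \<Rightarrow> 'w) \<Rightarrow> 'w::ab_group_add set \<Rightarrow> nat
    \<Rightarrow> (('m \<Rightarrow> 'v) list \<Rightarrow> 'w) set" where
  "alt_forms P s W k = {X.
    (\<forall>as. \<not> (length as = k \<and> set as \<subseteq> GamA P) \<longrightarrow> X as = 0) \<and>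
    (\<forall>as. length as = k \<and> set as \<subseteq> GamA P \<longrightarrow>
       X as \<in> W \<and>
       (\<forall>i<k. \<forall>a\<in>GamA P. X (as[i := as ! i + a]) = X as + X (as[i := a])) \<and>
       (\<forall>i<k. \<forall>f\<in>Cinf P. X (as[i := smul P f (as ! i)]) = s f (X as)) \<and>
       (\<not> distinct as \<longrightarrow> X as = 0))}"

definition Omega ::
  "('m::{t2_space,second_countable_topology}, 'k::real_or_complex_field, 'v::ab_group_add)
     lie_pair \<Rightarrow> nat \<Rightarrow> (('m \<Rightarrow> 'v) list \<Rightarrow> 'm \<Rightarrow> 'k) set" where
  "Omega P = alt_forms P (\<lambda>f g x. f x * g x) (Cinf P)"

definition OmegaB ::
  "('m::{t2_space,second_countable_topology}, 'k::real_or_complex_field, 'v::ab_group_add)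
     lie_pair \<Rightarrow> nat \<Rightarrow> (('m \<Rightarrow> 'v) list \<Rightarrow> 'm \<Rightarrow> 'v) set" where
  "OmegaB P = alt_forms P (smul P) (GamB P)"

text \<open>\<open>\<gg> = \<Oplus>\<^sub>k \<gg>\<^sup>k\<close>\<close>

definition OmegaB_total ::
  "('m::{t2_space,second_countable_topology}, 'k::real_or_complex_field, 'v::ab_group_add)
     lie_pair \<Rightarrow> (('m \<Rightarrow> 'v) list \<Rightarrow> 'm \<Rightarrow> 'v) set" where
  "OmegaB_total P = {\<Sum>k<N. Xs k | N Xs. \<forall>k<N. Xs k \<in> OmegaB P k}"

definition form0 :: "'w::zero \<Rightarrow> 's list \<Rightarrow> 'w" where
  "form0 u = (\<lambda>as. if as = [] then u else 0)"

text \<open>Permutations are of \<open>{0..<p + q}\<close>, all indices being shifted by one with respect to the usual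
  1-based formulas. \<open>pick as \<sigma> i j\<close> is \<open>a\<^bsub>\<sigma>(i)\<^esub>, \<dots>, a\<^bsub>\<sigma>(j - 1)\<^esub>\<close>.\<close>

definition Sh :: "nat \<Rightarrow> nat \<Rightarrow> (nat \<Rightarrow> nat) set" where
  "Sh p q = {\<sigma>. \<sigma> permutes {..<p + q} \<and>
    strict_mono_on {..<p} \<sigma> \<and> strict_mono_on {p..<p + q} \<sigma>}"

definition pick :: "'s list \<Rightarrow> (nat \<Rightarrow> nat) \<Rightarrow> nat \<Rightarrow> nat \<Rightarrow> 's list" where
  "pick as \<sigma> i j = map (\<lambda>l. as ! \<sigma> l) [i..<j]"

text \<open>\<open>wedge p q\<close> multiplies a \<open>p\<close>-form with a \<open>q\<close>-form; \<open>dotB p q\<close> is the product of a \<open>p\<close>-form with a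
  \<open>B\<close>-valued \<open>q\<close>-form, \<open>\<omega> \<cdot> (\<lambda> \<otimes> b) = (\<omega> \<and> \<lambda>) \<otimes> b\<close>.\<close>

definition wedge ::
  "nat \<Rightarrow> nat \<Rightarrow> ('s list \<Rightarrow> 'm \<Rightarrow> 'k::real_or_complex_field) \<Rightarrow> ('s list \<Rightarrow> 'm \<Rightarrow> 'k)
    \<Rightarrow> 's list \<Rightarrow> 'm \<Rightarrow> 'k" where
  "wedge p q \<omega> \<eta> = (\<lambda>as x. if length as = p + q
     then \<Sum>\<sigma>\<in>Sh p q. of_int (sign \<sigma>) * (\<omega> (pick as \<sigma> 0 p) x * \<eta> (pick as \<sigma> p (p + q)) x)
     else 0)"

definition dotB ::
  "('m::{t2_space,second_countable_topology}, 'k::real_or_complex_field, 'v::ab_group_add)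
     lie_pair \<Rightarrow> nat \<Rightarrow> nat \<Rightarrow> (('m \<Rightarrow> 'v) list \<Rightarrow> 'm \<Rightarrow> 'k)
    \<Rightarrow> (('m \<Rightarrow> 'v) list \<Rightarrow> 'm \<Rightarrow> 'v) \<Rightarrow> ('m \<Rightarrow> 'v) list \<Rightarrow> 'm \<Rightarrow> 'v" where
  "dotB P p q \<omega> Y = (\<lambda>as x. if length as = p + q
     then \<Sum>\<sigma>\<in>Sh p q. scl P (of_int (sign \<sigma>) * \<omega> (pick as \<sigma> 0 p) x) (Y (pick as \<sigma> p (p + q)) x)
     else 0)"

definition otimes ::
  "('m::{t2_space,second_countable_topology}, 'k::real_or_complex_field, 'v::ab_group_add)
     lie_pair \<Rightarrow> (('m \<Rightarrow> 'v) list \<Rightarrow> 'm \<Rightarrow> 'k) \<Rightarrow> ('m \<Rightarrow> 'v)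
    \<Rightarrow> ('m \<Rightarrow> 'v) list \<Rightarrow> 'm \<Rightarrow> 'v" where
  "otimes P \<eta> b = (\<lambda>as. smul P (\<eta> as) b)"

definition nabla ::
  "('m::{t2_space,second_countable_topology}, 'k::real_or_complex_field, 'v::ab_group_add)
     lie_pair \<Rightarrow> ('m \<Rightarrow> 'v) \<Rightarrow> ('m \<Rightarrow> 'v) \<Rightarrow> 'm \<Rightarrow> 'v" where
  "nabla P a b = prB P (brk P a b)"

definition eth ::
  "('m::{t2_space,second_countable_topology}, 'k::real_or_complex_field, 'v::ab_group_add)
     lie_pair \<Rightarrow> ('m \<Rightarrow> 'v) \<Rightarrow> ('m \<Rightarrow> 'v) \<Rightarrow> 'm \<Rightarrow> 'v" where
  "eth P b a = prA P (brk P b a)"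

definition brkB ::
  "('m::{t2_space,second_countable_topology}, 'k::real_or_complex_field, 'v::ab_group_add)
     lie_pair \<Rightarrow> ('m \<Rightarrow> 'v) \<Rightarrow> ('m \<Rightarrow> 'v) \<Rightarrow> 'm \<Rightarrow> 'v" where
  "brkB P b b' = prB P (brk P b b')"

definition beta ::
  "('m::{t2_space,second_countable_topology}, 'k::real_or_complex_field, 'v::ab_group_add)
     lie_pair \<Rightarrow> ('m \<Rightarrow> 'v) \<Rightarrow> ('m \<Rightarrow> 'v) \<Rightarrow> 'm \<Rightarrow> 'v" where
  "beta P b b' = prA P (brk P b b')"

text \<open>The action of \<open>\<eth>\<^sub>b\<close> on \<open>\<Omega>\<^sub>A\<^sup>\<bullet>\<close>: for functions it is \<open>\<rho>\<^sub>L(b)\<close>, for 1-forms the dual of \<open>\<eth>\<^sub>b\<close> on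
  \<open>\<Gamma>(A)\<close>, and in degree \<open>k\<close> the value of its derivation extension on \<open>(a\<^sub>1, \<dots>, a\<^sub>k)\<close>.\<close>

definition eth_form ::
  "('m::{t2_space,second_countable_topology}, 'k::real_or_complex_field, 'v::ab_group_add)
     lie_pair \<Rightarrow> ('m \<Rightarrow> 'v) \<Rightarrow> (('m \<Rightarrow> 'v) list \<Rightarrow> 'm \<Rightarrow> 'k)
    \<Rightarrow> ('m \<Rightarrow> 'v) list \<Rightarrow> 'm \<Rightarrow> 'k" where
  "eth_form P b \<omega> = (\<lambda>as. if set as \<subseteq> GamA P
     then rho P b (\<omega> as) - (\<Sum>i<length as. \<omega> (as[i := eth P b (as ! i)])) else 0)"

definition contract :: "'s \<Rightarrow> ('s list \<Rightarrow> 'w) \<Rightarrow> 's list \<Rightarrow> 'w" where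
  "contract a \<omega> = (\<lambda>as. \<omega> (a # as))"

definition dBott ::
  "('m::{t2_space,second_countable_topology}, 'k::real_or_complex_field, 'v::ab_group_add)
     lie_pair \<Rightarrow> (('m \<Rightarrow> 'v) list \<Rightarrow> 'm \<Rightarrow> 'v) \<Rightarrow> ('m \<Rightarrow> 'v) list \<Rightarrow> 'm \<Rightarrow> 'v" where
  "dBott P X = (\<lambda>as. if as \<noteq> [] \<and> set as \<subseteq> GamA P
     then (\<Sum>i<length as. pw (scl P) ((- 1) ^ i) (nabla P (as ! i) (X (nths as (- {i}))))) +
          (\<Sum>j<length as. \<Sum>i<j. pw (scl P) ((- 1) ^ (i + j))
             (X (brk P (as ! i) (as ! j) # nths as (- {i, j}))))
     else 0)"


section \<open>The brackets on \<open>B\<close>-valued \<open>A\<close>-forms\<close>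

text \<open>\<open>\<rho>\<^sub>1\<close> and \<open>\<rho>\<^sub>2\<close> are defined on simple tensors of
  \<open>\<Omega>\<^sub>A\<^sup>k(B) = \<Omega>\<^sub>A\<^sup>k \<otimes> \<Gamma>(B)\<close>, the tensor product being over \<open>C\<^sup>\<infinity>(M, \<bbbK>)\<close>, and extended linearly; the
  simple tensors determine them.\<close>

definition is_rho1 ::
  "('m::{t2_space,second_countable_topology}, 'k::real_or_complex_field, 'v::ab_group_add)
     lie_pair \<Rightarrow> ((('m \<Rightarrow> 'v) list \<Rightarrow> 'm \<Rightarrow> 'v) \<Rightarrow> (('m \<Rightarrow> 'v) list \<Rightarrow> 'm \<Rightarrow> 'k)
    \<Rightarrow> ('m \<Rightarrow> 'v) list \<Rightarrow> 'm \<Rightarrow> 'k) \<Rightarrow> bool" where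
  "is_rho1 P \<rho>1 \<longleftrightarrow>
    (\<forall>k p. \<forall>\<omega>\<in>Omega P p.
      (\<forall>X\<in>OmegaB P k. \<rho>1 X \<omega> \<in> Omega P (k + p) \<and>
         (\<forall>X'\<in>OmegaB P k. \<rho>1 (X + X') \<omega> = \<rho>1 X \<omega> + \<rho>1 X' \<omega>) \<and>
         (\<forall>f\<in>Cinf P. \<rho>1 (pw (smul P) f X) \<omega> = (\<lambda>as x. f x * \<rho>1 X \<omega> as x))) \<and>
      (\<forall>\<eta>\<in>Omega P k. \<forall>b\<in>GamB P. \<rho>1 (otimes P \<eta> b) \<omega> = wedge k p \<eta> (eth_form P b \<omega>)))"

text \<open>For a function \<open>\<omega>\<close> (\<open>p = 0\<close>) the contraction of \<open>\<omega>\<close> is \<open>0\<close>, so the truncated degrees below are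
  harmless.\<close>

definition is_rho2 ::
  "('m::{t2_space,second_countable_topology}, 'k::real_or_complex_field, 'v::ab_group_add)
     lie_pair \<Rightarrow> ((('m \<Rightarrow> 'v) list \<Rightarrow> 'm \<Rightarrow> 'v) \<Rightarrow> (('m \<Rightarrow> 'v) list \<Rightarrow> 'm \<Rightarrow> 'v)
    \<Rightarrow> (('m \<Rightarrow> 'v) list \<Rightarrow> 'm \<Rightarrow> 'k) \<Rightarrow> ('m \<Rightarrow> 'v) list \<Rightarrow> 'm \<Rightarrow> 'k) \<Rightarrow> bool" where
  "is_rho2 P \<rho>2 \<longleftrightarrow>
    (\<forall>i j p. \<forall>\<omega>\<in>Omega P p.
      (\<forall>X\<in>OmegaB P i. \<forall>Y\<in>OmegaB P j.
         (if p = 0 then \<rho>2 X Y \<omega> = 0 else \<rho>2 X Y \<omega> \<in> Omega P (i + j + (p - 1))) \<and>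
         (\<forall>X'\<in>OmegaB P i. \<rho>2 (X + X') Y \<omega> = \<rho>2 X Y \<omega> + \<rho>2 X' Y \<omega>) \<and>
         (\<forall>Y'\<in>OmegaB P j. \<rho>2 X (Y + Y') \<omega> = \<rho>2 X Y \<omega> + \<rho>2 X Y' \<omega>) \<and>
         (\<forall>f\<in>Cinf P. \<rho>2 (pw (smul P) f X) Y \<omega> = (\<lambda>as x. f x * \<rho>2 X Y \<omega> as x) \<and>
            \<rho>2 X (pw (smul P) f Y) \<omega> = (\<lambda>as x. f x * \<rho>2 X Y \<omega> as x))) \<and>
      (\<forall>\<eta>\<in>Omega P i. \<forall>b\<in>GamB P. \<forall>\<eta>'\<in>Omega P j. \<forall>b'\<in>GamB P.
         \<rho>2 (otimes P \<eta> b) (otimes P \<eta>' b') \<omega> =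
           (\<lambda>as x. (- 1) ^ (i + j + 1) *
              wedge i (j + (p - 1)) \<eta> (wedge j (p - 1) \<eta>' (contract (beta P b b') \<omega>)) as x)))"

text \<open>\<open>br [X\<^sub>1, \<dots>, X\<^sub>k]\<close> is the bracket \<open>[X\<^sub>1, \<dots>, X\<^sub>k]\<^sub>k\<close> on \<open>\<gg>\<close>.\<close>

definition L3_brackets ::
  "('m::{t2_space,second_countable_topology}, 'k::real_or_complex_field, 'v::ab_group_add)
     lie_pair \<Rightarrow> ((('m \<Rightarrow> 'v) list \<Rightarrow> 'm \<Rightarrow> 'v) list \<Rightarrow> ('m \<Rightarrow> 'v) list \<Rightarrow> 'm \<Rightarrow> 'v) \<Rightarrow> bool" where
  "L3_brackets P br \<longleftrightarrow>
    (\<comment> \<open>\<open>\<bbbK>\<close>-multilinear, of degree \<open>2 - k\<close>, graded skew-symmetric\<close>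
     (\<forall>Xs Ys. set Xs \<subseteq> OmegaB_total P \<longrightarrow> set Ys \<subseteq> OmegaB_total P \<longrightarrow>
        (\<forall>X\<in>OmegaB_total P.
           (\<forall>Y\<in>OmegaB_total P. br (Xs @ (X + Y) # Ys) = br (Xs @ X # Ys) + br (Xs @ Y # Ys)) \<and>
           (\<forall>c. br (Xs @ pw (pw (scl P)) c X # Ys) = pw (pw (scl P)) c (br (Xs @ X # Ys))))) \<and>
     (\<forall>Xs ks. list_all2 (\<lambda>X k. X \<in> OmegaB P k) Xs ks \<longrightarrow>
        (if length Xs \<le> sum_list ks + 2 then br Xs \<in> OmegaB P (sum_list ks + 2 - length Xs)
         else br Xs = 0)) \<and>
     (\<forall>Xs Ys i j. set Xs \<subseteq> OmegaB_total P \<longrightarrow> set Ys \<subseteq> OmegaB_total P \<longrightarrow>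
        (\<forall>X\<in>OmegaB P i. \<forall>Y\<in>OmegaB P j.
           br (Xs @ X # Y # Ys) = pw (pw (scl P)) (- ((- 1) ^ (i * j))) (br (Xs @ Y # X # Ys))))) \<and>
    br [] = 0 \<and> (\<forall>Xs. 4 \<le> length Xs \<longrightarrow> br Xs = 0) \<and>
    (\<forall>X\<in>OmegaB_total P. br [X] = dBott P X) \<and>
    (\<forall>b\<in>GamB P. \<forall>b'\<in>GamB P. br [form0 b, form0 b'] = form0 (brkB P b b')) \<and>
    (\<exists>\<rho>1. is_rho1 P \<rho>1 \<and>
       (\<forall>i p j. \<forall>X\<in>OmegaB P i. \<forall>\<omega>\<in>Omega P p. \<forall>Y\<in>OmegaB P j.
          br [X, dotB P p j \<omega> Y] =
            dotB P (i + p) j (\<rho>1 X \<omega>) Y +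
            pw (pw (scl P)) ((- 1) ^ (p * i)) (dotB P p (i + j) \<omega> (br [X, Y])))) \<and>
    (\<forall>b\<in>GamB P. \<forall>b'\<in>GamB P. \<forall>b''\<in>GamB P. br [form0 b, form0 b', form0 b''] = 0) \<and>
    (\<exists>\<rho>2. is_rho2 P \<rho>2 \<and>
       (\<forall>i j p k. \<forall>X\<in>OmegaB P i. \<forall>Y\<in>OmegaB P j. \<forall>\<omega>\<in>Omega P p. \<forall>Z\<in>OmegaB P k.
          br [X, Y, dotB P p k \<omega> Z] =
            dotB P (i + j + (p - 1)) k (\<rho>2 X Y \<omega>) Z +
            pw (pw (scl P)) ((- 1) ^ (p * (i + j + 1)))
              (dotB P p (i + j + k - 1) \<omega> (br [X, Y, Z]))))"


section \<open>The action of derivations\<close>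

text \<open>\<open>act2 P i j \<delta> X Y\<close> is the formula for \<open>\<delta> \<triangleright> (X, Y)\<close> with \<open>X\<close> of degree \<open>i\<close> and \<open>Y\<close> of degree \<open>j\<close>.
  The shuffle sums with a negative index are omitted.\<close>

definition act2 ::
  "('m::{t2_space,second_countable_topology}, 'k::real_or_complex_field, 'v::ab_group_add)
     lie_pair \<Rightarrow> nat \<Rightarrow> nat \<Rightarrow> (('m \<Rightarrow> 'v) \<Rightarrow> 'm \<Rightarrow> 'v) \<Rightarrow> (('m \<Rightarrow> 'v) list \<Rightarrow> 'm \<Rightarrow> 'v)
    \<Rightarrow> (('m \<Rightarrow> 'v) list \<Rightarrow> 'm \<Rightarrow> 'v) \<Rightarrow> ('m \<Rightarrow> 'v) list \<Rightarrow> 'm \<Rightarrow> 'v" where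
  "act2 P i j \<delta> X Y = (\<lambda>as. let n = i + j - 1 in if i + j \<ge> 1 \<and> length as = n \<and> set as \<subseteq> GamA P
     then
       (if j \<ge> 1 then pw (scl P) ((- 1) ^ (i + 1))
          (\<Sum>\<sigma>\<in>Sh i (j - 1). pw (scl P) (of_int (sign \<sigma>))
             (Y (prA P (\<delta> (X (pick as \<sigma> 0 i))) # pick as \<sigma> i n)))
        else 0) +
       (if i \<ge> 1 then
          (\<Sum>\<sigma>\<in>Sh (i - 1) j. pw (scl P) (of_int (sign \<sigma>))
             (X (prA P (\<delta> (Y (pick as \<sigma> (i - 1) n))) # pick as \<sigma> 0 (i - 1))))
        else 0)
     else 0)"

text \<open>\<open>mu P \<delta> [X\<^sub>1, \<dots>, X\<^sub>n] = \<mu>\<^sub>n(\<delta>, X\<^sub>1, \<dots>, X\<^sub>n)\<close>. For inhomogeneous \<open>X\<close> and \<open>Y\<close> the value of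
  \<open>\<delta> \<triangleright> (X, Y)\<close> on \<open>n\<close> sections is the sum over the pairs of degrees \<open>(i, n + 1 - i)\<close>; since a form of
  degree \<open>i\<close> vanishes on lists of length other than \<open>i\<close>, \<open>act2\<close> selects the components by itself, and
  for \<open>X\<close> and \<open>Y\<close> homogeneous of degrees \<open>i\<close> and \<open>j\<close> the sum is \<open>act2 P i j \<delta> X Y\<close>.\<close>

definition mu ::
  "('m::{t2_space,second_countable_topology}, 'k::real_or_complex_field, 'v::ab_group_add)
     lie_pair \<Rightarrow> (('m \<Rightarrow> 'v) \<Rightarrow> 'm \<Rightarrow> 'v) \<Rightarrow> (('m \<Rightarrow> 'v) list \<Rightarrow> 'm \<Rightarrow> 'v) list
    \<Rightarrow> ('m \<Rightarrow> 'v) list \<Rightarrow> 'm \<Rightarrow> 'v" where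
  "mu P \<delta> Xs = (case Xs of
     [] \<Rightarrow> (\<lambda>as. if length as = 1 \<and> set as \<subseteq> GamA P then - prB P (\<delta> (as ! 0)) else 0)
   | [X] \<Rightarrow> (\<lambda>as. if set as \<subseteq> GamA P
       then - (\<Sum>j<length as. X (as[j := prA P (\<delta> (as ! j))])) + prB P (\<delta> (X as)) else 0)
   | [X, Y] \<Rightarrow> (\<lambda>as. \<Sum>i\<le>length as + 1. act2 P i (length as + 1 - i) \<delta> X Y as)
   | _ \<Rightarrow> 0)"


section \<open>Local Artinian algebras and tensor products\<close>

definition is_ideal :: "'a::comm_ring_1 set \<Rightarrow> bool" where
  "is_ideal I \<longleftrightarrow> 0 \<in> I \<and> (\<forall>x\<in>I. \<forall>y\<in>I. x + y \<in> I) \<and> (\<forall>r. \<forall>x\<in>I. r * x \<in> I)"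

definition is_maximal_ideal :: "'a::comm_ring_1 set \<Rightarrow> bool" where
  "is_maximal_ideal I \<longleftrightarrow>
    is_ideal I \<and> I \<noteq> UNIV \<and> (\<forall>J. is_ideal J \<and> I \<subseteq> J \<and> J \<noteq> UNIV \<longrightarrow> J = I)"

text \<open>\<open>\<iota>\<close> is the structure map of the algebra; in the last condition it induces an isomorphism of the
  ground field with the residue field.\<close>

definition local_artinian_algebra ::
  "('k::real_or_complex_field \<Rightarrow> 'a::comm_ring_1) \<Rightarrow> 'a set \<Rightarrow> bool" where
  "local_artinian_algebra \<iota> \<mm> \<longleftrightarrow>
    \<iota> 1 = 1 \<and> (\<forall>c d. \<iota> (c + d) = \<iota> c + \<iota> d) \<and> (\<forall>c d. \<iota> (c * d) = \<iota> c * \<iota> d) \<and>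
    is_maximal_ideal \<mm> \<and> (\<forall>J. is_maximal_ideal J \<longrightarrow> J = \<mm>) \<and>
    (\<forall>I :: nat \<Rightarrow> 'a set. (\<forall>n. is_ideal (I n) \<and> I (Suc n) \<subseteq> I n) \<longrightarrow>
       (\<exists>N. \<forall>n\<ge>N. I n = I N)) \<and>
    (\<forall>x. \<exists>!c. x - \<iota> c \<in> \<mm>)"

text \<open>For a \<open>'k\<close>-vector space \<open>V\<close> with scalar multiplication \<open>s\<close>, the tensor product of \<open>V\<close> with \<open>\<mm>\<close>
  is realised inside the linear maps from the dual of the algebra to \<open>V\<close>, the simple tensor of \<open>w\<close> and
  \<open>t\<close> being the map sending \<open>\<phi>\<close> to \<open>\<phi>(t) w\<close>. Over a field this map from the abstract tensor product is
  injective; see \<open>tensor_universal\<close> below.\<close>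

definition dual_space :: "('k::field \<Rightarrow> 'a::comm_ring_1) \<Rightarrow> ('a \<Rightarrow> 'k) set" where
  "dual_space \<iota> = {\<phi>. (\<forall>x y. \<phi> (x + y) = \<phi> x + \<phi> y) \<and> (\<forall>c x. \<phi> (\<iota> c * x) = c * \<phi> x)}"

definition tpure ::
  "('k::field \<Rightarrow> 'a::comm_ring_1) \<Rightarrow> ('k \<Rightarrow> 'w \<Rightarrow> 'w) \<Rightarrow> 'w::ab_group_add \<Rightarrow> 'a
    \<Rightarrow> ('a \<Rightarrow> 'k) \<Rightarrow> 'w" where
  "tpure \<iota> s w t = (\<lambda>\<phi>. if \<phi> \<in> dual_space \<iota> then s (\<phi> t) w else 0)"

definition represents ::
  "('k::field \<Rightarrow> 'a::comm_ring_1) \<Rightarrow> ('k \<Rightarrow> 'w \<Rightarrow> 'w) \<Rightarrow> 'w::ab_group_add set \<Rightarrow> 'a set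
    \<Rightarrow> ('w \<times> 'a) list \<Rightarrow> (('a \<Rightarrow> 'k) \<Rightarrow> 'w) \<Rightarrow> bool" where
  "represents \<iota> s V \<mm> ps X \<longleftrightarrow> set ps \<subseteq> V \<times> \<mm> \<and> X = (\<Sum>(w, t)\<leftarrow>ps. tpure \<iota> s w t)"

definition tensor ::
  "('k::field \<Rightarrow> 'a::comm_ring_1) \<Rightarrow> ('k \<Rightarrow> 'w \<Rightarrow> 'w) \<Rightarrow> 'w::ab_group_add set \<Rightarrow> 'a set
    \<Rightarrow> (('a \<Rightarrow> 'k) \<Rightarrow> 'w) set" where
  "tensor \<iota> s V \<mm> = {X. \<exists>ps. represents \<iota> s V \<mm> ps X}"

lemma tensor_universal:
  fixes \<iota> :: "'k::field \<Rightarrow> 'a::comm_ring_1" and s :: "'k \<Rightarrow> 'w::ab_group_add \<Rightarrow> 'w"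
    and Q :: "'w \<Rightarrow> 'a \<Rightarrow> 'y::ab_group_add"
  assumes A: "vector_space (\<lambda>c x. \<iota> c * x)" and V: "vector_space s"
    and addw: "\<And>w w' t. Q (w + w') t = Q w t + Q w' t"
    and addt: "\<And>w t t'. Q w (t + t') = Q w t + Q w t'"
    and bal: "\<And>c w t. Q (s c w) t = Q w (\<iota> c * t)"
    and zero: "(\<Sum>(w, t)\<leftarrow>ps. tpure \<iota> s w t) = 0"
  shows "(\<Sum>(w, t)\<leftarrow>ps. Q w t) = 0"
proof -
  interpret A: vector_space "\<lambda>c x. \<iota> c * x" by (rule A)
  define Bs where "Bs = A.extend_basis {}"
  have ind: "A.independent Bs" and spn: "A.span Bs = UNIV"
    using A.independent_empty A.independent_extend_basis A.span_extend_basis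
    by (auto simp: Bs_def)
  define cf where "cf = (\<lambda>b t. A.representation Bs t b)"
  have dual: "cf b \<in> dual_space \<iota>" for b
    by (simp add: dual_space_def cf_def A.representation_add A.representation_scale ind spn)
  define F where "F = (\<Union>(w, t)\<in>set ps. {b. cf b t \<noteq> 0})"
  have fin: "finite F"
    by (auto simp: F_def cf_def A.finite_representation)
  have dec: "t = (\<Sum>b\<in>F. \<iota> (cf b t) * b)" if "(w, t) \<in> set ps" for w t
  proof -
    have "(\<Sum>b\<in>F. \<iota> (cf b t) * b) = (\<Sum>b | A.representation Bs t b \<noteq> 0. \<iota> (cf b t) * b)"
      by (rule sum.mono_neutral_right[OF fin])
         (use that in \<open>fastforce simp: F_def cf_def\<close>)+
    then show ?thesis
      using A.sum_nonzero_representation_eq[OF ind, of t] spn by (simp add: cf_def)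
  qed
  have Q0: "Q 0 t = 0" for t using addw[of 0 0 t] by simp
  have Qt0: "Q w 0 = 0" for w using addt[of w 0 0] by simp
  have Qsum: "Q w (\<Sum>b\<in>F. g b) = (\<Sum>b\<in>F. Q w (g b))" for w g
    by (induction F rule: infinite_finite_induct) (auto simp: addt Qt0)
  have Qlist: "(\<Sum>(w, t)\<leftarrow>qs. Q (s (cf b t) w) b) = Q (\<Sum>(w, t)\<leftarrow>qs. s (cf b t) w) b" for qs b
    by (induction qs) (auto simp: addw Q0)
  have z: "(\<Sum>(w, t)\<leftarrow>ps. s (cf b t) w) = 0" for b
  proof -
    have "(\<Sum>(w, t)\<leftarrow>qs. tpure \<iota> s w t) (cf b) = (\<Sum>(w, t)\<leftarrow>qs. s (cf b t) w)" for qs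
      by (induction qs) (auto simp: tpure_def dual)
    from this[of ps] show ?thesis using zero by simp
  qed
  have sw: "(\<Sum>(w, t)\<leftarrow>qs. \<Sum>b\<in>F. Q (s (cf b t) w) b) =
      (\<Sum>b\<in>F. \<Sum>(w, t)\<leftarrow>qs. Q (s (cf b t) w) b)" for qs
    by (induction qs) (auto simp: sum.distrib)
  have "(\<Sum>(w, t)\<leftarrow>ps. Q w t) = (\<Sum>(w, t)\<leftarrow>ps. \<Sum>b\<in>F. Q (s (cf b t) w) b)"
  proof (rule arg_cong[of _ _ sum_list], rule map_cong[OF refl], clarsimp)
    fix w t assume wt: "(w, t) \<in> set ps"
    have "Q w t = Q w (\<Sum>b\<in>F. \<iota> (cf b t) * b)" using dec[OF wt] by simp
    also have "\<dots> = (\<Sum>b\<in>F. Q (s (cf b t) w) b)" by (simp add: Qsum bal)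
    finally show "Q w t = (\<Sum>b\<in>F. Q (s (cf b t) w) b)" .
  qed
  also have "\<dots> = 0" by (simp add: sw Qlist z Q0)
  finally show ?thesis .
qed

text \<open>Some decomposition of a tensor into simple ones. The multilinear extensions below do not depend
  on its choice.\<close>

definition trep ::
  "('k::field \<Rightarrow> 'a::comm_ring_1) \<Rightarrow> ('k \<Rightarrow> 'w \<Rightarrow> 'w) \<Rightarrow> 'w::ab_group_add set \<Rightarrow> 'a set
    \<Rightarrow> (('a \<Rightarrow> 'k) \<Rightarrow> 'w) \<Rightarrow> ('w \<times> 'a) list" where
  "trep \<iota> s V \<mm> X = (SOME ps. represents \<iota> s V \<mm> ps X)"

definition text1 ::
  "('k::field \<Rightarrow> 'a::comm_ring_1) \<Rightarrow> 'a set \<Rightarrow> ('k \<Rightarrow> 'w \<Rightarrow> 'w) \<Rightarrow> 'w::ab_group_add set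
    \<Rightarrow> ('k \<Rightarrow> 'y \<Rightarrow> 'y) \<Rightarrow> ('w \<Rightarrow> 'y::ab_group_add) \<Rightarrow> (('a \<Rightarrow> 'k) \<Rightarrow> 'w) \<Rightarrow> ('a \<Rightarrow> 'k) \<Rightarrow> 'y" where
  "text1 \<iota> \<mm> s V s' op X = (\<Sum>(w, t)\<leftarrow>trep \<iota> s V \<mm> X. tpure \<iota> s' (op w) t)"

text \<open>\<open>[w\<^sub>1 \<otimes> t\<^sub>1, \<dots>, w\<^sub>n \<otimes> t\<^sub>n] = [w\<^sub>1, \<dots>, w\<^sub>n] \<otimes> t\<^sub>1 \<cdots> t\<^sub>n\<close>\<close>

definition br_ext ::
  "('m::{t2_space,second_countable_topology}, 'k::real_or_complex_field, 'v::ab_group_add)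
     lie_pair \<Rightarrow> ('k \<Rightarrow> 'a::comm_ring_1) \<Rightarrow> 'a set
    \<Rightarrow> ((('m \<Rightarrow> 'v) list \<Rightarrow> 'm \<Rightarrow> 'v) list \<Rightarrow> ('m \<Rightarrow> 'v) list \<Rightarrow> 'm \<Rightarrow> 'v)
    \<Rightarrow> (('a \<Rightarrow> 'k) \<Rightarrow> ('m \<Rightarrow> 'v) list \<Rightarrow> 'm \<Rightarrow> 'v) list
    \<Rightarrow> ('a \<Rightarrow> 'k) \<Rightarrow> ('m \<Rightarrow> 'v) list \<Rightarrow> 'm \<Rightarrow> 'v" where
  "br_ext P \<iota> \<mm> br Xs =
    (\<Sum>ps\<leftarrow>product_lists (map (trep \<iota> (pw (pw (scl P))) (OmegaB_total P) \<mm>) Xs).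
       tpure \<iota> (pw (pw (scl P))) (br (map fst ps)) (prod_list (map snd ps)))"

definition mu_ext ::
  "('m::{t2_space,second_countable_topology}, 'k::real_or_complex_field, 'v::ab_group_add)
     lie_pair \<Rightarrow> ('k \<Rightarrow> 'a::comm_ring_1) \<Rightarrow> 'a set
    \<Rightarrow> (('a \<Rightarrow> 'k) \<Rightarrow> ('m \<Rightarrow> 'v) \<Rightarrow> 'm \<Rightarrow> 'v)
    \<Rightarrow> (('a \<Rightarrow> 'k) \<Rightarrow> ('m \<Rightarrow> 'v) list \<Rightarrow> 'm \<Rightarrow> 'v) list
    \<Rightarrow> ('a \<Rightarrow> 'k) \<Rightarrow> ('m \<Rightarrow> 'v) list \<Rightarrow> 'm \<Rightarrow> 'v" where
  "mu_ext P \<iota> \<mm> h Xs =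
    (\<Sum>(\<delta>, t)\<leftarrow>trep \<iota> (pw (pw (scl P))) (DerL P) \<mm> h.
       \<Sum>ps\<leftarrow>product_lists (map (trep \<iota> (pw (pw (scl P))) (OmegaB_total P) \<mm>) Xs).
         tpure \<iota> (pw (pw (scl P))) (mu P \<delta> (map fst ps)) (t * prod_list (map snd ps)))"

definition ad_ext ::
  "('m::{t2_space,second_countable_topology}, 'k::real_or_complex_field, 'v::ab_group_add)
     lie_pair \<Rightarrow> ('k \<Rightarrow> 'a::comm_ring_1) \<Rightarrow> 'a set
    \<Rightarrow> (('a \<Rightarrow> 'k) \<Rightarrow> 'm \<Rightarrow> 'v) \<Rightarrow> ('a \<Rightarrow> 'k) \<Rightarrow> ('m \<Rightarrow> 'v) \<Rightarrow> 'm \<Rightarrow> 'v" where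
  "ad_ext P \<iota> \<mm> b = text1 \<iota> \<mm> (pw (scl P)) (GamB P) (pw (pw (scl P))) (ad P) b"

text \<open>The identification of \<open>\<Gamma>(B) \<otimes> \<mm>\<close> with \<open>\<gg>\<^sup>0 \<otimes> \<mm>\<close>.\<close>

definition form0_ext ::
  "('m::{t2_space,second_countable_topology}, 'k::real_or_complex_field, 'v::ab_group_add)
     lie_pair \<Rightarrow> ('k \<Rightarrow> 'a::comm_ring_1) \<Rightarrow> 'a set
    \<Rightarrow> (('a \<Rightarrow> 'k) \<Rightarrow> 'm \<Rightarrow> 'v) \<Rightarrow> ('a \<Rightarrow> 'k) \<Rightarrow> ('m \<Rightarrow> 'v) list \<Rightarrow> 'm \<Rightarrow> 'v" where
  "form0_ext P \<iota> \<mm> b = text1 \<iota> \<mm> (pw (scl P)) (GamB P) (pw (pw (scl P))) form0 b"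


section \<open>Maurer--Cartan elements and the gauge actions\<close>

text \<open>Sums over all natural numbers are taken with \<open>Sum_any\<close>. They have finitely many nonzero terms:
  \<open>br\<close> and \<open>mu\<close> vanish on long lists, and \<open>\<mm>\<close> is nilpotent.\<close>

definition MC ::
  "('m::{t2_space,second_countable_topology}, 'k::real_or_complex_field, 'v::ab_group_add)
     lie_pair \<Rightarrow> ('k \<Rightarrow> 'a::comm_ring_1) \<Rightarrow> 'a set
    \<Rightarrow> ((('m \<Rightarrow> 'v) list \<Rightarrow> 'm \<Rightarrow> 'v) list \<Rightarrow> ('m \<Rightarrow> 'v) list \<Rightarrow> 'm \<Rightarrow> 'v)
    \<Rightarrow> (('a \<Rightarrow> 'k) \<Rightarrow> ('m \<Rightarrow> 'v) list \<Rightarrow> 'm \<Rightarrow> 'v) set" where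
  "MC P \<iota> \<mm> br = {\<xi> \<in> tensor \<iota> (pw (pw (scl P))) (OmegaB P 1) \<mm>.
     Sum_any (\<lambda>k. if k \<ge> 1
       then pw (pw (pw (scl P))) (1 / fact k) (br_ext P \<iota> \<mm> br (replicate k \<xi>)) else 0) = 0}"

definition twisted_br ::
  "('m::{t2_space,second_countable_topology}, 'k::real_or_complex_field, 'v::ab_group_add)
     lie_pair \<Rightarrow> ('k \<Rightarrow> 'a::comm_ring_1) \<Rightarrow> 'a set
    \<Rightarrow> ((('m \<Rightarrow> 'v) list \<Rightarrow> 'm \<Rightarrow> 'v) list \<Rightarrow> ('m \<Rightarrow> 'v) list \<Rightarrow> 'm \<Rightarrow> 'v)
    \<Rightarrow> (('a \<Rightarrow> 'k) \<Rightarrow> ('m \<Rightarrow> 'v) list \<Rightarrow> 'm \<Rightarrow> 'v)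
    \<Rightarrow> (('a \<Rightarrow> 'k) \<Rightarrow> ('m \<Rightarrow> 'v) list \<Rightarrow> 'm \<Rightarrow> 'v) list
    \<Rightarrow> ('a \<Rightarrow> 'k) \<Rightarrow> ('m \<Rightarrow> 'v) list \<Rightarrow> 'm \<Rightarrow> 'v" where
  "twisted_br P \<iota> \<mm> br \<xi> gs =
    Sum_any (\<lambda>k. pw (pw (pw (scl P))) (1 / fact k) (br_ext P \<iota> \<mm> br (replicate k \<xi> @ gs)))"

definition twisted_mu ::
  "('m::{t2_space,second_countable_topology}, 'k::real_or_complex_field, 'v::ab_group_add)
     lie_pair \<Rightarrow> ('k \<Rightarrow> 'a::comm_ring_1) \<Rightarrow> 'a set
    \<Rightarrow> (('a \<Rightarrow> 'k) \<Rightarrow> ('m \<Rightarrow> 'v) list \<Rightarrow> 'm \<Rightarrow> 'v)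
    \<Rightarrow> (('a \<Rightarrow> 'k) \<Rightarrow> ('m \<Rightarrow> 'v) \<Rightarrow> 'm \<Rightarrow> 'v)
    \<Rightarrow> (('a \<Rightarrow> 'k) \<Rightarrow> ('m \<Rightarrow> 'v) list \<Rightarrow> 'm \<Rightarrow> 'v) list
    \<Rightarrow> ('a \<Rightarrow> 'k) \<Rightarrow> ('m \<Rightarrow> 'v) list \<Rightarrow> 'm \<Rightarrow> 'v" where
  "twisted_mu P \<iota> \<mm> \<xi> h gs =
    Sum_any (\<lambda>j. pw (pw (pw (scl P))) ((- 1) ^ j / fact j) (mu_ext P \<iota> \<mm> h (replicate j \<xi> @ gs)))"

definition compositions :: "nat \<Rightarrow> nat \<Rightarrow> nat list set" where
  "compositions n k = {ks. length ks = n \<and> sum_list ks = k \<and> (\<forall>j\<in>set ks. 1 \<le> j)}"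

text \<open>The recursion common to \<open>e\<^sup>k\<^sub>\<xi>(b)\<close> and \<open>e\<^sup>k\<^sub>\<xi>(h)\<close>, for \<open>k \<ge> 1\<close>; \<open>F [g\<^sub>1, \<dots>, g\<^sub>n]\<close> stands for
  \<open>[b, g\<^sub>1, \<dots>, g\<^sub>n]\<^sup>\<xi>\<close> in the first case and for the sum over \<open>j\<close> of
  \<open>(- 1)\<^sup>j / j! h \<triangleright> (\<xi>, \<dots>, \<xi>, g\<^sub>1, \<dots>, g\<^sub>n)\<close> in the second. The first term is \<open>F []\<close>, where \<open>j = 0\<close>
  contributes \<open>\<mu>\<^sub>0 = \<kappa>\<close> in the second case.\<close>

declare sum.cong [fundef_cong]

function gauge_term ::
  "('k::field_char_0 \<Rightarrow> 't \<Rightarrow> 't) \<Rightarrow> ('t list \<Rightarrow> 't) \<Rightarrow> nat \<Rightarrow> 't::ab_group_add" where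
  "gauge_term s F 0 = 0"
| "gauge_term s F (Suc k) =
    (if k = 0 then F []
     else \<Sum>n=1..k. s (1 / fact n)
       (\<Sum>ks\<in>compositions n k. s (fact k / prod_list (map fact ks)) (F (map (gauge_term s F) ks))))"
  by pat_completeness auto
termination
  by (relation "Wellfounded.measure (\<lambda>(s, F, k). k)")
     (auto simp: compositions_def less_Suc_eq_le dest: member_le_sum_list)

declare sum.cong [fundef_cong del]

definition gauge_act ::
  "('m::{t2_space,second_countable_topology}, 'k::real_or_complex_field, 'v::ab_group_add)
     lie_pair \<Rightarrow> ('k \<Rightarrow> 'a::comm_ring_1) \<Rightarrow> 'a set
    \<Rightarrow> ((('m \<Rightarrow> 'v) list \<Rightarrow> 'm \<Rightarrow> 'v) list \<Rightarrow> ('m \<Rightarrow> 'v) list \<Rightarrow> 'm \<Rightarrow> 'v)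
    \<Rightarrow> (('a \<Rightarrow> 'k) \<Rightarrow> 'm \<Rightarrow> 'v) \<Rightarrow> (('a \<Rightarrow> 'k) \<Rightarrow> ('m \<Rightarrow> 'v) list \<Rightarrow> 'm \<Rightarrow> 'v)
    \<Rightarrow> ('a \<Rightarrow> 'k) \<Rightarrow> ('m \<Rightarrow> 'v) list \<Rightarrow> 'm \<Rightarrow> 'v" where
  "gauge_act P \<iota> \<mm> br b \<xi> = \<xi> - Sum_any (\<lambda>k. if k \<ge> 1
     then pw (pw (pw (scl P))) (1 / fact k)
       (gauge_term (pw (pw (pw (scl P))))
          (\<lambda>gs. twisted_br P \<iota> \<mm> br \<xi> (form0_ext P \<iota> \<mm> b # gs)) k)
     else 0)"

definition der_gauge_act ::
  "('m::{t2_space,second_countable_topology}, 'k::real_or_complex_field, 'v::ab_group_add)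
     lie_pair \<Rightarrow> ('k \<Rightarrow> 'a::comm_ring_1) \<Rightarrow> 'a set
    \<Rightarrow> (('a \<Rightarrow> 'k) \<Rightarrow> ('m \<Rightarrow> 'v) \<Rightarrow> 'm \<Rightarrow> 'v) \<Rightarrow> (('a \<Rightarrow> 'k) \<Rightarrow> ('m \<Rightarrow> 'v) list \<Rightarrow> 'm \<Rightarrow> 'v)
    \<Rightarrow> ('a \<Rightarrow> 'k) \<Rightarrow> ('m \<Rightarrow> 'v) list \<Rightarrow> 'm \<Rightarrow> 'v" where
  "der_gauge_act P \<iota> \<mm> h \<xi> = \<xi> - Sum_any (\<lambda>k. if k \<ge> 1
     then pw (pw (pw (scl P))) (1 / fact k)
       (gauge_term (pw (pw (pw (scl P)))) (twisted_mu P \<iota> \<mm> \<xi> h) k)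
     else 0)"

end

theory Submission
  imports Defs
begin

text \<open>
  Both gauge actions are given by the same recursion, with \<open>[b, g\<^sub>1, \<dots>, g\<^sub>n]\<^sup>\<xi>\<close> as input in one case and
  \<open>\<Sum>\<^sub>j (- 1)\<^sup>j / j! ad\<^sub>b \<triangleright> (\<xi>, \<dots>, \<xi>, g\<^sub>1, \<dots>, g\<^sub>n)\<close> in the other. Since \<open>\<xi>\<close> has degree 1, so have all the
  \<open>g\<^sub>i\<close>, and it suffices to compare the two inputs on elements of degree 1 (\<open>gauge_term_cong\<close>). They
  agree summand by summand, because of the identity
  \<open>[b, X\<^sub>1, \<dots>, X\<^sub>n] = ad\<^sub>b \<triangleright> (X\<^sub>1, \<dots>, X\<^sub>n)\<close> for \<open>b \<in> \<Gamma>(B)\<close> and \<open>X\<^sub>i \<in> \<Omega>\<^sub>A\<^sup>1(B)\<close> (\<open>bracket_eq_action\<close>):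
  by graded skew-symmetry, moving \<open>b\<close>, of degree 0, past \<open>j\<close> copies of \<open>\<xi>\<close> produces the sign \<open>(- 1)\<^sup>j\<close>.

  The identity has content for \<open>n \<le> 2\<close> only. For \<open>n = 0\<close> it says \<open>\<nabla>\<^sub>a b = - pr\<^sub>B [b, a]\<close>. For \<open>n = 1, 2\<close>
  the bracket is known on simple tensors \<open>\<lambda> \<otimes> b'\<close>, by its Leibniz rule and its values on \<open>\<Gamma>(B)\<close>, and
  there the Leibniz rule of \<open>[\<cdot>, \<cdot>]\<^sub>L\<close> gives the same value for the action. In general, the difference of
  the two sides is \<open>C\<^sup>\<infinity>\<close>-linear in every \<open>X\<^sub>i\<close>, because the terms containing the derivative
  \<open>\<rho>\<^sub>L(b) f\<close> of a function cancel. A \<open>C\<^sup>\<infinity>\<close>-linear operator that kills simple tensors is zero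
  (\<open>tensorial_vanishes\<close>): near a point every form is a finite sum of simple tensors, and a cut-off
  function makes this decomposition global (\<open>local_decomposition\<close>). The first two parts provide
  the cut-off functions, together with the calculus needed for them.

  The extensions to \<open>\<gg> \<otimes> \<mm>\<close> are defined by means of unspecified decompositions into simple tensors,
  whose entries need not be homogeneous. By multilinearity the decompositions can be exchanged
  (\<open>ext_sum_well_defined\<close>), and for decompositions with entries of degree 1 the identity applies
  (\<open>br_ext_eq_mu_ext\<close>).
\<close>

section \<open>Calculus on open subsets of \<open>\<real>\<^sup>n\<close>\<close>

text \<open>A neighbourhood in the product topology constrains finitely many coordinates, and on \<open>Rn n\<close>
  only the first \<open>n\<close> coordinates vary. So the cubes used in the definition of partial derivatives
  describe limits within subsets of \<open>Rn n\<close>, and the calculus of limits becomes available.\<close>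

lemma eventually_at_within_Rn:
  assumes S: "S \<subseteq> Rn n" and x: "x \<in> S"
  shows "eventually Q (at x within S) \<longleftrightarrow>
    (\<exists>d>0. \<forall>y\<in>S. y \<noteq> x \<longrightarrow> (\<forall>i<n. \<bar>y i - x i\<bar> < d) \<longrightarrow> Q y)"
proof
  assume "eventually Q (at x within S)"
  then obtain T where T: "open T" "x \<in> T" "\<forall>y\<in>T. y \<noteq> x \<longrightarrow> y \<in> S \<longrightarrow> Q y"
    by (auto simp: eventually_at_topological)
  have "openin (product_topology (\<lambda>i. euclidean) UNIV) T"
    using T(1) by (simp add: open_fun_def)
  from product_topology_open_contains_basis[OF this T(2)]
  obtain X where X: "x \<in> (\<Pi>\<^sub>E i\<in>UNIV. X i)" "\<And>i. open (X i)" "(\<Pi>\<^sub>E i\<in>UNIV. X i) \<subseteq> T"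
    by auto
  have "\<exists>d>0. \<forall>z. \<bar>z - x i\<bar> < d \<longrightarrow> z \<in> X i" for i
    using X(1) X(2)[of i] by (auto simp: open_dist dist_real_def PiE_iff)
  then obtain d where d: "\<And>i. d i > 0" "\<And>i z. \<bar>z - x i\<bar> < d i \<Longrightarrow> z \<in> X i" by metis
  define e where "e = Min (insert 1 (d ` {..<n}))"
  have e: "e > 0" "\<And>i. i < n \<Longrightarrow> e \<le> d i" using d(1) by (auto simp: e_def)
  show "\<exists>d>0. \<forall>y\<in>S. y \<noteq> x \<longrightarrow> (\<forall>i<n. \<bar>y i - x i\<bar> < d) \<longrightarrow> Q y"
  proof (intro exI conjI ballI impI)
    show "e > 0" by (rule e)
    fix y assume y: "y \<in> S" "y \<noteq> x" "\<forall>i<n. \<bar>y i - x i\<bar> < e"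
    have "y i \<in> X i" for i
    proof (cases "i < n")
      case True then show ?thesis using y(3) e(2)[of i] d(2)[of "y i" i] by force
    next
      case False
      have "y \<in> Rn n" "x \<in> Rn n" using y(1) x S by auto
      then have "y i = x i" using False by (simp add: Rn_def)
      then show ?thesis using d by simp
    qed
    then have "y \<in> T" using X(3) by (auto simp: PiE_iff)
    then show "Q y" using T(3) y by auto
  qed
next
  assume "\<exists>d>0. \<forall>y\<in>S. y \<noteq> x \<longrightarrow> (\<forall>i<n. \<bar>y i - x i\<bar> < d) \<longrightarrow> Q y"
  then obtain d where d: "d > 0" "\<And>y. y \<in> S \<Longrightarrow> y \<noteq> x \<Longrightarrow> \<forall>i<n. \<bar>y i - x i\<bar> < d \<Longrightarrow> Q y" by blast
  define T where "T = (\<Inter>i<n. {y. \<bar>y i - x i\<bar> < d})"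
  have "open {y. \<bar>y i - x i\<bar> < d}" for i
    by (intro open_Collect_less continuous_intros) auto
  then have "open T" by (auto simp: T_def)
  moreover have "x \<in> T" using d by (auto simp: T_def)
  ultimately show "eventually Q (at x within S)"
    unfolding eventually_at_topological using d(2) by (intro exI[of _ T]) (auto simp: T_def)
qed

definition l1 :: "nat \<Rightarrow> (nat \<Rightarrow> real) \<Rightarrow> (nat \<Rightarrow> real) \<Rightarrow> real" where
  "l1 n x y = (\<Sum>i<n. \<bar>y i - x i\<bar>)"

lemma l1_nonneg: "l1 n x y \<ge> 0" by (simp add: l1_def sum_nonneg)

lemma l1_pos:
  assumes "x \<in> Rn n" "y \<in> Rn n" "y \<noteq> x" shows "l1 n x y > 0"
proof -
  obtain i where i: "y i \<noteq> x i" using assms(3) by auto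
  have "i < n" using assms(1,2) i by (auto simp: Rn_def) (metis not_less)
  have "0 < \<bar>y i - x i\<bar>" using i by simp
  also have "\<dots> \<le> l1 n x y" unfolding l1_def
    using \<open>i < n\<close> by (intro member_le_sum) auto
  finally show ?thesis .
qed

lemma has_partials_at_iff_tendsto:
  fixes f :: "(nat \<Rightarrow> real) \<Rightarrow> 'w::real_normed_vector"
  assumes S: "S \<subseteq> Rn n" and x: "x \<in> S"
  shows "has_partials_at n S f D x \<longleftrightarrow>
    ((\<lambda>y. (f y - f x - (\<Sum>i<n. (y i - x i) *\<^sub>R D i x)) /\<^sub>R l1 n x y) \<longlongrightarrow> 0) (at x within S)"
    (is "_ \<longleftrightarrow> (?q \<longlongrightarrow> 0) _")
proof
  assume *: "has_partials_at n S f D x"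
  show "(?q \<longlongrightarrow> 0) (at x within S)"
  proof (rule tendstoI)
    fix e :: real assume e: "e > 0"
    obtain d where d: "d > 0" "\<And>y. y \<in> S \<Longrightarrow> \<forall>i<n. \<bar>y i - x i\<bar> < d \<Longrightarrow>
       norm (f y - f x - (\<Sum>i<n. (y i - x i) *\<^sub>R D i x)) \<le> (e/2) * l1 n x y"
      using *[unfolded has_partials_at_def, rule_format, of "e/2"] e by (auto simp: l1_def)
    show "eventually (\<lambda>y. dist (?q y) 0 < e) (at x within S)"
      unfolding eventually_at_within_Rn[OF S x]
    proof (intro exI conjI ballI impI)
      fix y assume y: "y \<in> S" "y \<noteq> x" "\<forall>i<n. \<bar>y i - x i\<bar> < d"
      have p: "l1 n x y > 0" using l1_pos y x S by blast
      have "norm (?q y) \<le> e/2"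
        using d(2)[OF y(1,3)] p by (simp add: divide_simps)
      then show "dist (?q y) 0 < e" using e by simp
    qed (rule d)
  qed
next
  assume *: "(?q \<longlongrightarrow> 0) (at x within S)"
  show "has_partials_at n S f D x"
    unfolding has_partials_at_def
  proof (intro allI impI)
    fix e :: real assume e: "e > 0"
    from tendstoD[OF * e] obtain d where d: "d > 0"
      "\<And>y. y \<in> S \<Longrightarrow> y \<noteq> x \<Longrightarrow> \<forall>i<n. \<bar>y i - x i\<bar> < d \<Longrightarrow> norm (?q y) < e"
      unfolding eventually_at_within_Rn[OF S x] by auto
    show "\<exists>d>0. \<forall>y\<in>S. (\<forall>i<n. \<bar>y i - x i\<bar> < d) \<longrightarrow>
       norm (f y - f x - (\<Sum>i<n. (y i - x i) *\<^sub>R D i x)) \<le> e * (\<Sum>i<n. \<bar>y i - x i\<bar>)"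
    proof (intro exI conjI ballI impI)
      fix y assume y: "y \<in> S" "\<forall>i<n. \<bar>y i - x i\<bar> < d"
      show "norm (f y - f x - (\<Sum>i<n. (y i - x i) *\<^sub>R D i x)) \<le> e * (\<Sum>i<n. \<bar>y i - x i\<bar>)"
      proof (cases "y = x")
        case False
        have p: "l1 n x y > 0" using l1_pos y x S False by blast
        then show ?thesis using d(2)[OF y(1) False y(2)] by (simp add: divide_simps flip: l1_def)
      qed simp
    qed (rule d)
  qed
qed

lemma tendsto_l1:
  assumes "S \<subseteq> Rn n" "x \<in> S" shows "(l1 n x \<longlongrightarrow> 0) (at x within S)"
proof -
  have "((\<lambda>y. \<Sum>i<n. \<bar>y i - x i\<bar>) \<longlongrightarrow> (\<Sum>i<n. \<bar>x i - x i\<bar>)) (at x within S)"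
  proof (intro tendsto_intros)
    fix i :: nat
    have "continuous_on S (\<lambda>y::nat \<Rightarrow> real. y i)"
      by (rule continuous_on_subset[OF continuous_on_product_coordinates]) auto
    then show "((\<lambda>y. y i) \<longlongrightarrow> x i) (at x within S)" using assms by (auto simp: continuous_on_def)
  qed
  then show ?thesis by (simp add: l1_def[abs_def])
qed

lemma norm_linear_part_le:
  "norm (\<Sum>i<n. (y i - x i) *\<^sub>R D i) \<le> l1 n x y * (\<Sum>i<n. norm (D i))"
proof -
  have "norm (\<Sum>i<n. (y i - x i) *\<^sub>R D i) \<le> (\<Sum>i<n. \<bar>y i - x i\<bar> * norm (D i))"
    by (rule order_trans[OF norm_sum]) simp
  also have "\<dots> \<le> (\<Sum>i<n. \<bar>y i - x i\<bar> * (\<Sum>i<n. norm (D i)))"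
    by (intro sum_mono mult_left_mono member_le_sum) auto
  finally show ?thesis by (simp add: l1_def sum_distrib_right)
qed

lemma has_partials_at_bounded_quotient:
  fixes f :: "(nat \<Rightarrow> real) \<Rightarrow> 'w::real_normed_vector"
  assumes S: "S \<subseteq> Rn n" and x: "x \<in> S" and D: "has_partials_at n S f D x"
  shows "\<exists>K. eventually (\<lambda>y. norm (f y - f x) \<le> K * l1 n x y) (at x within S)"
proof
  let ?L = "\<lambda>y. \<Sum>i<n. (y i - x i) *\<^sub>R D i x"
  from D[unfolded has_partials_at_def, rule_format, of 1] obtain d where d: "d > 0"
    "\<And>y. y \<in> S \<Longrightarrow> \<forall>i<n. \<bar>y i - x i\<bar> < d \<Longrightarrow> norm (f y - f x - ?L y) \<le> l1 n x y"
    by (auto simp: l1_def)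
  show "eventually (\<lambda>y. norm (f y - f x) \<le> (1 + (\<Sum>i<n. norm (D i x))) * l1 n x y) (at x within S)"
    unfolding eventually_at_within_Rn[OF S x]
  proof (intro exI conjI ballI impI)
    fix y assume y: "y \<in> S" "\<forall>i<n. \<bar>y i - x i\<bar> < d"
    have "norm (f y - f x) \<le> norm (f y - f x - ?L y) + norm (?L y)"
      using norm_triangle_ineq[of "f y - f x - ?L y" "?L y"] by simp
    also have "\<dots> \<le> l1 n x y + l1 n x y * (\<Sum>i<n. norm (D i x))"
      using d(2)[OF y] norm_linear_part_le by (intro add_mono) auto
    finally show "norm (f y - f x) \<le> (1 + (\<Sum>i<n. norm (D i x))) * l1 n x y"
      by (simp add: algebra_simps)
  qed (rule d)
qed

lemma has_partials_at_imp_tendsto: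
  fixes f :: "(nat \<Rightarrow> real) \<Rightarrow> 'w::real_normed_vector"
  assumes S: "S \<subseteq> Rn n" and x: "x \<in> S" and D: "has_partials_at n S f D x"
  shows "(f \<longlongrightarrow> f x) (at x within S)"
proof -
  obtain K where K: "eventually (\<lambda>y. norm (f y - f x) \<le> K * l1 n x y) (at x within S)"
    using has_partials_at_bounded_quotient[OF assms] by blast
  have "((\<lambda>y. K * l1 n x y) \<longlongrightarrow> K * 0) (at x within S)"
    by (intro tendsto_intros tendsto_l1 S x)
  then have "((\<lambda>y. f y - f x) \<longlongrightarrow> 0) (at x within S)"
    using K by (intro Lim_null_comparison[OF K]) simp
  then show ?thesis by (simp add: LIM_zero_iff)
qed

lemma Ck_on_Suc_imp_continuous:
  assumes "S \<subseteq> Rn n" "Ck_on n (Suc k) S f" shows "continuous_on S f"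
proof -
  obtain D where "\<forall>x\<in>S. has_partials_at n S f D x" using assms(2) by auto
  then show ?thesis unfolding continuous_on_def
    using has_partials_at_imp_tendsto[OF assms(1)] by blast
qed

lemma Ck_on_SucD: "S \<subseteq> Rn n \<Longrightarrow> Ck_on n (Suc k) S f \<Longrightarrow> Ck_on n k S f"
proof (induction k arbitrary: f)
  case 0 then show ?case by (metis Ck_on_Suc_imp_continuous Ck_on.simps(1))
next
  case (Suc k)
  from Suc.prems(2) obtain D where "\<forall>x\<in>S. has_partials_at n S f D x"
    "\<forall>i<n. Ck_on n (Suc k) S (D i)" unfolding Ck_on.simps(2)[of n "Suc k"] by blast
  then show ?case unfolding Ck_on.simps(2)[of n k]
    by (intro exI[of _ D] conjI allI impI Suc.IH[OF Suc.prems(1)]) simp_all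
qed

lemma has_partials_at_cong:
  assumes "\<And>y. y \<in> S \<Longrightarrow> f y = g y" "\<And>i. i < n \<Longrightarrow> D i x = D' i x" "x \<in> S"
  shows "has_partials_at n S f D x \<longleftrightarrow> has_partials_at n S g D' x"
proof -
  have "(\<Sum>i<n. (y i - x i) *\<^sub>R D i x) = (\<Sum>i<n. (y i - x i) *\<^sub>R D' i x)" for y
    by (rule sum.cong) (use assms in auto)
  then show ?thesis using assms(1,3) by (simp add: has_partials_at_def)
qed

lemma Ck_on_cong:
  assumes "\<And>y. y \<in> S \<Longrightarrow> f y = g y" shows "Ck_on n k S f \<longleftrightarrow> Ck_on n k S g"
proof (cases k)
  case 0 then show ?thesis using continuous_on_cong[OF refl assms] by simp
next
  case (Suc l)
  have "has_partials_at n S f D x \<longleftrightarrow> has_partials_at n S g D x" if "x \<in> S" for D x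
    using has_partials_at_cong[of S f g n D x D] assms that by simp
  then show ?thesis using Suc by simp
qed

lemma has_partials_at_subset: "has_partials_at n S f D x \<Longrightarrow> T \<subseteq> S \<Longrightarrow> has_partials_at n T f D x"
proof (unfold has_partials_at_def, intro allI impI)
  fix e :: real
  assume *: "\<forall>e>0. \<exists>d>0. \<forall>y\<in>S. (\<forall>i<n. \<bar>y i - x i\<bar> < d) \<longrightarrow>
      norm (f y - f x - (\<Sum>i<n. (y i - x i) *\<^sub>R D i x)) \<le> e * (\<Sum>i<n. \<bar>y i - x i\<bar>)"
    and "T \<subseteq> S" "e > 0"
  from *[THEN spec, THEN mp, OF \<open>e > 0\<close>] obtain d where "d > 0" "\<forall>y\<in>S. (\<forall>i<n. \<bar>y i - x i\<bar> < d) \<longrightarrow>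
      norm (f y - f x - (\<Sum>i<n. (y i - x i) *\<^sub>R D i x)) \<le> e * (\<Sum>i<n. \<bar>y i - x i\<bar>)"
    by (elim exE conjE) (rule that)
  with \<open>T \<subseteq> S\<close> show "\<exists>d>0. \<forall>y\<in>T. (\<forall>i<n. \<bar>y i - x i\<bar> < d) \<longrightarrow>
      norm (f y - f x - (\<Sum>i<n. (y i - x i) *\<^sub>R D i x)) \<le> e * (\<Sum>i<n. \<bar>y i - x i\<bar>)"
    by (intro exI[of _ d]) auto
qed

lemma Ck_on_subset: "Ck_on n k S f \<Longrightarrow> T \<subseteq> S \<Longrightarrow> Ck_on n k T f"
proof (induction k arbitrary: f)
  case 0 then show ?case using continuous_on_subset by auto
next
  case (Suc k) then show ?case unfolding Ck_on.simps(2)[of n k]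
    by (meson has_partials_at_subset subsetD)
qed

lemma Ck_on_const: "Ck_on n k S (\<lambda>_. c)"
proof (induction k arbitrary: c)
  case (Suc k)
  show ?case unfolding Ck_on.simps(2)
    by (rule exI[of _ "\<lambda>_ _. 0"])
       (use Suc in \<open>auto simp: has_partials_at_def sum_nonneg intro: exI[of _ "1::real"]\<close>)
qed simp

lemma Ck_on_add:
  assumes S: "S \<subseteq> Rn n"
  shows "Ck_on n k S f \<Longrightarrow> Ck_on n k S g \<Longrightarrow> Ck_on n k S (\<lambda>x. f x + g x)"
proof (induction k arbitrary: f g)
  case 0 then show ?case by (auto intro: continuous_intros)
next
  case (Suc k)
  from Suc.prems obtain D E where D: "\<forall>x\<in>S. has_partials_at n S f D x" "\<forall>i<n. Ck_on n k S (D i)"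
    and E: "\<forall>x\<in>S. has_partials_at n S g E x" "\<forall>i<n. Ck_on n k S (E i)" by auto
  have "has_partials_at n S (\<lambda>x. f x + g x) (\<lambda>i x. D i x + E i x) x" if x: "x \<in> S" for x
  proof -
    note q = has_partials_at_iff_tendsto[OF S x]
    have "(\<Sum>i<n. (y i - x i) *\<^sub>R (D i x + E i x)) =
        (\<Sum>i<n. (y i - x i) *\<^sub>R D i x) + (\<Sum>i<n. (y i - x i) *\<^sub>R E i x)" for y
      by (simp add: scaleR_add_right sum.distrib)
    then have "(f y + g y - (f x + g x) - (\<Sum>i<n. (y i - x i) *\<^sub>R (D i x + E i x))) /\<^sub>R l1 n x y =
        (f y - f x - (\<Sum>i<n. (y i - x i) *\<^sub>R D i x)) /\<^sub>R l1 n x y +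
        (g y - g x - (\<Sum>i<n. (y i - x i) *\<^sub>R E i x)) /\<^sub>R l1 n x y" for y
      by (simp flip: scaleR_add_right)
    then show ?thesis
      using tendsto_add[OF D(1)[rule_format, OF x, unfolded q] E(1)[rule_format, OF x, unfolded q]]
      unfolding q by simp
  qed
  then show ?case unfolding Ck_on.simps(2) using D(2) E(2)
    by (intro exI[of _ "\<lambda>i x. D i x + E i x"] conjI ballI allI impI Suc.IH) simp_all
qed

text \<open>The product rule. The remainder of \<open>f g\<close> at \<open>x\<close> is
  \<open>R\<^sub>f(y) g(y) + f(x) R\<^sub>g(y) + (df)(y - x) (g(y) - g(x))\<close>, and the last term is a bounded multiple of
  \<open>l1 n x y\<close> times a function that tends to zero.\<close>

lemma has_partials_at_mult:
  fixes f g :: "(nat \<Rightarrow> real) \<Rightarrow> 'k::real_normed_field"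
  assumes S: "S \<subseteq> Rn n" and x: "x \<in> S"
    and D: "has_partials_at n S f D x" and E: "has_partials_at n S g E x"
  shows "has_partials_at n S (\<lambda>x. f x * g x) (\<lambda>i x. D i x * g x + f x * E i x) x"
proof -
  note q = has_partials_at_iff_tendsto[OF S x]
  define Lf where "Lf y = (\<Sum>i<n. (y i - x i) *\<^sub>R D i x)" for y
  define Lg where "Lg y = (\<Sum>i<n. (y i - x i) *\<^sub>R E i x)" for y
  have f: "((\<lambda>y. (f y - f x - Lf y) /\<^sub>R l1 n x y) \<longlongrightarrow> 0) (at x within S)"
    using D unfolding q Lf_def .
  have g: "((\<lambda>y. (g y - g x - Lg y) /\<^sub>R l1 n x y) \<longlongrightarrow> 0) (at x within S)"
    using E unfolding q Lg_def .
  have gx: "(g \<longlongrightarrow> g x) (at x within S)" by (rule has_partials_at_imp_tendsto[OF S x E])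
  define M where "M = (\<Sum>i<n. norm (D i x))"
  have "((\<lambda>y. M * norm (g y - g x)) \<longlongrightarrow> M * norm (g x - g x)) (at x within S)"
    by (intro tendsto_intros gx)
  then have M0: "((\<lambda>y. M * norm (g y - g x)) \<longlongrightarrow> 0) (at x within S)" by simp
  have "((\<lambda>y. (Lf y /\<^sub>R l1 n x y) * (g y - g x)) \<longlongrightarrow> 0) (at x within S)"
  proof (rule Lim_null_comparison[OF always_eventually M0], rule allI)
    fix y
    have M: "M \<ge> 0" by (simp add: M_def sum_nonneg)
    have "norm (Lf y /\<^sub>R l1 n x y) \<le> M"
      using norm_linear_part_le[of y x "\<lambda>i. D i x" n] l1_nonneg[of n x y] M
      by (cases "l1 n x y = 0") (simp_all add: Lf_def M_def divide_simps mult.commute)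
    then show "norm ((Lf y /\<^sub>R l1 n x y) * (g y - g x)) \<le> M * norm (g y - g x)"
      unfolding norm_mult by (rule mult_right_mono) simp
  qed
  note lim = tendsto_add[OF tendsto_add[OF tendsto_mult[OF f gx]
        tendsto_mult[OF tendsto_const[of "f x"] g]] this]
  have "(\<Sum>i<n. (y i - x i) *\<^sub>R (D i x * g x + f x * E i x)) = Lf y * g x + f x * Lg y" for y
    by (simp add: Lf_def Lg_def sum_distrib_left sum_distrib_right scaleR_add_right sum.distrib)
  then have "(f y * g y - f x * g x - (\<Sum>i<n. (y i - x i) *\<^sub>R (D i x * g x + f x * E i x))) /\<^sub>R l1 n x y =
      (f y - f x - Lf y) /\<^sub>R l1 n x y * g y + f x * ((g y - g x - Lg y) /\<^sub>R l1 n x y) +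
      Lf y /\<^sub>R l1 n x y * (g y - g x)" for y
    by (simp add: algebra_simps)
  then show ?thesis using lim unfolding q by simp
qed

lemma Ck_on_mult:
  fixes f g :: "(nat \<Rightarrow> real) \<Rightarrow> 'k::real_normed_field"
  assumes S: "S \<subseteq> Rn n"
  shows "Ck_on n k S f \<Longrightarrow> Ck_on n k S g \<Longrightarrow> Ck_on n k S (\<lambda>x. f x * g x)"
proof (induction k arbitrary: f g)
  case 0 then show ?case by (auto intro: continuous_intros)
next
  case (Suc k)
  from Suc.prems obtain D E where D: "\<forall>x\<in>S. has_partials_at n S f D x" "\<forall>i<n. Ck_on n k S (D i)"
    and E: "\<forall>x\<in>S. has_partials_at n S g E x" "\<forall>i<n. Ck_on n k S (E i)" by auto
  have "\<forall>x\<in>S. has_partials_at n S (\<lambda>x. f x * g x) (\<lambda>i x. D i x * g x + f x * E i x) x"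
    using has_partials_at_mult[OF S] D(1) E(1) by blast
  moreover have "\<forall>i<n. Ck_on n k S (\<lambda>x. D i x * g x + f x * E i x)"
    using D(2) E(2) Ck_on_SucD[OF S Suc.prems(1)] Ck_on_SucD[OF S Suc.prems(2)]
    by (intro allI impI Ck_on_add[OF S] Suc.IH) simp_all
  ultimately show ?case unfolding Ck_on.simps(2)
    by (intro exI[of _ "\<lambda>i x. D i x * g x + f x * E i x"] conjI)
qed

lemma Ck_on_prod:
  fixes f :: "'i \<Rightarrow> (nat \<Rightarrow> real) \<Rightarrow> 'k::real_normed_field"
  assumes "S \<subseteq> Rn n" "\<And>i. i \<in> I \<Longrightarrow> Ck_on n k S (f i)"
  shows "Ck_on n k S (\<lambda>x. \<Prod>i\<in>I. f i x)"
  using assms(2)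
proof (induction I rule: infinite_finite_induct)
  case (insert i I)
  have "Ck_on n k S (\<lambda>x. f i x * (\<Prod>i\<in>I. f i x))"
    by (intro Ck_on_mult[OF assms(1)] insert.IH insert.prems) auto
  then show ?case by (simp only: prod.insert[OF insert.hyps])
qed (simp_all add: Ck_on_const)

lemma has_partials_at_of_real:
  assumes "has_partials_at n S u D x"
  shows "has_partials_at n S (\<lambda>y. of_real (u y) :: 'k::real_normed_field) (\<lambda>i y. of_real (D i y)) x"
proof -
  have "of_real (u y) - of_real (u x) - (\<Sum>i<n. (y i - x i) *\<^sub>R (of_real (D i x) :: 'k)) =
     of_real (u y - u x - (\<Sum>i<n. (y i - x i) *\<^sub>R D i x))" for y
    by (simp add: scaleR_conv_of_real)
  then show ?thesis using assms unfolding has_partials_at_def by (simp only: norm_of_real real_norm_def)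
qed

lemma Ck_on_of_real: "Ck_on n k S u \<Longrightarrow> Ck_on n k S (\<lambda>x. of_real (u x) :: 'k::real_normed_field)"
proof (induction k arbitrary: u)
  case 0 then show ?case by (auto intro: continuous_intros)
next
  case (Suc k)
  then obtain D where "\<forall>x\<in>S. has_partials_at n S u D x" "\<forall>i<n. Ck_on n k S (D i)" by auto
  then show ?case unfolding Ck_on.simps(2)[of n k]
    by (intro exI[of _ "\<lambda>i x. of_real (D i x)"] conjI ballI allI impI has_partials_at_of_real Suc.IH)
       simp_all
qed

text \<open>By Caratheodory's criterion \<open>h z - h (u x) = c z * (z - u x)\<close> with \<open>c\<close> continuous at \<open>u x\<close>. The
  remainder of \<open>h \<circ> u\<close> is then \<open>(c (u y) - h') (u y - u x)\<close>, a null function times a function with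
  bounded quotients, plus \<open>h'\<close> times the remainder of \<open>u\<close>.\<close>

lemma has_partials_at_compose:
  fixes u :: "(nat \<Rightarrow> real) \<Rightarrow> real"
  assumes S: "S \<subseteq> Rn n" and x: "x \<in> S"
    and D: "has_partials_at n S u D x" and h: "(h has_real_derivative h') (at (u x))"
  shows "has_partials_at n S (\<lambda>y. h (u y)) (\<lambda>i y. h' * D i y) x"
proof -
  note q = has_partials_at_iff_tendsto[OF S x]
  obtain c where c: "\<And>z. h z - h (u x) = c z * (z - u x)" "isCont c (u x)" "c (u x) = h'"
    using h unfolding CARAT_DERIV by blast
  have ux: "(u \<longlongrightarrow> u x) (at x within S)" by (rule has_partials_at_imp_tendsto[OF S x D])
  have "((\<lambda>y. c (u y)) \<longlongrightarrow> h') (at x within S)"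
    using isCont_tendsto_compose[OF c(2) ux] c(3) by simp
  then have c0: "((\<lambda>y. c (u y) - h') \<longlongrightarrow> 0) (at x within S)" by (simp add: LIM_zero_iff)
  obtain K where K: "eventually (\<lambda>y. norm (u y - u x) \<le> K * l1 n x y) (at x within S)"
    using has_partials_at_bounded_quotient[OF S x D] by blast
  have "((\<lambda>y. \<bar>c (u y) - h'\<bar> * \<bar>K\<bar>) \<longlongrightarrow> 0) (at x within S)"
    using tendsto_mult[OF tendsto_rabs_zero[OF c0] tendsto_const[of "\<bar>K\<bar>"]] by simp
  moreover have "eventually (\<lambda>y. norm ((c (u y) - h') * ((u y - u x) /\<^sub>R l1 n x y)) \<le>
      \<bar>c (u y) - h'\<bar> * \<bar>K\<bar>) (at x within S)"
    using K
  proof eventually_elim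
    case (elim y)
    have "K * l1 n x y \<le> \<bar>K\<bar> * l1 n x y" by (intro mult_right_mono l1_nonneg) simp
    from order_trans[OF elim this] have "norm ((u y - u x) /\<^sub>R l1 n x y) \<le> \<bar>K\<bar>"
      using l1_nonneg[of n x y]
      by (cases "l1 n x y = 0") (simp_all add: divide_simps mult.commute abs_mult)
    then show ?case unfolding norm_mult by (intro mult_mono) auto
  qed
  ultimately have r: "((\<lambda>y. (c (u y) - h') * ((u y - u x) /\<^sub>R l1 n x y)) \<longlongrightarrow> 0) (at x within S)"
    by (rule Lim_null_comparison[rotated])
  have "((\<lambda>y. h' * ((u y - u x - (\<Sum>i<n. (y i - x i) *\<^sub>R D i x)) /\<^sub>R l1 n x y)) \<longlongrightarrow> h' * 0)
      (at x within S)"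
    using D unfolding q by (intro tendsto_intros)
  note lim = tendsto_add[OF r this]
  have "(\<Sum>i<n. (y i - x i) *\<^sub>R (h' * D i x)) = h' * (\<Sum>i<n. (y i - x i) *\<^sub>R D i x)" for y
    by (simp add: sum_distrib_left mult.left_commute)
  then have "(h (u y) - h (u x) - (\<Sum>i<n. (y i - x i) *\<^sub>R (h' * D i x))) /\<^sub>R l1 n x y =
      (c (u y) - h') * ((u y - u x) /\<^sub>R l1 n x y) +
      h' * ((u y - u x - (\<Sum>i<n. (y i - x i) *\<^sub>R D i x)) /\<^sub>R l1 n x y)" for y
    unfolding c(1) by (simp add: algebra_simps)
  then show ?thesis using lim unfolding q by simp
qed

text \<open>The smooth function behind all cut-off functions is \<open>flat 0\<close>. The functions \<open>flat m\<close> are chosen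
  such that their span is closed under differentiation, which makes the smoothness of all of them a
  single induction.\<close>

definition flat :: "nat \<Rightarrow> real \<Rightarrow> real" where
  "flat m x = (if x > 0 then exp (- inverse x) * inverse x ^ m else 0)"

lemma flat_tendsto_0: "(flat m \<longlongrightarrow> 0) (at_right 0)"
proof -
  have "((\<lambda>x::real. inverse x ^ m / exp (inverse x)) \<longlongrightarrow> 0) (at_right 0)"
    by (rule filterlim_compose[OF tendsto_power_div_exp_0 filterlim_inverse_at_top_right])
  then show ?thesis
    by (rule Lim_transform_eventually)
       (auto simp: eventually_at_filter flat_def exp_minus divide_inverse)
qed

lemma DERIV_flat: "(flat m has_real_derivative flat (m + 2) x - m * flat (m + 1) x) (at x)"
proof (cases x "0::real" rule: linorder_cases)
  case less
  then have "((\<lambda>_. 0) has_real_derivative 0) (at x)" by simp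
  then have "(flat m has_real_derivative 0) (at x)"
    by (rule has_field_derivative_transform_within_open[where S = "{..<0}"])
       (use less in \<open>auto simp: flat_def\<close>)
  then show ?thesis using less by (simp add: flat_def)
next
  case equal
  have "((\<lambda>h. flat m h / h) \<longlongrightarrow> 0) (at 0)"
  proof (rule filterlim_split_at)
    show "((\<lambda>h. flat m h / h) \<longlongrightarrow> 0) (at_left 0)"
      by (rule tendsto_eventually) (auto simp: eventually_at_filter flat_def)
    show "((\<lambda>h. flat m h / h) \<longlongrightarrow> 0) (at_right 0)"
      by (rule Lim_transform_eventually[OF flat_tendsto_0[of "Suc m"]])
         (auto simp: eventually_at_filter flat_def divide_inverse)
  qed
  then show ?thesis unfolding equal DERIV_def by (simp add: flat_def)
next
  case greater
  have e: "((\<lambda>x. exp (- inverse x)) has_real_derivative exp (- inverse x) * inverse x ^ 2) (at x)"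
    using greater by (auto intro!: derivative_eq_intros simp: power2_eq_square)
  have "((\<lambda>x. inverse x ^ m) has_real_derivative - real m * inverse x ^ (m + 1)) (at x)"
    by (rule DERIV_cong[OF DERIV_power[OF DERIV_inverse]])
       (use greater in \<open>cases m; simp add: algebra_simps\<close>)+
  from DERIV_mult[OF e this]
  have "((\<lambda>x. exp (- inverse x) * inverse x ^ m) has_real_derivative
      flat (m + 2) x - m * flat (m + 1) x) (at x)"
    by (rule DERIV_cong) (use greater in \<open>simp add: flat_def algebra_simps power2_eq_square\<close>)
  then show ?thesis
    by (rule has_field_derivative_transform_within_open[where S = "{0<..}"])
       (use greater in \<open>auto simp: flat_def\<close>)
qed

lemma Ck_on_flat:
  assumes S: "S \<subseteq> Rn n"
  shows "Ck_on n k S u \<Longrightarrow> Ck_on n k S (\<lambda>x. flat m (u x))"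
proof (induction k arbitrary: m)
  case 0
  have "continuous_on UNIV (flat m)"
    by (auto intro!: continuous_at_imp_continuous_on DERIV_isCont[OF DERIV_flat])
  from continuous_on_compose2[OF this, of S u] show ?case using 0 by simp
next
  case (Suc k)
  from Suc.prems obtain D where D: "\<forall>x\<in>S. has_partials_at n S u D x" "\<forall>i<n. Ck_on n k S (D i)"
    by auto
  let ?D = "\<lambda>i y. (flat (m + 2) (u y) + (- real m) * flat (m + 1) (u y)) * D i y"
  have "has_partials_at n S (\<lambda>x. flat m (u x)) ?D x" if "x \<in> S" for x
    using has_partials_at_compose[OF S that D(1)[rule_format, OF that] DERIV_flat[of m]] that
    by (subst has_partials_at_cong[of S _ "\<lambda>x. flat m (u x)" n ?D x
          "\<lambda>i y. (flat (m + 2) (u x) - real m * flat (m + 1) (u x)) * D i y"]) auto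
  moreover have "Ck_on n k S (?D i)" if "i < n" for i
    using D(2) that Ck_on_SucD[OF S Suc.prems] Suc.IH
    by (intro Ck_on_mult[OF S] Ck_on_add[OF S] Ck_on_const) auto
  ultimately show ?case unfolding Ck_on.simps(2) by (intro exI[of _ ?D]) auto
qed

lemma openin_Rn_ball:
  assumes "openin (top_of_set (Rn n)) S" "x \<in> S"
  obtains d where "d > 0" "\<And>y. y \<in> Rn n \<Longrightarrow> \<forall>i<n. \<bar>y i - x i\<bar> < d \<Longrightarrow> y \<in> S"
proof -
  obtain T where T: "open T" "S = Rn n \<inter> T" using assms(1) by (auto simp: openin_open)
  have "eventually (\<lambda>y. y \<in> S) (at x within Rn n)"
    unfolding eventually_at_topological using T assms(2) by auto
  moreover have "x \<in> Rn n" using T assms(2) by auto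
  ultimately obtain d where "d > 0"
    "\<forall>y\<in>Rn n. y \<noteq> x \<longrightarrow> (\<forall>i<n. \<bar>y i - x i\<bar> < d) \<longrightarrow> y \<in> S"
    unfolding eventually_at_within_Rn[OF subset_refl \<open>x \<in> Rn n\<close>] by blast
  then show thesis using assms(2) by (intro that[of d]) auto
qed

text \<open>Partial derivatives on an open set are unique: the function is followed along the coordinate
  lines through \<open>x\<close>.\<close>

lemma has_partials_at_unique:
  fixes f :: "(nat \<Rightarrow> real) \<Rightarrow> 'w::real_normed_vector"
  assumes S: "openin (top_of_set (Rn n)) S" and x: "x \<in> S"
    and D: "has_partials_at n S f D x" and E: "has_partials_at n S f E x" and j: "j < n"
  shows "D j x = E j x"
proof -
  obtain d where d: "d > 0" "\<And>y. y \<in> Rn n \<Longrightarrow> \<forall>i<n. \<bar>y i - x i\<bar> < d \<Longrightarrow> y \<in> S"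
    using openin_Rn_ball[OF S x] by blast
  have xR: "x \<in> Rn n" using S x openin_imp_subset by blast
  have "norm (D j x - E j x) \<le> e" if e: "e > 0" for e
  proof -
    obtain d1 where d1: "d1 > 0" "\<And>y. y \<in> S \<Longrightarrow> \<forall>i<n. \<bar>y i - x i\<bar> < d1 \<Longrightarrow>
       norm (f y - f x - (\<Sum>i<n. (y i - x i) *\<^sub>R D i x)) \<le> e/2 * (\<Sum>i<n. \<bar>y i - x i\<bar>)"
      using D[unfolded has_partials_at_def, rule_format, of "e/2"] e by auto
    obtain d2 where d2: "d2 > 0" "\<And>y. y \<in> S \<Longrightarrow> \<forall>i<n. \<bar>y i - x i\<bar> < d2 \<Longrightarrow>
       norm (f y - f x - (\<Sum>i<n. (y i - x i) *\<^sub>R E i x)) \<le> e/2 * (\<Sum>i<n. \<bar>y i - x i\<bar>)"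
      using E[unfolded has_partials_at_def, rule_format, of "e/2"] e by auto
    \<comment> \<open>small enough for the domain and for both expansions\<close>
    define t where "t = min d (min d1 d2) / 2"
    have t: "t > 0" "t < d" "t < d1" "t < d2" using d(1) d1(1) d2(1) by (auto simp: t_def)
    define y where "y = x(j := x j + t)"
    have yx: "y i - x i = (if i = j then t else 0)" for i by (simp add: y_def)
    have "y \<in> Rn n" using xR j by (auto simp: y_def Rn_def)
    then have yS: "y \<in> S" using d(2) t by (auto simp: yx)
    have 1: "norm (f y - f x - t *\<^sub>R D j x) \<le> e/2 * t"
      using d1(2)[OF yS] t j by (simp add: yx if_distrib[of "\<lambda>c. c *\<^sub>R _"] if_distrib[of abs] cong: if_cong)
    have 2: "norm (f y - f x - t *\<^sub>R E j x) \<le> e/2 * t"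
      using d2(2)[OF yS] t j by (simp add: yx if_distrib[of "\<lambda>c. c *\<^sub>R _"] if_distrib[of abs] cong: if_cong)
    have "t * norm (D j x - E j x) = norm ((f y - f x - t *\<^sub>R E j x) - (f y - f x - t *\<^sub>R D j x))"
      using t by (simp add: scaleR_diff_right[symmetric])
    also have "\<dots> \<le> t * e" using 1 2 norm_triangle_ineq4[of "f y - f x - t *\<^sub>R E j x" "f y - f x - t *\<^sub>R D j x"]
      by (simp add: algebra_simps)
    finally show ?thesis using t by simp
  qed
  then have "norm (D j x - E j x) \<le> 0" by (rule field_le_epsilon) simp
  then show ?thesis by simp
qed

lemma at_within_openin:
  assumes "openin (top_of_set R) S" "openin (top_of_set R) T" "x \<in> T" "T \<subseteq> S"
  shows "at x within T = at x within S"
proof -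
  obtain U where "open U" "T = R \<inter> U" using assms(2) by (auto simp: openin_open)
  then show ?thesis using assms openin_imp_subset[OF assms(1)]
    by (intro at_within_nhd[of x U]) auto
qed

text \<open>Being of class \<open>C\<^sup>k\<close> is a local property of functions on open sets. The derivatives provided by
  the local hypotheses agree where they are both defined, by uniqueness.\<close>

lemma Ck_on_local:
  fixes f :: "(nat \<Rightarrow> real) \<Rightarrow> 'w::real_normed_vector"
  assumes S: "openin (top_of_set (Rn n)) S"
    and loc: "\<And>x. x \<in> S \<Longrightarrow> \<exists>T. openin (top_of_set (Rn n)) T \<and> x \<in> T \<and> T \<subseteq> S \<and> Ck_on n k T f"
  shows "Ck_on n k S f"
  using loc
proof (induction k arbitrary: f)
  case 0
  have "(f \<longlongrightarrow> f x) (at x within S)" if x: "x \<in> S" for x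
  proof -
    obtain T where T: "openin (top_of_set (Rn n)) T" "x \<in> T" "T \<subseteq> S" "continuous_on T f"
      using 0 x by auto
    then have "(f \<longlongrightarrow> f x) (at x within T)" by (auto simp: continuous_on_def)
    then show ?thesis using at_within_openin[OF S T(1-3)] by simp
  qed
  then show ?case by (simp add: continuous_on_def)
next
  case (Suc k)
  have SR: "S \<subseteq> Rn n" using S openin_imp_subset by blast
  from Suc.prems have "\<forall>x\<in>S. \<exists>T D. openin (top_of_set (Rn n)) T \<and> x \<in> T \<and> T \<subseteq> S \<and>
      (\<forall>y\<in>T. has_partials_at n T f D y) \<and> (\<forall>i<n. Ck_on n k T (D i))"
    unfolding Ck_on.simps(2) by (intro ballI) (drule meta_spec, drule meta_mp, assumption, elim exE conjE, intro exI conjI)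
  then obtain T D where TD: "\<forall>x\<in>S. openin (top_of_set (Rn n)) (T x) \<and> x \<in> T x \<and> T x \<subseteq> S \<and>
      (\<forall>y\<in>T x. has_partials_at n (T x) f (D x) y) \<and> (\<forall>i<n. Ck_on n k (T x) (D x i))"
    by (elim bchoice[THEN exE]) (rule that)
  have T: "\<And>x. x \<in> S \<Longrightarrow> openin (top_of_set (Rn n)) (T x)"
      "\<And>x. x \<in> S \<Longrightarrow> x \<in> T x" "\<And>x. x \<in> S \<Longrightarrow> T x \<subseteq> S"
    and D: "\<And>x y. x \<in> S \<Longrightarrow> y \<in> T x \<Longrightarrow> has_partials_at n (T x) f (D x) y"
      "\<And>x i. x \<in> S \<Longrightarrow> i < n \<Longrightarrow> Ck_on n k (T x) (D x i)"
    using TD by auto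
  define E where "E i x = D x i x" for i x
  have DS: "has_partials_at n S f (D x) y" if "x \<in> S" "y \<in> T x" for x y
  proof -
    have TR: "T x \<subseteq> Rn n" using T(3)[OF that(1)] SR by blast
    have yS: "y \<in> S" using that T by blast
    show ?thesis
      using D(1)[OF that] at_within_openin[OF S T(1)[OF that(1)] that(2) T(3)[OF that(1)]]
      unfolding has_partials_at_iff_tendsto[OF SR yS] has_partials_at_iff_tendsto[OF TR that(2)] by simp
  qed
  have "has_partials_at n S f E x" if x: "x \<in> S" for x
    using DS[OF x T(2)[OF x]] x has_partials_at_cong[of S f f n "D x" x E] by (simp add: E_def)
  moreover have "Ck_on n k S (E i)" if i: "i < n" for i
  proof (rule Suc.IH)
    fix x assume x: "x \<in> S"
    have "E i y = D x i y" if y: "y \<in> T x" for y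
    proof -
      have "y \<in> S" using y T x by blast
      then show ?thesis unfolding E_def
        using has_partials_at_unique[OF S \<open>y \<in> S\<close> DS[OF \<open>y \<in> S\<close> T(2)[OF \<open>y \<in> S\<close>]] DS[OF x y] i] by simp
    qed
    then have "Ck_on n k (T x) (E i)" using D(2)[OF x i] Ck_on_cong[of "T x" "E i" "D x i"] by blast
    then show "\<exists>T. openin (top_of_set (Rn n)) T \<and> x \<in> T \<and> T \<subseteq> S \<and> Ck_on n k T (E i)"
      using T x by (intro exI[of _ "T x"]) simp
  qed
  ultimately show ?case unfolding Ck_on.simps(2) by (intro exI[of _ E]) simp
qed

section \<open>Smooth functions and cut-off functions on a manifold\<close>

lemma smooth_manifold_chartD:
  assumes "smooth_manifold M" "(U, \<phi>) \<in> charts M"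
  shows "open U" "openin (top_of_set (Rn (mdim M))) (\<phi> ` U)"
    "homeomorphism U (\<phi> ` U) \<phi> (inv_into U \<phi>)"
  using assms unfolding smooth_manifold_def by fast+

lemma chart_image_subset:
  assumes "smooth_manifold M" "(U, \<phi>) \<in> charts M"
  shows "\<phi> ` (U \<inter> W) \<subseteq> Rn (mdim M)"
  using openin_imp_subset[OF smooth_manifold_chartD(2)[OF assms]] by auto

lemma openin_chart_image:
  assumes "smooth_manifold M" "(U, \<phi>) \<in> charts M" "open W"
  shows "openin (top_of_set (Rn (mdim M))) (\<phi> ` (U \<inter> W))"
proof -
  note c = smooth_manifold_chartD[OF assms(1,2)]
  have "openin (top_of_set U) (U \<inter> W)" using assms(3) by (simp add: openin_open_Int)
  from homeomorphism_imp_open_map[OF c(3) this] c(2) show ?thesis by (rule openin_trans)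
qed

lemma chart_inv_into:
  assumes "smooth_manifold M" "(U, \<phi>) \<in> charts M" "x \<in> U"
  shows "inv_into U \<phi> (\<phi> x) = x"
  using smooth_manifold_chartD(3)[OF assms(1,2)] assms(3) by (auto simp: homeomorphism_def)

lemma smooth_onI:
  assumes "\<And>U \<phi> k. (U, \<phi>) \<in> charts M \<Longrightarrow> Ck_on (mdim M) k (\<phi> ` (U \<inter> W)) (\<lambda>y. f (inv_into U \<phi> y))"
  shows "smooth_on M W f"
  using assms unfolding smooth_on_def smooth_Rn_def by auto

lemma smooth_onD:
  assumes "smooth_on M W f" "(U, \<phi>) \<in> charts M"
  shows "Ck_on (mdim M) k (\<phi> ` (U \<inter> W)) (\<lambda>y. f (inv_into U \<phi> y))"
  using assms unfolding smooth_on_def smooth_Rn_def by auto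

lemma smooth_on_cong:
  assumes M: "smooth_manifold M" and fg: "\<And>x. x \<in> W \<Longrightarrow> f x = g x" and f: "smooth_on M W f"
  shows "smooth_on M W g"
proof (rule smooth_onI)
  fix U \<phi> k assume c: "(U, \<phi>) \<in> charts M"
  have "f (inv_into U \<phi> y) = g (inv_into U \<phi> y)" if "y \<in> \<phi> ` (U \<inter> W)" for y
    using that chart_inv_into[OF M c] fg by auto
  then show "Ck_on (mdim M) k (\<phi> ` (U \<inter> W)) (\<lambda>y. g (inv_into U \<phi> y))"
    using smooth_onD[OF f c] by (subst (asm) Ck_on_cong) auto
qed

lemma smooth_on_subset: "smooth_on M W f \<Longrightarrow> V \<subseteq> W \<Longrightarrow> smooth_on M V f"
  by (rule smooth_onI, rule Ck_on_subset[OF smooth_onD]) auto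

lemma smooth_on_const: "smooth_on M W (\<lambda>_. c)"
  by (rule smooth_onI) (rule Ck_on_const)

lemma smooth_on_add:
  assumes "smooth_manifold M" "smooth_on M W f" "smooth_on M W g"
  shows "smooth_on M W (\<lambda>x. f x + g x)"
  by (rule smooth_onI) (intro Ck_on_add[OF chart_image_subset] smooth_onD assms)

lemma smooth_on_mult:
  assumes "smooth_manifold M" "smooth_on M W f" "smooth_on M W g"
  shows "smooth_on M W (\<lambda>x. f x * g x)"
  by (rule smooth_onI) (intro Ck_on_mult[OF chart_image_subset] smooth_onD assms)

lemma smooth_on_Un:
  assumes M: "smooth_manifold M" and V: "open V" and W: "open W"
    and f: "smooth_on M V f" "smooth_on M W f"
  shows "smooth_on M (V \<union> W) f"
proof (rule smooth_onI)
  fix U \<phi> k assume c: "(U, \<phi>) \<in> charts M"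
  show "Ck_on (mdim M) k (\<phi> ` (U \<inter> (V \<union> W))) (\<lambda>y. f (inv_into U \<phi> y))"
  proof (rule Ck_on_local)
    show "openin (top_of_set (Rn (mdim M))) (\<phi> ` (U \<inter> (V \<union> W)))"
      using V W by (intro openin_chart_image[OF M c]) auto
  next
    fix y assume "y \<in> \<phi> ` (U \<inter> (V \<union> W))"
    then consider "y \<in> \<phi> ` (U \<inter> V)" | "y \<in> \<phi> ` (U \<inter> W)" by blast
    then show "\<exists>T. openin (top_of_set (Rn (mdim M))) T \<and> y \<in> T \<and> T \<subseteq> \<phi> ` (U \<inter> (V \<union> W)) \<and>
        Ck_on (mdim M) k T (\<lambda>y. f (inv_into U \<phi> y))"
    proof cases
      case 1
      then show ?thesis using openin_chart_image[OF M c V] smooth_onD[OF f(1) c]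
        by (intro exI[of _ "\<phi> ` (U \<inter> V)"]) auto
    next
      case 2
      then show ?thesis using openin_chart_image[OF M c W] smooth_onD[OF f(2) c]
        by (intro exI[of _ "\<phi> ` (U \<inter> W)"]) auto
    qed
  qed
qed

text \<open>The two open sets \<open>U\<close> and \<open>- C\<close> cover the manifold; on the second one the extension is \<open>0\<close>.\<close>

lemma smooth_on_extend_by_zero:
  assumes M: "smooth_manifold M" and W: "open W" and U: "open U" and C: "closed C" "C \<subseteq> U"
    and f: "smooth_on M (U \<inter> W) f" and f0: "\<And>x. x \<in> U - C \<Longrightarrow> f x = 0"
  shows "smooth_on M W (\<lambda>x. if x \<in> U then f x else 0)"
proof -
  let ?F = "\<lambda>x. if x \<in> U then f x else 0"
  have "smooth_on M (U \<inter> W) ?F" by (rule smooth_on_cong[OF M _ f]) simp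
  moreover have "smooth_on M (W - C) ?F"
    by (rule smooth_on_cong[OF M _ smooth_on_const[of _ _ 0]]) (use f0 in auto)
  ultimately have "smooth_on M (U \<inter> W \<union> (W - C)) ?F"
    using W U C by (intro smooth_on_Un[OF M]) auto
  then show ?thesis using C(2) by (rule_tac smooth_on_subset) auto
qed

lemma compact_cube: "compact {y \<in> Rn n. \<forall>i<n. \<bar>y i - c i\<bar> \<le> (r::real)}"
proof -
  let ?S = "\<lambda>i. if i < n then {c i - r .. c i + r} else {0}"
  have "compactin (product_topology (\<lambda>i. euclidean) UNIV) (\<Pi>\<^sub>E i\<in>UNIV. ?S i)"
    unfolding compactin_PiE by auto
  then have "compact (\<Pi>\<^sub>E i\<in>UNIV. ?S i)"
    by (simp add: euclidean_product_topology)
  moreover have "{y \<in> Rn n. \<forall>i<n. \<bar>y i - c i\<bar> \<le> r} = (\<Pi>\<^sub>E i\<in>UNIV. ?S i)"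
    unfolding Rn_def PiE_UNIV_domain Pi_def
    by (intro Collect_eqI) (auto simp: abs_le_iff not_less split: if_splits; smt)
  ultimately show ?thesis by simp
qed

text \<open>In a chart around \<open>p\<close>, the product of the functions \<open>flat 0 (d\<^sup>2 - t\<^sub>i\<^sup>2)\<close>, \<open>t\<^sub>i\<close> being the
  coordinates centred at \<open>p\<close>, is supported in a cube. Its preimage is compact, hence closed in the
  Hausdorff space \<open>'m\<close>, so that the function extends by zero to the whole manifold.\<close>

lemma smooth_cutoff:
  fixes M :: "('m::{t2_space,second_countable_topology}, 'z) manifold_scheme"
  assumes M: "smooth_manifold M" and U: "open U" "p \<in> U"
  obtains \<theta> :: "'m \<Rightarrow> 'k::real_or_complex_field" and C
  where "\<theta> \<in> Cinf M" "\<theta> p = 1" "closed C" "C \<subseteq> U" "\<And>x. x \<notin> C \<Longrightarrow> \<theta> x = 0"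
proof -
  let ?n = "mdim M"
  obtain V \<phi> where c: "(V, \<phi>) \<in> charts M" and pV: "p \<in> V"
    using M unfolding smooth_manifold_def by blast
  note ch = smooth_manifold_chartD[OF M c]
  note inv = chart_inv_into[OF M c]
  have "\<phi> p \<in> \<phi> ` (V \<inter> U)" using pV U by auto
  from openin_Rn_ball[OF openin_chart_image[OF M c U(1)] this] obtain e where e: "e > 0"
    "\<And>y. y \<in> Rn ?n \<Longrightarrow> \<forall>i<?n. \<bar>y i - \<phi> p i\<bar> < e \<Longrightarrow> y \<in> \<phi> ` (V \<inter> U)" by blast
  define d where "d = e / 2"
  have d: "d > 0" "d < e" using e(1) by (auto simp: d_def)
  define K where "K = {y \<in> Rn ?n. \<forall>i<?n. \<bar>y i - \<phi> p i\<bar> \<le> d}"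
  have K: "K \<subseteq> \<phi> ` (V \<inter> U)" using e(2) d unfolding K_def by force
  define C where "C = inv_into V \<phi> ` K"
  have "continuous_on K (inv_into V \<phi>)"
    using ch(3) K by (meson homeomorphism_def continuous_on_subset image_mono Int_lower1 order_trans)
  then have "compact C" unfolding C_def K_def by (intro compact_continuous_image compact_cube) auto
  then have C: "closed C" by (rule compact_imp_closed)
  have CU: "C \<subseteq> V \<inter> U" using K inv unfolding C_def by force
  have inC: "x \<in> C" if "x \<in> V" "\<forall>i<?n. \<bar>\<phi> x i - \<phi> p i\<bar> \<le> d" for x
  proof -
    have "\<phi> x \<in> K" using that openin_imp_subset[OF ch(2)] unfolding K_def by auto
    then show ?thesis unfolding C_def using inv[OF that(1)] by (metis imageI)
  qed
  define g where "g x = (\<Prod>i<?n. flat 0 (d * d + (- 1) * ((\<phi> x i + (- \<phi> p i)) * (\<phi> x i + (- \<phi> p i)))))" for x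
  define h where "h x = of_real (g x) / (of_real (g p) :: 'k)" for x
  \<comment> \<open>normalisation to the value \<open>1\<close> at \<open>p\<close>\<close>
  have gp: "g p \<noteq> 0" using d by (simp add: g_def flat_def)
  have g0: "g x = 0" if x: "x \<in> V - C" for x
  proof -
    obtain i where i: "i < ?n" "\<bar>\<phi> x i - \<phi> p i\<bar> > d" using inC[of x] x by force
    have "d * d \<le> \<bar>\<phi> x i - \<phi> p i\<bar> * \<bar>\<phi> x i - \<phi> p i\<bar>"
      using i d by (intro mult_mono) auto
    then have "flat 0 (d * d + (- 1) * ((\<phi> x i + (- \<phi> p i)) * (\<phi> x i + (- \<phi> p i)))) = 0"
      by (simp add: flat_def)
    then show ?thesis unfolding g_def using i(1) by (intro prod_zero) auto
  qed
  have "smooth_on M V h"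
  proof (rule smooth_onI)
    fix W \<psi> k assume c': "(W, \<psi>) \<in> charts M"
    note S = chart_image_subset[OF M c']
    have *: "Ck_on ?n k (\<psi> ` (W \<inter> V)) (\<lambda>y. \<phi> (inv_into W \<psi> y) i)" if "i < ?n" for i
      using M c c' that unfolding smooth_manifold_def smooth_Rn_def by fast
    have "Ck_on ?n k (\<psi> ` (W \<inter> V)) (\<lambda>y. g (inv_into W \<psi> y))"
      unfolding g_def using *
      by (intro Ck_on_prod[OF S] Ck_on_flat[OF S] Ck_on_add[OF S] Ck_on_mult[OF S] Ck_on_const) auto
    then show "Ck_on ?n k (\<psi> ` (W \<inter> V)) (\<lambda>y. h (inv_into W \<psi> y))"
      unfolding h_def divide_inverse by (intro Ck_on_mult[OF S] Ck_on_of_real Ck_on_const)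
  qed
  moreover have "h x = 0" if "x \<in> V - C" for x using g0[OF that] by (simp add: h_def)
  ultimately have "smooth_on M UNIV (\<lambda>x. if x \<in> V then h x else 0)"
    using CU ch(1) by (intro smooth_on_extend_by_zero[OF M _ _ C]) simp_all
  then show thesis
    using C CU gp g0 pV
    by (intro that[of "\<lambda>x. if x \<in> V then h x else 0" C]) (auto simp: Cinf_def h_def)
qed

lemma Cinf_const: "(\<lambda>_. c) \<in> Cinf M"
  by (simp add: Cinf_def smooth_on_const)

lemma Cinf_mult: "smooth_manifold M \<Longrightarrow> f \<in> Cinf M \<Longrightarrow> g \<in> Cinf M \<Longrightarrow> (\<lambda>x. f x * g x) \<in> Cinf M"
  by (simp add: Cinf_def smooth_on_mult)

section \<open>Sections of a split Lie pair\<close>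

locale split_pair =
  fixes P :: "('m::{t2_space,second_countable_topology}, 'k::real_or_complex_field, 'v::ab_group_add) lie_pair"
  assumes split: "split_lie_pair P"
begin

lemma lie: "lie_algebroid P" using split by (simp add: split_lie_pair_def)
lemma bundle_P: "vector_bundle P" using lie by (simp add: lie_algebroid_def)
lemma manifold: "smooth_manifold P" using bundle_P by (simp add: vector_bundle_def)

sublocale V: vector_space "scl P" using bundle_P by (simp add: vector_bundle_def)

lemma subspace_fib: "V.subspace (fib P x)"
  and subspace_subA: "V.subspace (subA P x)" and subspace_subB: "V.subspace (subB P x)"
proof -
  have "subbundle P (subA P)" "subbundle P (subB P)" using split by (simp_all add: split_lie_pair_def)
  then show "V.subspace (subA P x)" "V.subspace (subB P x)"
    unfolding subbundle_def by simp_all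
  show "V.subspace (fib P x)" using bundle_P by (simp add: vector_bundle_def)
qed

lemma frameD:
  assumes "(U, es) \<in> frames P"
  shows "open U" "x \<in> U \<Longrightarrow> is_basis (scl P) (map (\<lambda>e. e x) es) (fib P x)"
    "e \<in> set es \<Longrightarrow> local_section P U e"
proof -
  have "\<forall>(U, es) \<in> frames P. open U \<and>
       (\<forall>x\<in>U. is_basis (scl P) (map (\<lambda>e. e x) es) (fib P x)) \<and>
       (\<forall>e \<in> set es. local_section P U e)" using bundle_P by (simp add: vector_bundle_def)
  from bspec[OF this assms] show "open U" "x \<in> U \<Longrightarrow> is_basis (scl P) (map (\<lambda>e. e x) es) (fib P x)"
    "e \<in> set es \<Longrightarrow> local_section P U e" by simp_all
qed

lemma Gam_iff: "u \<in> Gam P \<longleftrightarrow> (\<forall>x. u x \<in> fib P x) \<and>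
    (\<forall>(U, es) \<in> frames P. \<exists>g. (\<forall>i < length es. smooth_on P U (g i)) \<and>
       (\<forall>x \<in> U. u x = (\<Sum>i < length es. scl P (g i x) ((es ! i) x))))"
  by (simp add: Gam_def local_section_def)

lemma Gam_in_fib: "u \<in> Gam P \<Longrightarrow> u x \<in> fib P x"
  by (simp add: Gam_iff)

lemma Gam_coeffs:
  assumes "u \<in> Gam P" "(U, es) \<in> frames P"
  obtains g where "\<And>i. i < length es \<Longrightarrow> smooth_on P U (g i)"
    "\<And>x. x \<in> U \<Longrightarrow> u x = (\<Sum>i < length es. scl P (g i x) ((es ! i) x))"
proof -
  have "\<forall>(U, es) \<in> frames P. \<exists>g. (\<forall>i < length es. smooth_on P U (g i)) \<and>
       (\<forall>x \<in> U. u x = (\<Sum>i < length es. scl P (g i x) ((es ! i) x)))"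
    using assms(1) unfolding Gam_iff by (rule conjunct2)
  from bspec[OF this assms(2)] show thesis using that by auto
qed

lemma GamI:
  assumes "\<And>x. u x \<in> fib P x"
    and "\<And>U es. (U, es) \<in> frames P \<Longrightarrow> \<exists>g. (\<forall>i < length es. smooth_on P U (g i)) \<and>
       (\<forall>x \<in> U. u x = (\<Sum>i < length es. scl P (g i x) ((es ! i) x)))"
  shows "u \<in> Gam P"
  using assms by (simp add: Gam_iff split_beta)

lemma Gam_zero: "0 \<in> Gam P"
proof (rule GamI)
  fix U es
  show "\<exists>g. (\<forall>i < length es. smooth_on P U (g i)) \<and>
       (\<forall>x \<in> U. 0 x = (\<Sum>i < length es. scl P (g i x) ((es ! i) x)))"
    by (rule exI[of _ "\<lambda>_ _. 0"]) (simp add: smooth_on_const)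
qed (simp add: V.subspace_0[OF subspace_fib])

lemma Gam_add:
  assumes "u \<in> Gam P" "v \<in> Gam P" shows "u + v \<in> Gam P"
proof (rule GamI)
  fix x show "(u + v) x \<in> fib P x" using assms V.subspace_add[OF subspace_fib] by (simp add: Gam_in_fib)
next
  fix U es assume F: "(U, es) \<in> frames P"
  obtain g where g: "\<And>i. i < length es \<Longrightarrow> smooth_on P U (g i)"
    "\<And>x. x \<in> U \<Longrightarrow> u x = (\<Sum>i < length es. scl P (g i x) ((es ! i) x))"
    by (rule Gam_coeffs[OF assms(1) F]) (rule that)
  obtain h where h: "\<And>i. i < length es \<Longrightarrow> smooth_on P U (h i)"
    "\<And>x. x \<in> U \<Longrightarrow> v x = (\<Sum>i < length es. scl P (h i x) ((es ! i) x))"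
    by (rule Gam_coeffs[OF assms(2) F]) (rule that)
  show "\<exists>g. (\<forall>i < length es. smooth_on P U (g i)) \<and>
       (\<forall>x \<in> U. (u + v) x = (\<Sum>i < length es. scl P (g i x) ((es ! i) x)))"
    by (rule exI[of _ "\<lambda>i x. g i x + h i x"])
       (use g h in \<open>simp add: smooth_on_add[OF manifold] V.scale_left_distrib sum.distrib\<close>)
qed

lemma Gam_smul:
  assumes "f \<in> Cinf P" "u \<in> Gam P" shows "smul P f u \<in> Gam P"
proof (rule GamI)
  fix x show "smul P f u x \<in> fib P x"
    using assms V.subspace_scale[OF subspace_fib] by (simp add: Gam_in_fib smul_def)
next
  fix U es assume F: "(U, es) \<in> frames P"
  obtain g where g: "\<And>i. i < length es \<Longrightarrow> smooth_on P U (g i)"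
    "\<And>x. x \<in> U \<Longrightarrow> u x = (\<Sum>i < length es. scl P (g i x) ((es ! i) x))"
    by (rule Gam_coeffs[OF assms(2) F]) (rule that)
  have "smooth_on P U f" using assms(1) smooth_on_subset[of P UNIV f U] by (simp add: Cinf_def)
  then show "\<exists>g. (\<forall>i < length es. smooth_on P U (g i)) \<and>
       (\<forall>x \<in> U. smul P f u x = (\<Sum>i < length es. scl P (g i x) ((es ! i) x)))"
    by (intro exI[of _ "\<lambda>i x. f x * g i x"])
       (use g in \<open>simp add: smooth_on_mult[OF manifold] smul_def V.scale_sum_right\<close>)
qed

lemma smul_apply: "smul P f u x = scl P (f x) (u x)"
  by (simp add: smul_def)

lemma pw_eq_smul: "pw (scl P) c u = smul P (\<lambda>_. c) u"
  by (simp add: pw_def smul_def)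

lemma smul_add_right: "smul P f (u + v) = smul P f u + smul P f v"
  and smul_smul: "smul P f (smul P g u) = smul P (\<lambda>x. f x * g x) u"
  and smul_zero: "smul P f 0 = 0"
  and smul_minus: "smul P f (- u) = - smul P f u"
  and smul_1: "smul P (\<lambda>_. 1) u = u"
  and smul_m1: "smul P (\<lambda>_. - 1) u = - u"
  by (simp_all add: smul_def fun_eq_iff V.scale_right_distrib V.scale_left_distrib)

lemma GamA_subset: "GamA P \<subseteq> Gam P" and GamB_subset: "GamB P \<subseteq> Gam P"
  by (auto simp: GamA_def GamB_def)

lemma GamA_zero: "0 \<in> GamA P"
  and GamA_add: "a \<in> GamA P \<Longrightarrow> a' \<in> GamA P \<Longrightarrow> a + a' \<in> GamA P"
  and GamA_smul: "f \<in> Cinf P \<Longrightarrow> a \<in> GamA P \<Longrightarrow> smul P f a \<in> GamA P"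
  using subspace_subA
  by (simp_all add: GamA_def Gam_zero Gam_add Gam_smul smul_apply V.subspace_0 V.subspace_add V.subspace_scale)

lemma GamB_zero: "0 \<in> GamB P"
  and GamB_add: "b \<in> GamB P \<Longrightarrow> b' \<in> GamB P \<Longrightarrow> b + b' \<in> GamB P"
  and GamB_smul: "f \<in> Cinf P \<Longrightarrow> b \<in> GamB P \<Longrightarrow> smul P f b \<in> GamB P"
  using subspace_subB
  by (simp_all add: GamB_def Gam_zero Gam_add Gam_smul smul_apply V.subspace_0 V.subspace_add V.subspace_scale)

lemma prA_in: "u \<in> Gam P \<Longrightarrow> prA P u \<in> GamA P" and prB_in: "u \<in> Gam P \<Longrightarrow> prB P u \<in> GamB P"
  using split by (auto simp: split_lie_pair_def)

lemma split_unique: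
  assumes "a \<in> subA P x" "b \<in> subB P x" "a' \<in> subA P x" "b' \<in> subB P x" "a + b = a' + b'"
  shows "a = a' \<and> b = b'"
proof -
  have "a - a' = b' - b" using assms(5) by (simp add: algebra_simps)
  moreover have "a - a' \<in> subA P x" "b' - b \<in> subB P x"
    using assms V.subspace_diff subspace_subA subspace_subB by blast+
  moreover have "subA P x \<inter> subB P x = {0}" using split by (simp add: split_lie_pair_def)
  ultimately have "a - a' = 0" "b' - b = 0" by (metis IntI singletonD)+
  then show ?thesis by simp
qed

lemma pr_apply:
  assumes "a \<in> subA P x" "b \<in> subB P x" "u x = a + b"
  shows "prA P u x = a" and "prB P u x = b"
proof -
  show "prA P u x = a" unfolding prA_def
  proof (rule the_equality)
    fix c assume c: "c \<in> subA P x \<and> u x - c \<in> subB P x"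
    then show "c = a"
      using split_unique[of c x "u x - c" a b, THEN conjunct1] assms by simp
  qed (use assms in simp)
  show "prB P u x = b" unfolding prB_def
  proof (rule the_equality)
    fix c assume c: "c \<in> subB P x \<and> u x - c \<in> subA P x"
    then show "c = b"
      using split_unique[of "u x - c" x c a b, THEN conjunct2] assms by simp
  qed (use assms in simp)
qed

lemma prA_prB_eqI:
  assumes a: "a \<in> GamA P" and b: "b \<in> GamB P" and u: "u = a + b"
  shows "prA P u = a" and "prB P u = b"
proof -
  have "a x \<in> subA P x" "b x \<in> subB P x" "u x = a x + b x" for x
    using assms by (simp_all add: GamA_def GamB_def)
  note pr = pr_apply[of "a x" x "b x" u for x, OF this]
  show "prA P u = a" "prB P u = b" by (rule ext, rule pr)+
qed

lemma prA_plus_prB: "u \<in> Gam P \<Longrightarrow> prA P u + prB P u = u"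
proof
  fix x assume "u \<in> Gam P"
  then have "u x \<in> fib P x" by (rule Gam_in_fib)
  moreover have "fib P x = {a + b | a b. a \<in> subA P x \<and> b \<in> subB P x}"
    using split by (simp add: split_lie_pair_def)
  ultimately obtain a b where "a \<in> subA P x" "b \<in> subB P x" "u x = a + b" by blast
  then show "(prA P u + prB P u) x = u x" using pr_apply[of a x b u] by simp
qed

lemma pr_add:
  assumes "u \<in> Gam P" "v \<in> Gam P"
  shows prA_add: "prA P (u + v) = prA P u + prA P v" and prB_add: "prB P (u + v) = prB P u + prB P v"
proof -
  have eq: "u + v = (prA P u + prA P v) + (prB P u + prB P v)"
    using prA_plus_prB[OF assms(1)] prA_plus_prB[OF assms(2)] by (metis add.assoc add.left_commute)
  show "prA P (u + v) = prA P u + prA P v" "prB P (u + v) = prB P u + prB P v"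
    by (rule prA_prB_eqI[OF _ _ eq]; intro GamA_add GamB_add prA_in prB_in assms)+
qed

lemma pr_smul:
  assumes "f \<in> Cinf P" "u \<in> Gam P"
  shows prA_smul: "prA P (smul P f u) = smul P f (prA P u)"
    and prB_smul: "prB P (smul P f u) = smul P f (prB P u)"
proof -
  have eq: "smul P f u = smul P f (prA P u) + smul P f (prB P u)"
    using prA_plus_prB[OF assms(2)] by (metis smul_add_right)
  show "prA P (smul P f u) = smul P f (prA P u)" "prB P (smul P f u) = smul P f (prB P u)"
    by (rule prA_prB_eqI[OF _ _ eq]; intro GamA_smul GamB_smul prA_in prB_in assms)+
qed

lemma prA_GamB: "b \<in> GamB P \<Longrightarrow> prA P b = 0" and prB_GamB: "b \<in> GamB P \<Longrightarrow> prB P b = b"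
  using prA_prB_eqI[OF GamA_zero, of b b] by simp_all

lemma prA_0: "prA P 0 = 0" and prB_0: "prB P 0 = 0"
  using prA_GamB[OF GamB_zero] prB_GamB[OF GamB_zero] .

lemma prB_uminus: "u \<in> Gam P \<Longrightarrow> prB P (- u) = - prB P u"
  using prB_smul[OF Cinf_const, of u "- 1"] by (simp add: smul_m1)

lemma brk_in: "u \<in> Gam P \<Longrightarrow> v \<in> Gam P \<Longrightarrow> brk P u v \<in> Gam P"
  and brk_add_left: "u \<in> Gam P \<Longrightarrow> v \<in> Gam P \<Longrightarrow> w \<in> Gam P \<Longrightarrow> brk P (u + v) w = brk P u w + brk P v w"
  and brk_add_right: "u \<in> Gam P \<Longrightarrow> v \<in> Gam P \<Longrightarrow> w \<in> Gam P \<Longrightarrow> brk P w (u + v) = brk P w u + brk P w v"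
  and brk_pw_right: "u \<in> Gam P \<Longrightarrow> v \<in> Gam P \<Longrightarrow> brk P u (pw (scl P) c v) = pw (scl P) c (brk P u v)"
  and brk_self: "u \<in> Gam P \<Longrightarrow> brk P u u = 0"
  and brk_smul: "u \<in> Gam P \<Longrightarrow> v \<in> Gam P \<Longrightarrow> f \<in> Cinf P \<Longrightarrow>
      brk P u (smul P f v) = smul P (rho P u f) v + smul P f (brk P u v)"
  and rho_in: "u \<in> Gam P \<Longrightarrow> f \<in> Cinf P \<Longrightarrow> rho P u f \<in> Cinf P"
  using lie by (simp_all add: lie_algebroid_def)

lemma brk_jacobi: "u \<in> Gam P \<Longrightarrow> v \<in> Gam P \<Longrightarrow> w \<in> Gam P \<Longrightarrow>
    brk P u (brk P v w) + brk P v (brk P w u) + brk P w (brk P u v) = 0"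
  and rho_brk: "u \<in> Gam P \<Longrightarrow> v \<in> Gam P \<Longrightarrow> f \<in> Cinf P \<Longrightarrow>
    rho P (brk P u v) f = rho P u (rho P v f) - rho P v (rho P u f)"
  using lie by (simp_all add: lie_algebroid_def)

lemma brk_anti:
  assumes "u \<in> Gam P" "v \<in> Gam P" shows "brk P u v = - brk P v u"
proof -
  have "brk P (u + v) (u + v) = 0" using assms Gam_add brk_self by blast
  then have "brk P u v + brk P v u = 0"
    using assms by (simp add: brk_add_left brk_add_right Gam_add brk_self[OF assms(1)] brk_self[OF assms(2)] add.commute)
  then show ?thesis by (simp add: eq_neg_iff_add_eq_0)
qed

lemma brk_zero_right: "u \<in> Gam P \<Longrightarrow> brk P u 0 = 0"
  using brk_add_right[OF Gam_zero Gam_zero, of u] by simp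

section \<open>Forms of degree zero and one\<close>

(* The degree 1 has to stay in the literal form in which it occurs in the facts about 1-forms. *)
declare One_nat_def [simp del]

lemma form0_in_OmegaB:
  "b \<in> GamB P \<Longrightarrow> form0 b \<in> OmegaB P 0"
  by (auto simp: OmegaB_def alt_forms_def form0_def)

lemma form0_in_Omega: "f \<in> Cinf P \<Longrightarrow> form0 f \<in> Omega P 0"
  by (auto simp: Omega_def alt_forms_def form0_def)

lemma alt_forms_1_iff: "X \<in> alt_forms P s W 1 \<longleftrightarrow>
    (\<forall>as. \<not> (\<exists>a\<in>GamA P. as = [a]) \<longrightarrow> X as = 0) \<and>
    (\<forall>a\<in>GamA P. X [a] \<in> W \<and> (\<forall>a'\<in>GamA P. X [a + a'] = X [a] + X [a']) \<and>
       (\<forall>f\<in>Cinf P. X [smul P f a] = s f (X [a])))"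
proof -
  have 1: "length as = 1 \<and> set as \<subseteq> GamA P \<longleftrightarrow> (\<exists>a\<in>GamA P. as = [a])" for as
    by (cases as) (auto simp: length_Suc_conv)
  have 2: "(\<forall>as. length as = 1 \<and> set as \<subseteq> GamA P \<longrightarrow> Q as) \<longleftrightarrow> (\<forall>a\<in>GamA P. Q [a])" for Q
    unfolding 1 by blast
  show ?thesis unfolding alt_forms_def mem_Collect_eq 2 unfolding 1 by simp
qed

lemma Omega1_iff: "\<omega> \<in> Omega P 1 \<longleftrightarrow>
    (\<forall>as. \<not> (\<exists>a\<in>GamA P. as = [a]) \<longrightarrow> \<omega> as = 0) \<and>
    (\<forall>a\<in>GamA P. \<omega> [a] \<in> Cinf P \<and> (\<forall>a'\<in>GamA P. \<omega> [a + a'] = \<omega> [a] + \<omega> [a']) \<and>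
       (\<forall>f\<in>Cinf P. \<omega> [smul P f a] = (\<lambda>x. f x * \<omega> [a] x)))"
  unfolding Omega_def by (rule alt_forms_1_iff)

lemma OmegaB1_iff: "X \<in> OmegaB P 1 \<longleftrightarrow>
    (\<forall>as. \<not> (\<exists>a\<in>GamA P. as = [a]) \<longrightarrow> X as = 0) \<and>
    (\<forall>a\<in>GamA P. X [a] \<in> GamB P \<and> (\<forall>a'\<in>GamA P. X [a + a'] = X [a] + X [a']) \<and>
       (\<forall>f\<in>Cinf P. X [smul P f a] = smul P f (X [a])))"
  unfolding OmegaB_def by (rule alt_forms_1_iff)

lemma OmegaB1_off: "X \<in> OmegaB P 1 \<Longrightarrow> \<not> (\<exists>a\<in>GamA P. as = [a]) \<Longrightarrow> X as = 0"
  and OmegaB1_in: "X \<in> OmegaB P 1 \<Longrightarrow> a \<in> GamA P \<Longrightarrow> X [a] \<in> GamB P"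
  and OmegaB1_arg_add: "X \<in> OmegaB P 1 \<Longrightarrow> a \<in> GamA P \<Longrightarrow> a' \<in> GamA P \<Longrightarrow> X [a + a'] = X [a] + X [a']"
  and OmegaB1_arg_smul: "X \<in> OmegaB P 1 \<Longrightarrow> f \<in> Cinf P \<Longrightarrow> a \<in> GamA P \<Longrightarrow> X [smul P f a] = smul P f (X [a])"
  unfolding OmegaB1_iff by blast+

lemma Omega1_off: "\<omega> \<in> Omega P 1 \<Longrightarrow> \<not> (\<exists>a\<in>GamA P. as = [a]) \<Longrightarrow> \<omega> as = 0"
  and Omega1_in: "\<omega> \<in> Omega P 1 \<Longrightarrow> a \<in> GamA P \<Longrightarrow> \<omega> [a] \<in> Cinf P"
  and Omega1_arg_add: "\<omega> \<in> Omega P 1 \<Longrightarrow> a \<in> GamA P \<Longrightarrow> a' \<in> GamA P \<Longrightarrow> \<omega> [a + a'] = \<omega> [a] + \<omega> [a']"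
  and Omega1_arg_smul: "\<omega> \<in> Omega P 1 \<Longrightarrow> f \<in> Cinf P \<Longrightarrow> a \<in> GamA P \<Longrightarrow> \<omega> [smul P f a] = (\<lambda>x. f x * \<omega> [a] x)"
  unfolding Omega1_iff by blast+

lemma OmegaB1_length: "X \<in> OmegaB P 1 \<Longrightarrow> length as \<noteq> 1 \<Longrightarrow> X as = 0"
  by (rule OmegaB1_off) auto

lemma OmegaB1_I:
  assumes "\<And>as. \<not> (\<exists>a\<in>GamA P. as = [a]) \<Longrightarrow> X as = 0"
    and "\<And>a. a \<in> GamA P \<Longrightarrow> X [a] \<in> GamB P"
    and "\<And>a a'. a \<in> GamA P \<Longrightarrow> a' \<in> GamA P \<Longrightarrow> X [a + a'] = X [a] + X [a']"
    and "\<And>f a. f \<in> Cinf P \<Longrightarrow> a \<in> GamA P \<Longrightarrow> X [smul P f a] = smul P f (X [a])"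
  shows "X \<in> OmegaB P 1"
  unfolding OmegaB1_iff using assms by simp

lemma OmegaB1_eqI:
  assumes "X \<in> OmegaB P 1" "Y \<in> OmegaB P 1" "\<And>a. a \<in> GamA P \<Longrightarrow> X [a] = Y [a]"
  shows "X = Y"
proof
  fix as show "X as = Y as"
  proof (cases "\<exists>a\<in>GamA P. as = [a]")
    case True
    then obtain a where "a \<in> GamA P" "as = [a]" by blast
    then show ?thesis using assms(3) by simp
  next
    case False
    then show ?thesis using OmegaB1_off[OF assms(1)] OmegaB1_off[OF assms(2)] by simp
  qed
qed

lemma OmegaB1_in_Gam: "X \<in> OmegaB P 1 \<Longrightarrow> a \<in> GamA P \<Longrightarrow> X [a] \<in> Gam P"
  using OmegaB1_in GamB_subset by blast

lemma OmegaB1_zero: "0 \<in> OmegaB P 1"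
  by (rule OmegaB1_I) (simp_all add: GamB_zero smul_zero)

lemma OmegaB1_add:
  assumes X: "X \<in> OmegaB P 1" and Y: "Y \<in> OmegaB P 1" shows "X + Y \<in> OmegaB P 1"
  by (rule OmegaB1_I)
     (simp_all add: OmegaB1_off[OF X] OmegaB1_off[OF Y] OmegaB1_in[OF X] OmegaB1_in[OF Y]
       OmegaB1_arg_add[OF X] OmegaB1_arg_add[OF Y] OmegaB1_arg_smul[OF X] OmegaB1_arg_smul[OF Y]
       GamB_add smul_add_right)

lemma OmegaB1_smul:
  assumes f: "f \<in> Cinf P" and X: "X \<in> OmegaB P 1" shows "pw (smul P) f X \<in> OmegaB P 1"
  by (rule OmegaB1_I)
     (simp_all add: OmegaB1_off[OF X] OmegaB1_in[OF X] OmegaB1_arg_add[OF X] OmegaB1_arg_smul[OF X]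
       GamB_smul[OF f] smul_add_right smul_smul smul_zero pw_def mult.commute)

lemma OmegaB1_sum:
  assumes "\<And>i. i \<in> I \<Longrightarrow> X i \<in> OmegaB P 1" shows "(\<Sum>i\<in>I. X i) \<in> OmegaB P 1"
  using assms by (induction I rule: infinite_finite_induct) (simp_all add: OmegaB1_zero OmegaB1_add del: One_nat_def)

lemma otimes_in:
  assumes \<omega>: "\<omega> \<in> Omega P 1" and b: "b \<in> GamB P" shows "otimes P \<omega> b \<in> OmegaB P 1"
proof (rule OmegaB1_I)
  show "otimes P \<omega> b as = 0" if "\<not> (\<exists>a\<in>GamA P. as = [a])" for as
    using Omega1_off[OF \<omega> that] by (simp add: otimes_def smul_def fun_eq_iff)
  fix a assume a: "a \<in> GamA P"
  show "otimes P \<omega> b [a] \<in> GamB P" using Omega1_in[OF \<omega> a] b by (simp add: otimes_def GamB_smul)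
  show "otimes P \<omega> b [a + a'] = otimes P \<omega> b [a] + otimes P \<omega> b [a']" if "a' \<in> GamA P" for a'
    using Omega1_arg_add[OF \<omega> a that]
    by (simp add: otimes_def smul_def fun_eq_iff V.scale_left_distrib)
  show "otimes P \<omega> b [smul P f a] = smul P f (otimes P \<omega> b [a])" if "f \<in> Cinf P" for f
    using Omega1_arg_smul[OF \<omega> that a] by (simp add: otimes_def smul_smul)
qed

text \<open>Near a point \<open>p\<close>, a \<open>B\<close>-valued 1-form is a finite sum of simple tensors; multiplied by a cut-off
  function, the summands become global. The coefficients are taken with respect to a frame of the
  whole bundle \<open>L\<close>, in which sections of \<open>B\<close> have smooth coefficients by definition, and the members
  of the frame are afterwards projected to \<open>B\<close>. One factor \<open>\<theta>\<close> extends the coefficient forms by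
  zero, the other one the frame.\<close>

lemma local_decomposition:
  assumes X: "X \<in> OmegaB P 1"
  obtains \<theta> N \<omega> b where "\<theta> \<in> Cinf P" "\<theta> p = 1"
    "\<And>i. i < N \<Longrightarrow> \<omega> i \<in> Omega P 1" "\<And>i. i < N \<Longrightarrow> b i \<in> GamB P"
    "pw (smul P) (\<lambda>x. \<theta> x * \<theta> x) X = (\<Sum>i<N::nat. otimes P (\<omega> i) (b i))"
proof -
  obtain U es where fr: "(U, es) \<in> frames P" and p: "p \<in> U"
  proof -
    have "(\<Union>(U, es) \<in> frames P. U) = UNIV" using bundle_P by (simp add: vector_bundle_def)
    then have "p \<in> (\<Union>(U, es) \<in> frames P. U)" by simp
    then show thesis using that by blast
  qed
  note U = frameD(1)[OF fr] and basis = frameD(2)[OF fr] and es = frameD(3)[OF fr]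
  obtain \<theta> :: "'m \<Rightarrow> 'k" and C where \<theta>: "\<theta> \<in> Cinf P" "\<theta> p = 1" and C: "closed C" "C \<subseteq> U"
    and \<theta>0: "\<And>x. x \<notin> C \<Longrightarrow> \<theta> x = 0"
    by (rule smooth_cutoff[OF manifold U p]) (rule that)
  have \<theta>U: "smooth_on P W \<theta>" for W using \<theta>(1) smooth_on_subset unfolding Cinf_def by blast
  have extend: "smooth_on P W (\<lambda>x. if x \<in> U then \<theta> x * g x else 0)"
    if "smooth_on P (U \<inter> W) g" "open W" for W g
    by (rule smooth_on_extend_by_zero[OF manifold that(2) U C smooth_on_mult[OF manifold \<theta>U that(1)]])
       (use \<theta>0 in auto)
  define N where "N = length es"
  define E where "E i = (\<lambda>x. if x \<in> U then scl P (\<theta> x) ((es ! i) x) else 0)" for i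
  have E: "E i \<in> Gam P" if i: "i < N" for i
  proof (rule GamI)
    have sec: "local_section P U (es ! i)" using es i by (simp add: N_def)
    then show "E i x \<in> fib P x" for x
      using V.subspace_scale[OF subspace_fib] V.subspace_0[OF subspace_fib]
      by (simp add: E_def local_section_def)
    fix U' es' assume F: "(U', es') \<in> frames P"
    note U' = frameD(1)[OF F]
    have "\<forall>(U', es') \<in> frames P. \<exists>g. (\<forall>j < length es'. smooth_on P (U' \<inter> U) (g j)) \<and>
       (\<forall>x \<in> U' \<inter> U. (es ! i) x = (\<Sum>j < length es'. scl P (g j x) ((es' ! j) x)))"
      using sec by (simp add: local_section_def)
    from bspec[OF this F] obtain g where g: "\<And>j. j < length es' \<Longrightarrow> smooth_on P (U' \<inter> U) (g j)"
      "\<And>x. x \<in> U' \<inter> U \<Longrightarrow> (es ! i) x = (\<Sum>j < length es'. scl P (g j x) ((es' ! j) x))"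
      by auto
    let ?g = "\<lambda>j x. if x \<in> U then \<theta> x * g j x else 0"
    have "smooth_on P U' (?g j)" if "j < length es'" for j
      using extend[OF _ U'] g(1)[OF that] by (simp add: Int_commute)
    moreover have "E i x = (\<Sum>j < length es'. scl P (?g j x) ((es' ! j) x))" if "x \<in> U'" for x
      using g(2)[of x] that by (simp add: E_def V.scale_sum_right)
    ultimately show "\<exists>g. (\<forall>j < length es'. smooth_on P U' (g j)) \<and>
       (\<forall>x \<in> U'. E i x = (\<Sum>j < length es'. scl P (g j x) ((es' ! j) x)))"
      by (intro exI[of _ ?g]) simp
  qed
  \<comment> \<open>\<open>cf i x v\<close> is the \<open>i\<close>-th coordinate of \<open>v\<close> in the frame at \<open>x\<close>\<close>
  define cf where "cf i x v =
    V.representation (set (map (\<lambda>e. e x) es)) v ((es ! i) x)" for i x v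
  have ind: "V.independent (set (map (\<lambda>e. e x) es))" "V.span (set (map (\<lambda>e. e x) es)) = fib P x"
    "distinct (map (\<lambda>e. e x) es)" if "x \<in> U" for x
    using basis[OF that] by (auto simp: is_basis_def)
  have inX: "X [a] x \<in> fib P x" if "a \<in> GamA P" for a x
    using OmegaB1_in_Gam[OF X that] by (rule Gam_in_fib)
  have cf_add: "cf i x (v + w) = cf i x v + cf i x w"
    if "x \<in> U" "v \<in> fib P x" "w \<in> fib P x" for i x v w
    unfolding cf_def using that ind[OF that(1)] by (simp add: V.representation_add)
  have cf_scale: "cf i x (scl P c v) = c * cf i x v" if "x \<in> U" "v \<in> fib P x" for i x c v
    unfolding cf_def using that ind[OF that(1)] by (simp add: V.representation_scale)
  have cf_frame: "cf i x ((es ! j) x) = (if j = i then 1 else 0)" if "x \<in> U" "i < N" "j < N" for i j x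
  proof -
    have "(es ! i) x = (es ! j) x \<longleftrightarrow> j = i"
      using nth_eq_iff_index_eq[OF ind(3)[OF that(1)], of i j] that by (auto simp: N_def)
    moreover have "(es ! j) x \<in> set (map (\<lambda>e. e x) es)" using that by (simp add: N_def)
    ultimately show ?thesis unfolding cf_def using V.representation_basis[OF ind(1)[OF that(1)]] by simp
  qed
  have es_fib: "(es ! j) x \<in> fib P x" if "x \<in> U" "j < N" for j x
    using es[of "es ! j"] that by (simp add: local_section_def N_def)
  have cf_sum: "cf i x (\<Sum>j\<in>J. scl P (g j) ((es ! j) x)) = (\<Sum>j\<in>J. g j * (if j = i then 1 else 0))"
    if "x \<in> U" "i < N" "J \<subseteq> {..<N}" for i x g J
  proof -
    have "finite J" using that(3) finite_subset by blast
    then show ?thesis using that(3)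
    proof (induction J)
      case empty
      show ?case using cf_scale[OF that(1) V.subspace_0[OF subspace_fib], of i 0] by simp
    next
      case (insert j J)
      have "(\<Sum>j\<in>J. scl P (g j) ((es ! j) x)) \<in> fib P x"
        using insert.prems es_fib[OF that(1)]
        by (intro V.subspace_sum[OF subspace_fib] V.subspace_scale[OF subspace_fib]) auto
      then show ?case using insert es_fib[OF that(1), of j]
        by (simp add: cf_add cf_scale cf_frame that V.subspace_scale[OF subspace_fib])
    qed
  qed
  define \<omega> where "\<omega> i as = (\<lambda>x. if (\<exists>a\<in>GamA P. as = [a]) \<and> x \<in> U then \<theta> x * cf i x (X as x) else 0)" for i as
  have \<omega>_val: "\<omega> i [a] x = (if x \<in> U then \<theta> x * cf i x (X [a] x) else 0)" if "a \<in> GamA P" for i a x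
    using that by (simp add: \<omega>_def)
  have coeffs: "\<exists>g.
   (\<forall>i<N. smooth_on P U (g i)) \<and> (\<forall>x\<in>U. X [a] x = (\<Sum>i<N. scl P (g i x) ((es ! i) x)))"
    if a: "a \<in> GamA P" for a
  proof -
    obtain g where "\<And>i. i < length es \<Longrightarrow> smooth_on P U (g i)"
      "\<And>x. x \<in> U \<Longrightarrow> X [a] x = (\<Sum>i < length es. scl P (g i x) ((es ! i) x))"
      by (rule Gam_coeffs[OF OmegaB1_in_Gam[OF X a] fr]) (rule that)
    then show ?thesis unfolding N_def by (intro exI[of _ g]) simp
  qed
  have \<omega>: "\<omega> i \<in> Omega P 1" if i: "i < N" for i
    unfolding Omega1_iff
  proof (intro conjI allI ballI impI)
    show "\<omega> i as = 0" if "\<not> (\<exists>a\<in>GamA P. as = [a])" for as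
      using that by (auto simp: \<omega>_def fun_eq_iff)
    fix a assume a: "a \<in> GamA P"
    obtain g where g: "\<forall>i<N. smooth_on P U (g i)" "\<forall>x\<in>U. X [a] x = (\<Sum>i<N. scl P (g i x) ((es ! i) x))"
      using coeffs[OF a] by blast
    have "cf i x (X [a] x) = g i x" if x: "x \<in> U" for x
    proof -
      have "cf i x (X [a] x) = (\<Sum>j<N. g j x * (if j = i then 1 else 0))"
        unfolding g(2)[rule_format, OF x] by (rule cf_sum[OF x i]) simp
      then show ?thesis using i by (simp add: if_distrib[of "\<lambda>c. _ * c"] cong: if_cong)
    qed
    then have "\<omega> i [a] = (\<lambda>x. if x \<in> U then \<theta> x * g i x else 0)"
      using a by (intro ext) (simp add: \<omega>_val)
    then show "\<omega> i [a] \<in> Cinf P" using extend[of UNIV "g i"] g(1) i by (simp add: Cinf_def)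
    show "\<omega> i [a + a'] = \<omega> i [a] + \<omega> i [a']" if a': "a' \<in> GamA P" for a'
      using a a' GamA_add[OF a a']
      by (intro ext) (simp add: \<omega>_val OmegaB1_arg_add[OF X] cf_add inX distrib_left)
    show "\<omega> i [smul P f a] = (\<lambda>x. f x * \<omega> i [a] x)" if f: "f \<in> Cinf P" for f
    proof -
      have "X [smul P f a] x = scl P (f x) (X [a] x)" for x
        using OmegaB1_arg_smul[OF X f a] by (simp add: smul_def)
      then show ?thesis using a GamA_smul[OF f a] by (intro ext) (simp add: \<omega>_val cf_scale inX)
    qed
  qed
  have bi: "prB P (E i) \<in> GamB P" if "i < N" for i using prB_in[OF E[OF that]] .
  have "pw (smul P) (\<lambda>x. \<theta> x * \<theta> x) X = (\<Sum>i<N. otimes P (\<omega> i) (prB P (E i)))"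
  proof (rule OmegaB1_eqI)
    show "pw (smul P) (\<lambda>x. \<theta> x * \<theta> x) X \<in> OmegaB P 1"
      by (intro OmegaB1_smul Cinf_mult manifold \<theta> X)
    show "(\<Sum>i<N. otimes P (\<omega> i) (prB P (E i))) \<in> OmegaB P 1"
      using \<omega> bi by (intro OmegaB1_sum otimes_in) auto
    fix a assume a: "a \<in> GamA P"
    have sumB: "(\<Sum>i<n. smul P (\<omega> i [a]) (E i)) \<in> Gam P \<and>
        prB P (\<Sum>i<n. smul P (\<omega> i [a]) (E i)) = (\<Sum>i<n. smul P (\<omega> i [a]) (prB P (E i)))" if "n \<le> N" for n
      using that
    proof (induction n)
      case 0 show ?case by (simp only: lessThan_0 sum.empty Gam_zero prB_0 simp_thms)
    next
      case (Suc n)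
      have "\<omega> n [a] \<in> Cinf P" "E n \<in> Gam P"
        using Omega1_in[OF \<omega> a] E Suc.prems by simp_all
      then show ?case using Suc unfolding sum.lessThan_Suc
        by (simp only: Suc_leD Gam_add Gam_smul prB_add prB_smul simp_thms)
    qed
    have "smul P (\<lambda>x. \<theta> x * \<theta> x) (X [a]) = (\<Sum>i<N. smul P (\<omega> i [a]) (E i))"
    proof
      fix x
      obtain g where g: "\<forall>x\<in>U. X [a] x = (\<Sum>i<N. scl P (g i x) ((es ! i) x))"
        using coeffs[OF a] by blast
      have ap: "(\<Sum>i<n. F i) x = (\<Sum>i<n. F i x)" for n :: nat and F :: "nat \<Rightarrow> 'm \<Rightarrow> 'v"
        by (induction n) auto
      show "smul P (\<lambda>x. \<theta> x * \<theta> x) (X [a]) x = (\<Sum>i<N. smul P (\<omega> i [a]) (E i)) x"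
      proof (cases "x \<in> U")
        case True
        have c: "cf i x (X [a] x) = g i x" if i: "i < N" for i
        proof -
          have "cf i x (X [a] x) = (\<Sum>j<N. g j x * (if j = i then 1 else 0))"
            unfolding g[rule_format, OF True] by (rule cf_sum[OF True i]) simp
          then show ?thesis using i by (simp add: if_distrib[of "\<lambda>c. _ * c"] cong: if_cong)
        qed
        have "(\<Sum>i<N. smul P (\<omega> i [a]) (E i)) x = (\<Sum>i<N. scl P (\<theta> x * \<theta> x) (scl P (g i x) ((es ! i) x)))"
          unfolding ap using True a c by (intro sum.cong) (auto simp: smul_def \<omega>_val E_def mult_ac)
        then show ?thesis using g True by (simp add: smul_def V.scale_sum_right)
      next
        case False
        then have "\<theta> x = 0" using \<theta>0 C(2) by blast
        then show ?thesis using False by (simp add: ap smul_def E_def)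
      qed
    qed
    \<comment> \<open>projection to \<open>B\<close> leaves the left-hand side unchanged\<close>
    then have "smul P (\<lambda>x. \<theta> x * \<theta> x) (X [a]) = (\<Sum>i<N. smul P (\<omega> i [a]) (prB P (E i)))"
      using sumB[of N] prB_GamB[OF GamB_smul[OF Cinf_mult[OF manifold \<theta>(1) \<theta>(1)] OmegaB1_in[OF X a]]]
      by simp
    moreover have "(\<Sum>i<n. F i) as = (\<Sum>i<n. F i as)"
      for n :: nat and F :: "nat \<Rightarrow> ('m \<Rightarrow> 'v) list \<Rightarrow> 'm \<Rightarrow> 'v" and as
      by (induction n) auto
    ultimately show "pw (smul P) (\<lambda>x. \<theta> x * \<theta> x) X [a] = (\<Sum>i<N. otimes P (\<omega> i) (prB P (E i))) [a]"
      by (simp add: pw_def otimes_def)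
  qed
  then show thesis using that[of \<theta> N \<omega> "\<lambda>i. prB P (E i)"] \<theta> \<omega> bi by blast
qed

text \<open>At the point \<open>p\<close>, the forms \<open>X\<close> and \<open>\<theta>\<^sup>2 X\<close> have the same image under a \<open>C\<^sup>\<infinity>\<close>-linear operator,
  and the second one is a sum of simple tensors.\<close>

lemma tensorial_vanishes:
  fixes D :: "(('m \<Rightarrow> 'v) list \<Rightarrow> 'm \<Rightarrow> 'v) \<Rightarrow> 'm \<Rightarrow> 'v"
  assumes add: "\<And>X Y. X \<in> OmegaB P 1 \<Longrightarrow> Y \<in> OmegaB P 1 \<Longrightarrow> D (X + Y) = D X + D Y"
    and lin: "\<And>f X. f \<in> Cinf P \<Longrightarrow> X \<in> OmegaB P 1 \<Longrightarrow> D (pw (smul P) f X) = smul P f (D X)"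
    and simple: "\<And>\<omega> b. \<omega> \<in> Omega P 1 \<Longrightarrow> b \<in> GamB P \<Longrightarrow> D (otimes P \<omega> b) = 0"
    and X: "X \<in> OmegaB P 1"
  shows "D X = 0"
proof
  fix p
  obtain \<theta> N \<omega> b where \<theta>: "\<theta> \<in> Cinf P" "\<theta> p = 1"
    and \<omega>: "\<And>i. i < N \<Longrightarrow> \<omega> i \<in> Omega P 1" and b: "\<And>i. i < N \<Longrightarrow> b i \<in> GamB P"
    and dec: "pw (smul P) (\<lambda>x. \<theta> x * \<theta> x) X = (\<Sum>i<N::nat. otimes P (\<omega> i) (b i))"
    by (rule local_decomposition[OF X, where p = p]) (rule that)
  have D0: "D 0 = 0" using add[OF OmegaB1_zero OmegaB1_zero] by simp
  have "D (\<Sum>i<n. otimes P (\<omega> i) (b i)) = 0" if "n \<le> N" for n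
    using that
  proof (induction n)
    case (Suc n)
    have "(\<Sum>i<n. otimes P (\<omega> i) (b i)) \<in> OmegaB P 1"
      using Suc.prems \<omega> b by (intro OmegaB1_sum otimes_in) auto
    moreover have "otimes P (\<omega> n) (b n) \<in> OmegaB P 1" "D (otimes P (\<omega> n) (b n)) = 0"
      using Suc.prems \<omega> b by (auto intro: otimes_in simple)
    ultimately show ?case unfolding sum.lessThan_Suc using Suc by (subst add) auto
  qed (simp add: D0)
  then have "smul P (\<lambda>x. \<theta> x * \<theta> x) (D X) = 0"
    using lin[OF Cinf_mult[OF manifold \<theta>(1) \<theta>(1)] X] dec by simp
  then show "D X p = 0 p" using \<theta>(2) by (auto simp: smul_def fun_eq_iff dest: spec[of _ p])
qed

end

section \<open>The brackets and the adjoint action on 1-forms\<close>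

lemma Sh_trivial: "p + q \<le> 1 \<Longrightarrow> Sh p q = {id}"
proof -
  assume pq: "p + q \<le> 1"
  have "\<sigma> permutes {..<p + q} \<longleftrightarrow> \<sigma> = id" for \<sigma>
  proof (cases "p + q = 0")
    case False
    then have "{..<p + q} = {0}" using pq by auto
    then show ?thesis by simp
  qed simp
  moreover have "strict_mono_on A id" for A :: "nat set" by (simp add: strict_mono_on_def)
  ultimately show ?thesis unfolding Sh_def by (intro set_eqI) auto
qed

lemma pick_simps: "pick as \<sigma> i i = []" "pick [a] id 0 1 = [a]"
  by (simp_all add: pick_def)

lemma wedge_low_degree:
  "wedge 0 0 \<omega> \<eta> [] x = \<omega> [] x * \<eta> [] x"
  "wedge 0 1 \<omega> \<eta> [a] x = \<omega> [] x * \<eta> [a] x"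
  "wedge 1 0 \<omega> \<eta> [a] x = \<omega> [a] x * \<eta> [] x"
  by (simp_all add: wedge_def Sh_trivial sign_id pick_simps del: One_nat_def)

lemma dotB_low_degree:
  "dotB P 0 0 \<omega> Y [] x = scl P (\<omega> [] x) (Y [] x)"
  "dotB P 0 1 \<omega> Y [a] x = scl P (\<omega> [] x) (Y [a] x)"
  "dotB P 1 0 \<omega> Y [a] x = scl P (\<omega> [a] x) (Y [] x)"
  by (simp_all add: dotB_def Sh_trivial sign_id pick_simps del: One_nat_def)

lemma dotB_length: "length as \<noteq> p + q \<Longrightarrow> dotB P p q \<omega> Y as = 0"
  by (simp add: dotB_def fun_eq_iff)

context split_pair
begin

lemma OmegaB_zero: "0 \<in> OmegaB P k"
  by (simp add: OmegaB_def alt_forms_def GamB_zero smul_zero)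

lemma OmegaB_subset_total: "OmegaB P k \<subseteq> OmegaB_total P"
proof
  fix X assume X: "X \<in> OmegaB P k"
  have "(\<Sum>i<Suc k. if i = k then X else 0) = X" by simp
  moreover have "\<forall>i<Suc k. (if i = k then X else 0) \<in> OmegaB P i" using X OmegaB_zero by simp
  ultimately show "X \<in> OmegaB_total P" unfolding OmegaB_total_def
    by (intro CollectI exI[of _ "Suc k"] exI[of _ "\<lambda>i. if i = k then X else 0"]) simp
qed

lemma pw_apply: "pw s c F z = s c (F z)"
  by (simp add: pw_def)

lemma smul_diff_right: "smul P f (u - v) = smul P f u - smul P f v"
  by (simp add: smul_def fun_eq_iff V.scale_right_diff_distrib)

lemma form0_Nil: "form0 u [] = u"
  by (simp add: form0_def)

lemma form0_eq_otimes: "form0 b = otimes P (form0 (\<lambda>_. 1)) b"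
  by (rule ext) (simp add: form0_def otimes_def smul_1, simp add: smul_def fun_eq_iff)

lemma dotB_form0:
  assumes Y: "Y \<in> OmegaB P 1" shows "dotB P 0 1 (form0 f) Y = pw (smul P) f Y"
proof
  fix as show "dotB P 0 1 (form0 f) Y as = pw (smul P) f Y as"
  proof (cases "length as = 1")
    case True
    then obtain a where "as = [a]" by (auto simp: length_Suc_conv One_nat_def)
    then show ?thesis by (intro ext) (simp add: dotB_low_degree pw_def smul_def form0_def)
  next
    case False
    then show ?thesis using OmegaB1_length[OF Y False] by (simp add: dotB_length pw_def smul_zero)
  qed
qed

lemma otimes_eq_dotB:
  assumes \<omega>: "\<omega> \<in> Omega P 1" shows "otimes P \<omega> b = dotB P 1 0 \<omega> (form0 b)"
proof
  fix as show "otimes P \<omega> b as = dotB P 1 0 \<omega> (form0 b) as"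
  proof (cases "length as = 1")
    case True
    then obtain a where "as = [a]" by (auto simp: length_Suc_conv One_nat_def)
    then show ?thesis by (intro ext) (simp add: dotB_low_degree otimes_def smul_def form0_def)
  next
    case False
    then have "\<omega> as = 0" by (intro Omega1_off[OF \<omega>]) auto
    then show ?thesis using False by (simp add: dotB_length otimes_def smul_def fun_eq_iff)
  qed
qed

lemma OmegaB1_zero_arg:
  assumes Y: "Y \<in> OmegaB P 1" shows "Y (0 # as) = 0"
proof (cases "as = []")
  case True
  then show ?thesis using OmegaB1_arg_add[OF Y GamA_zero GamA_zero] by simp
next
  case False
  then show ?thesis by (intro OmegaB1_length[OF Y]) (simp add: One_nat_def)
qed

text \<open>For two 1-forms only the summand of degrees \<open>(1, 1)\<close> contributes to the action: in every other
  one, some form is evaluated on a list of the wrong length.\<close>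

lemma act2_eq_0:
  assumes X: "X \<in> OmegaB P 1" and Y: "Y \<in> OmegaB P 1" and \<delta>: "\<delta> 0 = 0"
    and ij: "i + j = length as + 1" "\<not> (i = 1 \<and> j = 1)"
  shows "act2 P i j \<delta> X Y as = 0"
proof -
  have "Y (prA P (\<delta> (X (pick as \<sigma> 0 i))) # pick as \<sigma> i (i + j - 1)) = 0" if "j \<ge> 1" for \<sigma>
  proof (cases "i = 1")
    case True
    then show ?thesis using ij that by (intro OmegaB1_length[OF Y]) (simp add: pick_def)
  next
    case False
    then have "X (pick as \<sigma> 0 i) = 0" by (intro OmegaB1_length[OF X]) (simp add: pick_def)
    then show ?thesis by (simp add: \<delta> prA_0 OmegaB1_zero_arg[OF Y])
  qed
  moreover have "X (prA P (\<delta> (Y (pick as \<sigma> (i - 1) (i + j - 1)))) # pick as \<sigma> 0 (i - 1)) = 0"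
    if "i \<ge> 1" for \<sigma>
  proof (cases "j = 1")
    case True
    then show ?thesis using ij that by (intro OmegaB1_length[OF X]) (simp add: pick_def)
  next
    case False
    then have "Y (pick as \<sigma> (i - 1) (i + j - 1)) = 0"
      using that by (intro OmegaB1_length[OF Y]) (simp add: pick_def)
    then show ?thesis by (simp add: \<delta> prA_0 OmegaB1_zero_arg[OF X])
  qed
  ultimately show ?thesis
    by (auto simp: act2_def Let_def pw_eq_smul smul_zero)
qed

lemma mu_two_1forms:
  assumes X: "X \<in> OmegaB P 1" and Y: "Y \<in> OmegaB P 1" and \<delta>: "\<delta> 0 = 0"
  shows "length as \<noteq> 1 \<Longrightarrow> mu P \<delta> [X, Y] as = 0"
    and "a \<in> GamA P \<Longrightarrow> mu P \<delta> [X, Y] [a] = Y [prA P (\<delta> (X [a]))] + X [prA P (\<delta> (Y [a]))]"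
proof -
  note act0 = act2_eq_0[where \<delta> = \<delta>, OF X Y \<delta>]
  have "(\<Sum>i\<le>length as + 1. act2 P i (length as + 1 - i) \<delta> X Y as) = 0" if "length as \<noteq> 1"
    using that by (intro sum.neutral ballI act0) auto
  then show "length as \<noteq> 1 \<Longrightarrow> mu P \<delta> [X, Y] as = 0" by (simp add: mu_def)
next
  assume a: "a \<in> GamA P"
  have "(\<Sum>i\<le>length [a] + 1. act2 P i (length [a] + 1 - i) \<delta> X Y [a]) =
      (\<Sum>i\<in>{1}. act2 P i (length [a] + 1 - i) \<delta> X Y [a])"
    by (intro sum.mono_neutral_right ballI act2_eq_0[where \<delta> = \<delta>, OF X Y \<delta>]) auto
  then have "mu P \<delta> [X, Y] [a] = act2 P 1 1 \<delta> X Y [a]" by (simp add: mu_def flip: One_nat_def)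
  also have "\<dots> = Y [prA P (\<delta> (X [a]))] + X [prA P (\<delta> (Y [a]))]"
    using a by (simp add: act2_def Let_def Sh_trivial sign_id pick_simps pw_eq_smul smul_1 flip: One_nat_def)
  finally show "mu P \<delta> [X, Y] [a] = Y [prA P (\<delta> (X [a]))] + X [prA P (\<delta> (Y [a]))]" .
qed

lemma ad_0: "b \<in> Gam P \<Longrightarrow> ad P b 0 = 0"
  by (simp add: ad_def Gam_zero brk_zero_right)

lemma ad_apply: "u \<in> Gam P \<Longrightarrow> ad P b u = brk P b u"
  by (simp add: ad_def)

end

locale split_pair_brackets = split_pair P
  for P :: "('m::{t2_space,second_countable_topology}, 'k::real_or_complex_field, 'v::ab_group_add) lie_pair" +
  fixes br :: "(('m \<Rightarrow> 'v) list \<Rightarrow> 'm \<Rightarrow> 'v) list \<Rightarrow> ('m \<Rightarrow> 'v) list \<Rightarrow> 'm \<Rightarrow> 'v"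
  assumes L3: "L3_brackets P br"
begin

lemma br_add: "set Xs \<subseteq> OmegaB_total P \<Longrightarrow> set Ys \<subseteq> OmegaB_total P \<Longrightarrow> X \<in> OmegaB_total P \<Longrightarrow>
    Y \<in> OmegaB_total P \<Longrightarrow> br (Xs @ (X + Y) # Ys) = br (Xs @ X # Ys) + br (Xs @ Y # Ys)"
  using L3 unfolding L3_brackets_def by (elim conjE) (drule spec[of _ Xs], drule spec[of _ Ys], blast)

lemma br_scale: "set Xs \<subseteq> OmegaB_total P \<Longrightarrow> set Ys \<subseteq> OmegaB_total P \<Longrightarrow> X \<in> OmegaB_total P \<Longrightarrow>
    br (Xs @ pw (pw (scl P)) c X # Ys) = pw (pw (scl P)) c (br (Xs @ X # Ys))"
  using L3 unfolding L3_brackets_def by (elim conjE) (drule spec[of _ Xs], drule spec[of _ Ys], blast)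

lemma br_degree: "list_all2 (\<lambda>X k. X \<in> OmegaB P k) Xs ks \<Longrightarrow> length Xs \<le> sum_list ks + 2 \<Longrightarrow>
    br Xs \<in> OmegaB P (sum_list ks + 2 - length Xs)"
  using L3 unfolding L3_brackets_def by (elim conjE) metis

lemma br_swap:
  assumes "set Xs \<subseteq> OmegaB_total P" "set Ys \<subseteq> OmegaB_total P" "X \<in> OmegaB P i" "Y \<in> OmegaB P j"
  shows "br (Xs @ X # Y # Ys) = pw (pw (scl P)) (- ((- 1) ^ (i * j))) (br (Xs @ Y # X # Ys))"
proof -
  have "\<forall>Xs Ys i j. set Xs \<subseteq> OmegaB_total P \<longrightarrow> set Ys \<subseteq> OmegaB_total P \<longrightarrow>
        (\<forall>X\<in>OmegaB P i. \<forall>Y\<in>OmegaB P j.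
           br (Xs @ X # Y # Ys) = pw (pw (scl P)) (- ((- 1) ^ (i * j))) (br (Xs @ Y # X # Ys)))"
    using L3 unfolding L3_brackets_def by (elim conjE) assumption
  from this[rule_format, OF assms] show ?thesis .
qed

lemma br_long: "4 \<le> length Xs \<Longrightarrow> br Xs = 0"
  and br_one: "X \<in> OmegaB_total P \<Longrightarrow> br [X] = dBott P X"
  and br_two: "b \<in> GamB P \<Longrightarrow> b' \<in> GamB P \<Longrightarrow> br [form0 b, form0 b'] = form0 (brkB P b b')"
  and br_three: "b \<in> GamB P \<Longrightarrow> b' \<in> GamB P \<Longrightarrow> b'' \<in> GamB P \<Longrightarrow> br [form0 b, form0 b', form0 b''] = 0"
  using L3 unfolding L3_brackets_def by simp_all

lemma br_two_Leibniz:
  obtains \<rho>1 where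
    "\<And>k p \<omega> \<eta> b. \<omega> \<in> Omega P p \<Longrightarrow> \<eta> \<in> Omega P k \<Longrightarrow> b \<in> GamB P \<Longrightarrow>
       \<rho>1 (otimes P \<eta> b) \<omega> = wedge k p \<eta> (eth_form P b \<omega>)"
    "\<And>i p j X \<omega> Y. X \<in> OmegaB P i \<Longrightarrow> \<omega> \<in> Omega P p \<Longrightarrow> Y \<in> OmegaB P j \<Longrightarrow>
       br [X, dotB P p j \<omega> Y] = dotB P (i + p) j (\<rho>1 X \<omega>) Y +
            pw (pw (scl P)) ((- 1) ^ (p * i)) (dotB P p (i + j) \<omega> (br [X, Y]))"
proof -
  obtain \<rho>1 where r: "is_rho1 P \<rho>1" and
    l: "\<forall>i p j. \<forall>X\<in>OmegaB P i. \<forall>\<omega>\<in>Omega P p. \<forall>Y\<in>OmegaB P j.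
          br [X, dotB P p j \<omega> Y] =
            dotB P (i + p) j (\<rho>1 X \<omega>) Y +
            pw (pw (scl P)) ((- 1) ^ (p * i)) (dotB P p (i + j) \<omega> (br [X, Y]))"
    using L3 unfolding L3_brackets_def by (elim conjE exE) (rule that)
  show thesis
  proof (rule that)
    show "\<rho>1 (otimes P \<eta> b) \<omega> = wedge k p \<eta> (eth_form P b \<omega>)"
      if "\<omega> \<in> Omega P p" "\<eta> \<in> Omega P k" "b \<in> GamB P" for k p \<omega> \<eta> b
      using r that unfolding is_rho1_def by simp
  qed (use l in simp)
qed

lemma br_three_Leibniz:
  obtains \<rho>2 where
    "\<And>i j \<omega> X Y. \<omega> \<in> Omega P 0 \<Longrightarrow> X \<in> OmegaB P i \<Longrightarrow> Y \<in> OmegaB P j \<Longrightarrow> \<rho>2 X Y \<omega> = 0"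
    "\<And>i j p \<omega> \<eta> b \<eta>' b'. \<omega> \<in> Omega P p \<Longrightarrow> \<eta> \<in> Omega P i \<Longrightarrow> b \<in> GamB P \<Longrightarrow> \<eta>' \<in> Omega P j \<Longrightarrow>
       b' \<in> GamB P \<Longrightarrow> \<rho>2 (otimes P \<eta> b) (otimes P \<eta>' b') \<omega> = (\<lambda>as x. (- 1) ^ (i + j + 1) *
              wedge i (j + (p - 1)) \<eta> (wedge j (p - 1) \<eta>' (contract (beta P b b') \<omega>)) as x)"
    "\<And>i j p k X Y \<omega> Z. X \<in> OmegaB P i \<Longrightarrow> Y \<in> OmegaB P j \<Longrightarrow> \<omega> \<in> Omega P p \<Longrightarrow> Z \<in> OmegaB P k \<Longrightarrow>
       br [X, Y, dotB P p k \<omega> Z] = dotB P (i + j + (p - 1)) k (\<rho>2 X Y \<omega>) Z +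
            pw (pw (scl P)) ((- 1) ^ (p * (i + j + 1))) (dotB P p (i + j + k - 1) \<omega> (br [X, Y, Z]))"
proof -
  obtain \<rho>2 where r: "is_rho2 P \<rho>2" and
    l: "\<forall>i j p k. \<forall>X\<in>OmegaB P i. \<forall>Y\<in>OmegaB P j. \<forall>\<omega>\<in>Omega P p. \<forall>Z\<in>OmegaB P k.
          br [X, Y, dotB P p k \<omega> Z] =
            dotB P (i + j + (p - 1)) k (\<rho>2 X Y \<omega>) Z +
            pw (pw (scl P)) ((- 1) ^ (p * (i + j + 1)))
              (dotB P p (i + j + k - 1) \<omega> (br [X, Y, Z]))"
    using L3 unfolding L3_brackets_def by (elim conjE exE) (rule that)
  show thesis
  proof (rule that[of \<rho>2])
    show "\<rho>2 X Y \<omega> = 0" if "\<omega> \<in> Omega P 0" "X \<in> OmegaB P i" "Y \<in> OmegaB P j" for i j \<omega> X Y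
    proof -
      have "(\<forall>X\<in>OmegaB P i. \<forall>Y\<in>OmegaB P j. \<rho>2 X Y \<omega> = 0)"
        using r[unfolded is_rho2_def, THEN spec[of _ i], THEN spec[of _ j], THEN spec[of _ 0], THEN bspec,
            OF that(1), THEN conjunct1] by simp
      then show ?thesis using that by blast
    qed
    show "\<rho>2 (otimes P \<eta> b) (otimes P \<eta>' b') \<omega> = (\<lambda>as x. (- 1) ^ (i + j + 1) *
              wedge i (j + (p - 1)) \<eta> (wedge j (p - 1) \<eta>' (contract (beta P b b') \<omega>)) as x)"
      if "\<omega> \<in> Omega P p" "\<eta> \<in> Omega P i" "b \<in> GamB P" "\<eta>' \<in> Omega P j" "b' \<in> GamB P" for i j p \<omega> \<eta> b \<eta>' b'
      using r[unfolded is_rho2_def, THEN spec[of _ i], THEN spec[of _ j], THEN spec[of _ p], THEN bspec,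
          OF that(1), THEN conjunct2] that(2-) by blast
  qed (use l in simp)
qed

text \<open>The case \<open>n = 0\<close> of the identity is \<open>\<nabla>\<^sub>a b = pr\<^sub>B [a, b] = - pr\<^sub>B (ad\<^sub>b a)\<close>. All values of the
  differential on longer lists vanish, as \<open>b\<close> has degree 0.\<close>

lemma br_form0:
  assumes b: "b \<in> GamB P" shows "br [form0 b] = mu P (ad P b) []"
proof
  fix as
  have bG: "b \<in> Gam P" using b GamB_subset by blast
  have "br [form0 b] as = dBott P (form0 b) as"
    using br_one form0_in_OmegaB[OF b] OmegaB_subset_total by (simp add: subset_eq)
  also have "\<dots> = mu P (ad P b) [] as"
  proof (cases "set as \<subseteq> GamA P")
    case False
    then show ?thesis by (auto simp: dBott_def mu_def)
  next
    case as: True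
    consider "as = []" | a where "as = [a]" | "length as \<ge> 2" by (cases as rule: remdups_adj.cases) auto
    then show ?thesis
    proof cases
      case 1
      then show ?thesis by (simp add: dBott_def mu_def)
    next
      case 2
      then have a: "a \<in> GamA P" "a \<in> Gam P" using as GamA_subset by auto
      have "nths [a] (- {0}) = []" by (simp add: nths_Cons)
      then have "dBott P (form0 b) as = nabla P a b"
        using 2 as by (simp add: dBott_def form0_def pw_eq_smul smul_1)
      also have "\<dots> = - prB P (ad P b a)"
        using brk_anti[OF a(2) bG] prB_uminus[OF brk_in[OF bG a(2)]]
        by (simp add: nabla_def ad_apply[OF a(2)])
      finally show ?thesis using 2 as by (simp add: mu_def)
    next
      case 3
      have "form0 b (nths as (- {i})) = 0" for i
      proof -
        have "nths as (- {i}) \<noteq> []"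
        proof
          assume "nths as (- {i}) = []"
          then have "set (nths as (- {i})) = {}" by simp
          then have "{..<length as} \<subseteq> {i}" by (auto simp: set_nths)
          then have "card {..<length as} \<le> card {i}" by (intro card_mono) auto
          then show False using 3 by simp
        qed
        then show ?thesis by (simp add: form0_def)
      qed
      moreover have "form0 b (x # xs) = 0" for x :: "'m \<Rightarrow> 'v" and xs by (simp add: form0_def)
      moreover have "nabla P (as ! i) 0 = 0" if "i < length as" for i
        using brk_zero_right[of "as ! i"] prB_0 as nth_mem[OF that] GamA_subset
        by (simp add: nabla_def subset_eq)
      ultimately show ?thesis using 3 as by (simp add: dBott_def mu_def pw_eq_smul smul_zero)
    qed
  qed
  finally show "br [form0 b] as = mu P (ad P b) [] as" .
qed

lemma br_in_OmegaB1:
  assumes "b \<in> GamB P" "set Xs \<subseteq> OmegaB P 1" shows "br (form0 b # Xs) \<in> OmegaB P 1"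
proof -
  have "list_all2 (\<lambda>X k. X \<in> OmegaB P k) (form0 b # Xs) (0 # replicate (length Xs) 1)"
    using assms(2) form0_in_OmegaB[OF assms(1)] by (induction Xs) auto
  from br_degree[OF this] show ?thesis by (simp add: sum_list_replicate flip: One_nat_def)
qed

text \<open>Both sides satisfy the same Leibniz rule, \<open>D(f X) = (\<rho>\<^sub>L(b) f) X + f D(X)\<close>. On the side of the
  action, this is the Leibniz rule of \<open>[b, \<cdot>]\<^sub>L\<close>, applied to \<open>f X(a)\<close>. The difference is therefore
  \<open>C\<^sup>\<infinity>\<close>-linear in \<open>X\<close>, and only simple tensors remain.\<close>

lemma binary_bracket_eq_action:
  assumes b: "b \<in> GamB P" and X: "X \<in> OmegaB P 1"
  shows "br [form0 b, X] = mu P (ad P b) [X]"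
proof -
  have bG: "b \<in> Gam P" using b GamB_subset by blast
  have bT: "set [form0 b] \<subseteq> OmegaB_total P" using form0_in_OmegaB[OF b] OmegaB_subset_total by auto
  have T: "Y \<in> OmegaB P 1 \<Longrightarrow> Y \<in> OmegaB_total P" for Y using OmegaB_subset_total by blast
  obtain \<rho>1 where r: "\<And>k p \<omega> \<eta> b. \<omega> \<in> Omega P p \<Longrightarrow> \<eta> \<in> Omega P k \<Longrightarrow> b \<in> GamB P \<Longrightarrow>
       \<rho>1 (otimes P \<eta> b) \<omega> = wedge k p \<eta> (eth_form P b \<omega>)"
    and L: "\<And>i p j X \<omega> Y. X \<in> OmegaB P i \<Longrightarrow> \<omega> \<in> Omega P p \<Longrightarrow> Y \<in> OmegaB P j \<Longrightarrow>
       br [X, dotB P p j \<omega> Y] = dotB P (i + p) j (\<rho>1 X \<omega>) Y +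
            pw (pw (scl P)) ((- 1) ^ (p * i)) (dotB P p (i + j) \<omega> (br [X, Y]))"
    by (rule br_two_Leibniz) (rule that)
  have r0: "\<rho>1 (form0 b) \<omega> = wedge 0 p (form0 (\<lambda>_. 1)) (eth_form P b \<omega>)" if "\<omega> \<in> Omega P p" for \<omega> p
    using r[OF that form0_in_Omega[OF Cinf_const[of 1]] b] by (simp flip: form0_eq_otimes)
  have on_section: "br [form0 b, X] [a] = - X [eth P b a] + prB P (brk P b (X [a]))"
    if a: "a \<in> GamA P" for a
  proof -
    have aG: "a \<in> Gam P" using a GamA_subset by blast
    have ea: "eth P b a \<in> GamA P" unfolding eth_def by (rule prA_in[OF brk_in[OF bG aG]])
    define D where "D X = br [form0 b, X] [a] - (- X [eth P b a] + prB P (brk P b (X [a])))" for X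
    have "D X = 0"
    proof (rule tensorial_vanishes[OF _ _ _ X])
      fix X Y assume X: "X \<in> OmegaB P 1" and Y: "Y \<in> OmegaB P 1"
      have 1: "br [form0 b, X + Y] = br [form0 b, X] + br [form0 b, Y]"
        using br_add[OF bT _ T[OF X] T[OF Y], of "[]"] by simp
      have 2: "brk P b ((X + Y) [a]) = brk P b (X [a]) + brk P b (Y [a])"
        using brk_add_right[OF OmegaB1_in_Gam[OF X a] OmegaB1_in_Gam[OF Y a] bG] by simp
      show "D (X + Y) = D X + D Y"
        unfolding D_def 1 2
        using prB_add[OF brk_in[OF bG OmegaB1_in_Gam[OF X a]] brk_in[OF bG OmegaB1_in_Gam[OF Y a]]]
        by (simp add: algebra_simps)
    next
      fix f :: "'m \<Rightarrow> 'k" and X assume f: "f \<in> Cinf P" and X: "X \<in> OmegaB P 1"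
      note XG = OmegaB1_in_Gam[OF X a]
      have "\<rho>1 (form0 b) (form0 f) [] x = rho P b f x" for x
        using r0[OF form0_in_Omega[OF f]] by (simp add: wedge_low_degree eth_form_def form0_Nil flip: One_nat_def)
      then have 1: "br [form0 b, pw (smul P) f X] [a] =
          smul P (rho P b f) (X [a]) + smul P f (br [form0 b, X] [a])"
        using L[OF form0_in_OmegaB[OF b] form0_in_Omega[OF f] X] dotB_form0[OF X, of f]
        by (intro ext) (simp add: dotB_low_degree smul_def pw_def form0_Nil flip: One_nat_def)
      have "prB P (brk P b (smul P f (X [a]))) = smul P (rho P b f) (X [a]) + smul P f (prB P (brk P b (X [a])))"
        using f XG bG rho_in[OF bG f] prB_GamB[OF OmegaB1_in[OF X a]]
        by (simp add: brk_smul prB_add prB_smul Gam_smul brk_in)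
      then show "D (pw (smul P) f X) = smul P f (D X)"
        unfolding D_def 1 pw_apply by (simp add: smul_add_right smul_diff_right smul_minus)
    next
      fix \<omega> b' assume \<omega>: "\<omega> \<in> Omega P 1" and b': "b' \<in> GamB P"
      have b'G: "b' \<in> Gam P" using b' GamB_subset by blast
      have "\<rho>1 (form0 b) \<omega> [a] x = rho P b (\<omega> [a]) x - \<omega> [eth P b a] x" for x
        using r0[OF \<omega>] a by (simp add: wedge_low_degree eth_form_def form0_Nil flip: One_nat_def)
      then have 1: "br [form0 b, otimes P \<omega> b'] [a] =
          smul P (\<lambda>x. rho P b (\<omega> [a]) x - \<omega> [eth P b a] x) b' + smul P (\<omega> [a]) (brkB P b b')"
        using L[OF form0_in_OmegaB[OF b] \<omega> form0_in_OmegaB[OF b']] br_two[OF b b']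
        unfolding otimes_eq_dotB[OF \<omega>]
        by (intro ext) (simp add: dotB_low_degree smul_def pw_def form0_Nil flip: One_nat_def)
      have "prB P (brk P b (smul P (\<omega> [a]) b')) = smul P (rho P b (\<omega> [a])) b' + smul P (\<omega> [a]) (brkB P b b')"
        using Omega1_in[OF \<omega> a] bG b'G rho_in[OF bG Omega1_in[OF \<omega> a]] prB_GamB[OF b']
        by (simp add: brk_smul prB_add prB_smul Gam_smul brk_in brkB_def)
      then show "D (otimes P \<omega> b') = 0"
        unfolding D_def 1 by (simp add: otimes_def smul_def fun_eq_iff V.scale_left_diff_distrib)
    qed
    then show ?thesis by (simp add: D_def)
  qed
  show ?thesis
  proof
    fix as show "br [form0 b, X] as = mu P (ad P b) [X] as"
    proof (cases "\<exists>a\<in>GamA P. as = [a]")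
      case True
      then obtain a where a: "a \<in> GamA P" "as = [a]" by blast
      have aG: "a \<in> Gam P" using a GamA_subset by blast
      show ?thesis using on_section[OF a(1)] a ad_apply[OF aG] ad_apply[OF OmegaB1_in_Gam[OF X a(1)]]
        by (simp add: mu_def eth_def)
    next
      case False
      have "mu P (ad P b) [X] as = 0"
      proof (cases "set as \<subseteq> GamA P")
        case True
        then have l: "length as \<noteq> 1" using False by (auto simp: length_Suc_conv One_nat_def)
        then have "X as = 0" "X (as[j := v]) = 0" for j v
          by (intro OmegaB1_length[OF X]; simp)+
        then show ?thesis by (simp add: mu_def ad_0[OF bG] prB_0)
      qed (simp add: mu_def)
      moreover have "br [form0 b, X] as = 0"
        using br_in_OmegaB1[OF b, of "[X]"] X by (intro OmegaB1_off[OF _ False]) simp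
      ultimately show ?thesis by simp
    qed
  qed
qed

text \<open>Here both sides are \<open>C\<^sup>\<infinity>\<close>-linear: on the left, \<open>\<rho>\<^sub>2\<close> vanishes on functions; on the right, the
  term \<open>(\<rho>\<^sub>L(b) f) X(a)\<close> of \<open>[b, f X(a)]\<^sub>L\<close> lies in \<open>\<Gamma>(B)\<close> and is killed by \<open>pr\<^sub>A\<close>. For
  \<open>X = \<omega>' \<otimes> b'\<close> and \<open>Y = \<omega> \<otimes> b''\<close>, two applications of the Leibniz rule, one for each form, give
  \<open>\<omega>(\<beta>(b, b')) \<omega>' \<otimes> b'' + \<omega>'(\<beta>(b, b'')) \<omega> \<otimes> b'\<close>, which is the action because of
  \<open>pr\<^sub>A [b, X(a)] = \<omega>'(a) \<beta>(b, b')\<close>.\<close>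

lemma ternary_bracket_eq_action:
  assumes b: "b \<in> GamB P" and X: "X \<in> OmegaB P 1" and Y: "Y \<in> OmegaB P 1"
  shows "br [form0 b, X, Y] = mu P (ad P b) [X, Y]"
proof -
  have bG: "b \<in> Gam P" using b GamB_subset by blast
  have bT: "form0 b \<in> OmegaB_total P" using form0_in_OmegaB[OF b] OmegaB_subset_total by auto
  have T: "Y \<in> OmegaB P 1 \<Longrightarrow> Y \<in> OmegaB_total P" for Y using OmegaB_subset_total by blast
  obtain \<rho>2 where
    r0: "\<And>i j \<omega> X Y. \<omega> \<in> Omega P 0 \<Longrightarrow> X \<in> OmegaB P i \<Longrightarrow> Y \<in> OmegaB P j \<Longrightarrow> \<rho>2 X Y \<omega> = 0" and
    r: "\<And>i j p \<omega> \<eta> b \<eta>' b'. \<omega> \<in> Omega P p \<Longrightarrow> \<eta> \<in> Omega P i \<Longrightarrow> b \<in> GamB P \<Longrightarrow> \<eta>' \<in> Omega P j \<Longrightarrow>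
       b' \<in> GamB P \<Longrightarrow> \<rho>2 (otimes P \<eta> b) (otimes P \<eta>' b') \<omega> = (\<lambda>as x. (- 1) ^ (i + j + 1) *
              wedge i (j + (p - 1)) \<eta> (wedge j (p - 1) \<eta>' (contract (beta P b b') \<omega>)) as x)" and
    L: "\<And>i j p k X Y \<omega> Z. X \<in> OmegaB P i \<Longrightarrow> Y \<in> OmegaB P j \<Longrightarrow> \<omega> \<in> Omega P p \<Longrightarrow> Z \<in> OmegaB P k \<Longrightarrow>
       br [X, Y, dotB P p k \<omega> Z] = dotB P (i + j + (p - 1)) k (\<rho>2 X Y \<omega>) Z +
            pw (pw (scl P)) ((- 1) ^ (p * (i + j + 1))) (dotB P p (i + j + k - 1) \<omega> (br [X, Y, Z]))"
    by (rule br_three_Leibniz) (rule that)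
  note b0 = form0_in_OmegaB[OF b]
  have on_section: "br [form0 b, X, Y] [a] = Y [prA P (brk P b (X [a]))] + X [prA P (brk P b (Y [a]))]"
    if a: "a \<in> GamA P" for a
  proof -
    define D where "D X Y = br [form0 b, X, Y] [a] -
      (Y [prA P (brk P b (X [a]))] + X [prA P (brk P b (Y [a]))])" for X Y
    have prX: "prA P (brk P b (X [a])) \<in> GamA P" if "X \<in> OmegaB P 1" for X
      by (rule prA_in[OF brk_in[OF bG OmegaB1_in_Gam[OF that a]]])
    \<comment> \<open>two forms of degree 1 commute in the bracket, so that linearity in \<open>Y\<close> is enough\<close>
    have sym: "D X Y = D Y X" if
      "X \<in> OmegaB P 1" "Y \<in> OmegaB P 1" for X Y
      using br_swap[of "[form0 b]" "[]" X 1 Y 1] bT that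
      by (simp add: D_def pw_def fun_eq_iff add.commute)
    have add: "D X (Y + Z) = D X Y + D X Z"
      if X: "X \<in> OmegaB P 1" and Y: "Y \<in> OmegaB P 1" and Z: "Z \<in> OmegaB P 1" for X Y Z
    proof -
      have 1: "br [form0 b, X, Y + Z] = br [form0 b, X, Y] + br [form0 b, X, Z]"
        using br_add[of "[form0 b, X]" "[]" Y Z] bT T X Y Z by simp
      have 2: "prA P (brk P b ((Y + Z) [a])) = prA P (brk P b (Y [a])) + prA P (brk P b (Z [a]))"
        using brk_add_right[OF OmegaB1_in_Gam[OF Y a] OmegaB1_in_Gam[OF Z a] bG]
          prA_add[OF brk_in[OF bG OmegaB1_in_Gam[OF Y a]] brk_in[OF bG OmegaB1_in_Gam[OF Z a]]] by simp
      show ?thesis unfolding D_def 1 2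
        using OmegaB1_arg_add[OF X prX[OF Y] prX[OF Z]] by (simp add: algebra_simps)
    qed
    have lin: "D X (pw (smul P) f Y) = smul P f (D X Y)"
      if f: "f \<in> Cinf P" and X: "X \<in> OmegaB P 1" and Y: "Y \<in> OmegaB P 1" for f X Y
    proof -
      have 1: "br [form0 b, X, pw (smul P) f Y] [a] = smul P f (br [form0 b, X, Y] [a])"
        using L[OF b0 X form0_in_Omega[OF f] Y] dotB_form0[OF Y, of f]
        by (intro ext) (simp add: dotB_low_degree dotB_length pw_def form0_Nil smul_def flip: One_nat_def)
      have "prA P (brk P b (smul P f (Y [a]))) = smul P f (prA P (brk P b (Y [a])))"
        using f bG OmegaB1_in_Gam[OF Y a] rho_in[OF bG f] prA_GamB[OF OmegaB1_in[OF Y a]]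
        by (simp add: brk_smul prA_add prA_smul Gam_smul brk_in smul_zero)
      then show ?thesis
        unfolding D_def 1 pw_apply using OmegaB1_arg_smul[OF X f prX[OF Y]]
        by (simp only: smul_add_right smul_diff_right)
    qed
    have simple: "D (otimes P \<omega>' b') (otimes P \<omega> b'') = 0"
      if \<omega>': "\<omega>' \<in> Omega P 1" and b': "b' \<in> GamB P" and \<omega>: "\<omega> \<in> Omega P 1" and b'': "b'' \<in> GamB P"
      for \<omega>' b' \<omega> b''
    proof -
      let ?X = "otimes P \<omega>' b'"
      note X = otimes_in[OF \<omega>' b']
      have pr: "prA P (brk P b (otimes P \<eta> c [a])) = smul P (\<eta> [a]) (beta P b c)"
        if \<eta>: "\<eta> \<in> Omega P 1" and c: "c \<in> GamB P" for \<eta> c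
      proof -
        have "c \<in> Gam P" using c GamB_subset by blast
        then show ?thesis
          using Omega1_in[OF \<eta> a] bG rho_in[OF bG Omega1_in[OF \<eta> a]] prA_GamB[OF c]
          by (simp add: otimes_def brk_smul prA_add prA_smul Gam_smul brk_in beta_def smul_zero)
      qed
      have beta_in: "beta P b c \<in> GamA P" if "c \<in> GamB P" for c
        unfolding beta_def using that bG GamB_subset by (intro prA_in brk_in) auto
      have "\<rho>2 (form0 b) (form0 b'') \<omega>' [] x = - \<omega>' [beta P b b''] x" for x
        using r[OF \<omega>' form0_in_Omega[OF Cinf_const[of 1]] b form0_in_Omega[OF Cinf_const[of 1]] b'']
        by (simp flip: form0_eq_otimes) (simp add: wedge_low_degree contract_def form0_Nil flip: One_nat_def)
      then have "br [form0 b, form0 b'', ?X] [] = - smul P (\<omega>' [beta P b b'']) b'"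
        using L[OF b0 form0_in_OmegaB[OF b''] \<omega>' form0_in_OmegaB[OF b']] br_three[OF b b'' b']
        unfolding otimes_eq_dotB[OF \<omega>']
        by (intro ext) (simp add: dotB_low_degree dotB_length pw_def form0_Nil smul_def flip: One_nat_def)
      then have 1: "br [form0 b, ?X, form0 b''] [] = smul P (\<omega>' [beta P b b'']) b'"
        using br_swap[of "[form0 b]" "[]" ?X 1 "form0 b''" 0] bT X form0_in_OmegaB[OF b'']
        by (simp add: pw_def fun_eq_iff)
      have "\<rho>2 (form0 b) ?X \<omega> [a] x = \<omega>' [a] x * \<omega> [beta P b b'] x" for x
        using r[OF \<omega> form0_in_Omega[OF Cinf_const[of 1]] b \<omega>' b']
        by (simp flip: form0_eq_otimes) (simp add: wedge_low_degree contract_def form0_Nil flip: One_nat_def)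
      then have "br [form0 b, ?X, otimes P \<omega> b''] [a] =
          smul P (\<lambda>x. \<omega>' [a] x * \<omega> [beta P b b'] x) b'' + smul P (\<lambda>x. \<omega> [a] x * \<omega>' [beta P b b''] x) b'"
        using L[OF b0 X \<omega> form0_in_OmegaB[OF b'']] 1
        unfolding otimes_eq_dotB[OF \<omega>]
        by (intro ext) (simp add: dotB_low_degree pw_def form0_Nil smul_def flip: One_nat_def)
      then show ?thesis
        unfolding D_def pr[OF \<omega> b''] pr[OF \<omega>' b']
        using Omega1_arg_smul[OF \<omega> Omega1_in[OF \<omega>' a] beta_in[OF b']]
          Omega1_arg_smul[OF \<omega>' Omega1_in[OF \<omega> a] beta_in[OF b'']]
        by (simp add: otimes_def)
    qed
    \<comment> \<open>tensoriality in the first argument, then in the second one\<close>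
    have half: "D X (otimes P \<omega> b'') = 0"
      if X: "X \<in> OmegaB P 1" and \<omega>: "\<omega> \<in> Omega P 1" and b'': "b'' \<in> GamB P" for X \<omega> b''
    proof (rule tensorial_vanishes[OF _ _ _ X, where D = "\<lambda>X. D X (otimes P \<omega> b'')"])
      note Z = otimes_in[OF \<omega> b'']
      show "D (X + Y) (otimes P \<omega> b'') = D X (otimes P \<omega> b'') + D Y (otimes P \<omega> b'')"
        if "X \<in> OmegaB P 1" "Y \<in> OmegaB P 1" for X Y
        using add[OF Z that] sym[OF Z] that OmegaB1_add[OF that] by simp
      show "D (pw (smul P) f X) (otimes P \<omega> b'') = smul P f (D X (otimes P \<omega> b''))"
        if "f \<in> Cinf P" "X \<in> OmegaB P 1" for f X
        using lin[OF that(1) Z that(2)] sym[OF Z] that(2) OmegaB1_smul[OF that] by simp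
    qed (rule simple[OF _ _ \<omega> b''])
    have "D X Y = 0"
      by (rule tensorial_vanishes[OF _ _ _ Y, where D = "D X"])
        (use add[OF X] lin[OF _ X] half[OF X] in simp_all)
    then show ?thesis by (simp add: D_def)
  qed
  note mu2 = mu_two_1forms[where \<delta> = "ad P b", OF X Y ad_0[OF bG]]
  show ?thesis
  proof
    fix as show "br [form0 b, X, Y] as = mu P (ad P b) [X, Y] as"
    proof (cases "\<exists>a\<in>GamA P. as = [a]")
      case True
      then obtain a where a: "a \<in> GamA P" "as = [a]" by blast
      show ?thesis unfolding a(2) mu2(2)[OF a(1)] on_section[OF a(1)]
        by (simp only: ad_apply[OF OmegaB1_in_Gam[OF X a(1)]] ad_apply[OF OmegaB1_in_Gam[OF Y a(1)]])
    next
      case False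
      have "mu P (ad P b) [X, Y] as = 0"
      proof (cases "length as = 1")
        case True
        then have "\<not> set as \<subseteq> GamA P" using False by (auto simp: length_Suc_conv One_nat_def)
        then have "act2 P i j \<delta> X Y as = 0" for i j \<delta> by (simp add: act2_def Let_def)
        then show ?thesis by (simp add: mu_def)
      qed (rule mu2(1))
      moreover have "br [form0 b, X, Y] as = 0"
        using br_in_OmegaB1[OF b, of "[X, Y]"] X Y by (intro OmegaB1_off[OF _ False]) simp
      ultimately show ?thesis by simp
    qed
  qed
qed

lemma bracket_eq_action:
  assumes b: "b \<in> GamB P" and Xs: "set Xs \<subseteq> OmegaB P 1"
  shows "br (form0 b # Xs) = mu P (ad P b) Xs"
proof -
  consider "Xs = []" | X where "Xs = [X]" | X Y where "Xs = [X, Y]" | X Y Z Zs where "Xs = X # Y # Z # Zs"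
    by (metis list.exhaust)
  then show ?thesis
    using br_form0[OF b] binary_bracket_eq_action[OF b] ternary_bracket_eq_action[OF b] Xs
    by cases (simp_all add: br_long mu_def[of P _ "_ # _ # _ # _"])
qed

text \<open>Each 1-form that passes the element \<open>b\<close> of degree \<open>0\<close> contributes a factor \<open>- 1\<close>, which is the
  sign in the twisted action.\<close>

lemma bracket_eq_signed_action:
  assumes b: "b \<in> GamB P"
  shows "set Xs \<subseteq> OmegaB P 1 \<Longrightarrow> set Ys \<subseteq> OmegaB P 1 \<Longrightarrow>
    br (Xs @ form0 b # Ys) = pw (pw (scl P)) ((- 1) ^ length Xs) (mu P (ad P b) (Xs @ Ys))"
proof (induction Xs arbitrary: Ys rule: rev_induct)
  case Nil
  then show ?case using bracket_eq_action[OF b] by (simp add: pw_def)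
next
  case (snoc X Xs)
  have T: "set Zs \<subseteq> OmegaB P 1 \<Longrightarrow> set Zs \<subseteq> OmegaB_total P" for Zs using OmegaB_subset_total by blast
  have "br (Xs @ X # form0 b # Ys) = pw (pw (scl P)) (- 1) (br (Xs @ form0 b # X # Ys))"
    using br_swap[of Xs Ys X 1 "form0 b" 0] snoc.prems T form0_in_OmegaB[OF b] by simp
  also have "br (Xs @ form0 b # X # Ys) = pw (pw (scl P)) ((- 1) ^ length Xs) (mu P (ad P b) (Xs @ X # Ys))"
    using snoc.prems by (intro snoc.IH) auto
  finally show ?case by (simp add: pw_def)
qed

end

section \<open>Multilinear extension to tensor products\<close>

lemma vector_space_pw:
  assumes "vector_space s" shows "vector_space (pw s)"
proof -
  interpret vector_space s by (rule assms)
  show ?thesis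
    by standard (simp_all add: pw_def fun_eq_iff scale_right_distrib scale_left_distrib)
qed

text \<open>The universal property for maps that are linear only on a subspace \<open>V\<close>: they are extended to
  the ambient space by means of a linear projection onto \<open>V\<close>.\<close>

lemma tensor_sum_well_defined:
  fixes \<iota> :: "'k::field \<Rightarrow> 'a::comm_ring_1" and s :: "'k \<Rightarrow> 'w::ab_group_add \<Rightarrow> 'w"
    and Q :: "'w \<Rightarrow> 'a \<Rightarrow> 'y::ab_group_add"
  assumes A: "vector_space (\<lambda>c x. \<iota> c * x)" and S: "vector_space s" and V: "module.subspace s V"
    and addw: "\<And>w w' t. w \<in> V \<Longrightarrow> w' \<in> V \<Longrightarrow> Q (w + w') t = Q w t + Q w' t"
    and addt: "\<And>w t t'. w \<in> V \<Longrightarrow> Q w (t + t') = Q w t + Q w t'"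
    and bal: "\<And>c w t. w \<in> V \<Longrightarrow> Q (s c w) t = Q w (\<iota> c * t)"
    and ps: "represents \<iota> s V \<mm> ps X" and qs: "represents \<iota> s V \<mm> qs X"
  shows "(\<Sum>(w, t)\<leftarrow>ps. Q w t) = (\<Sum>(w, t)\<leftarrow>qs. Q w t)"
proof -
  interpret S: vector_space s by (rule S)
  interpret SS: vector_space_pair s s by standard
  have "Vector_Spaces.linear s s id" by (rule S.linear_id)
  then obtain p where p: "range p \<subseteq> V" "Vector_Spaces.linear s s p" "\<forall>v\<in>V. p (id v) = v"
    using SS.linear_exists_left_inverse_on[of id V] V by auto
  interpret p: Vector_Spaces.linear s s p by (rule p(2))
  have pV: "p w \<in> V" for w using p(1) by auto
  define R where "R w t = Q (p w) t" for w t
  have R_add: "R (w + w') t = R w t + R w' t" for w w' t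
    using addw[OF pV pV] by (simp add: R_def p.add)
  have R0: "R 0 t = 0" for t using R_add[of 0 0 t] by simp
  have R_minus: "R (- w) t = - R w t" for w t
    using R_add[of w "- w" t] R0 by (simp add: eq_neg_iff_add_eq_0 add.commute)
  let ?neg = "map (\<lambda>(w, t). (- w, t)) qs"
  have neg: "(\<Sum>(w, t)\<leftarrow>map (\<lambda>(w, t). (- w, t)) rs. tpure \<iota> s w t) = - (\<Sum>(w, t)\<leftarrow>rs. tpure \<iota> s w t)" for rs
    by (induction rs) (auto simp: tpure_def fun_eq_iff)
  have "(\<Sum>(w, t)\<leftarrow>ps @ ?neg. tpure \<iota> s w t) = 0"
    using ps qs unfolding represents_def map_append sum_list_append neg by simp
  from tensor_universal[of \<iota> s R, OF A S R_add _ _ this]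
  have "(\<Sum>(w, t)\<leftarrow>ps @ ?neg. R w t) = 0"
    using addt[OF pV] bal[OF pV] by (simp add: R_def p.scale)
  moreover have "(\<Sum>(w, t)\<leftarrow>map (\<lambda>(w, t). (- w, t)) rs. R w t) = - (\<Sum>(w, t)\<leftarrow>rs. R w t)" for rs
    by (induction rs) (auto simp: R_minus)
  ultimately have "(\<Sum>(w, t)\<leftarrow>ps. R w t) = (\<Sum>(w, t)\<leftarrow>qs. R w t)"
    unfolding map_append sum_list_append by simp
  moreover have "(\<Sum>(w, t)\<leftarrow>rs. R w t) = (\<Sum>(w, t)\<leftarrow>rs. Q w t)" if "represents \<iota> s V \<mm> rs X" for rs
    by (rule arg_cong[of _ _ sum_list], rule map_cong[OF refl])
       (use that p(3) in \<open>auto simp: represents_def R_def\<close>)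
  ultimately show ?thesis using ps qs by simp
qed

lemma represents_trep: "X \<in> tensor \<iota> s V \<mm> \<Longrightarrow> represents \<iota> s V \<mm> (trep \<iota> s V \<mm> X) X"
  unfolding tensor_def trep_def by (auto intro: someI)

lemma represents_mono: "represents \<iota> s V \<mm> ps X \<Longrightarrow> V \<subseteq> W \<Longrightarrow> represents \<iota> s W \<mm> ps X"
  unfolding represents_def by auto

definition multilinear_on ::
  "('k \<Rightarrow> 'w \<Rightarrow> 'w) \<Rightarrow> 'w::ab_group_add set \<Rightarrow> ('w list \<Rightarrow> 'w) \<Rightarrow> bool" where
  "multilinear_on s V op \<longleftrightarrow> (\<forall>Xs Ys. set Xs \<subseteq> V \<longrightarrow> set Ys \<subseteq> V \<longrightarrow>
     (\<forall>X\<in>V. (\<forall>Y\<in>V. op (Xs @ (X + Y) # Ys) = op (Xs @ X # Ys) + op (Xs @ Y # Ys)) \<and>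
        (\<forall>c. op (Xs @ s c X # Ys) = s c (op (Xs @ X # Ys)))))"

lemma multilinear_onD:
  assumes "multilinear_on s V op" "set Xs \<subseteq> V" "set Ys \<subseteq> V" "X \<in> V"
  shows "Y \<in> V \<Longrightarrow> op (Xs @ (X + Y) # Ys) = op (Xs @ X # Ys) + op (Xs @ Y # Ys)"
    and "op (Xs @ s c X # Ys) = s c (op (Xs @ X # Ys))"
  using assms unfolding multilinear_on_def by blast+

lemma multilinear_on_Cons:
  assumes "multilinear_on s V op" "w \<in> V" shows "multilinear_on s V (\<lambda>l. op (w # l))"
  unfolding multilinear_on_def
proof (intro allI impI ballI conjI)
  fix Xs Ys X assume "set Xs \<subseteq> V" "set Ys \<subseteq> V" "X \<in> V"
  then have *: "set (w # Xs) \<subseteq> V" "set Ys \<subseteq> V" "X \<in> V" using assms(2) by auto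
  show "op (w # Xs @ (X + Y) # Ys) = op (w # Xs @ X # Ys) + op (w # Xs @ Y # Ys)" if "Y \<in> V" for Y
    using multilinear_onD(1)[OF assms(1) * that] by simp
  show "op (w # Xs @ s c X # Ys) = s c (op (w # Xs @ X # Ys))" for c
    using multilinear_onD(2)[OF assms(1) *] by simp
qed

text \<open>The value of the extension of \<open>op\<close> on the tensors with decompositions \<open>rss\<close>. The scalar \<open>c\<close>
  collects the factors of the arguments that an induction has already split off.\<close>

definition ext_sum ::
  "('k::field \<Rightarrow> 'a::comm_ring_1) \<Rightarrow> ('k \<Rightarrow> 'w \<Rightarrow> 'w) \<Rightarrow> ('w list \<Rightarrow> 'w) \<Rightarrow> 'a
    \<Rightarrow> ('w::ab_group_add \<times> 'a) list list \<Rightarrow> ('a \<Rightarrow> 'k) \<Rightarrow> 'w" where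
  "ext_sum \<iota> s op c rss =
    (\<Sum>ps\<leftarrow>product_lists rss. tpure \<iota> s (op (map fst ps)) (c * prod_list (map snd ps)))"

lemma sum_list_concat: "sum_list (concat xss) = (\<Sum>xs\<leftarrow>xss. sum_list xs)"
  by (induction xss) auto

lemma ext_sum_Cons:
  "ext_sum \<iota> s op c (rs # rss) = (\<Sum>(w, t)\<leftarrow>rs. ext_sum \<iota> s (\<lambda>l. op (w # l)) (c * t) rss)"
  by (simp add: ext_sum_def map_concat sum_list_concat o_def case_prod_unfold mult.assoc)

lemma in_product_lists:
  assumes "ps \<in> set (product_lists rss)" "\<And>rs. rs \<in> set rss \<Longrightarrow> set rs \<subseteq> V \<times> \<mm>"
  shows "set (map fst ps) \<subseteq> V" "set (map snd ps) \<subseteq> \<mm>" "length ps = length rss"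
proof -
  have l: "list_all2 (\<lambda>p rs. p \<in> set rs) ps rss" using assms(1) by (simp add: product_lists_set)
  then show "length ps = length rss" by (rule list_all2_lengthD)
  have "p \<in> V \<times> \<mm>" if "p \<in> set ps" for p
    using l that assms(2) by (induction rule: list_all2_induct) auto
  then show "set (map fst ps) \<subseteq> V" "set (map snd ps) \<subseteq> \<mm>" by auto
qed

context
  fixes \<iota> :: "'k::field \<Rightarrow> 'a::comm_ring_1" and s :: "'k \<Rightarrow> 'w::ab_group_add \<Rightarrow> 'w"
  assumes A: "vector_space (\<lambda>c x. \<iota> c * x)" and S: "vector_space s"
begin

interpretation S: vector_space s by (rule S)

lemma tpure_add_left: "tpure \<iota> s (w + w') t = tpure \<iota> s w t + tpure \<iota> s w' t"
  by (simp add: tpure_def fun_eq_iff S.scale_right_distrib)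

lemma tpure_add_right: "tpure \<iota> s w (t + t') = tpure \<iota> s w t + tpure \<iota> s w t'"
  by (simp add: tpure_def fun_eq_iff dual_space_def S.scale_left_distrib)

lemma tpure_balanced: "tpure \<iota> s (s c w) t = tpure \<iota> s w (\<iota> c * t)"
  by (simp add: tpure_def fun_eq_iff dual_space_def mult.commute)

lemma pw_tpure: "pw s c (tpure \<iota> s w t) = tpure \<iota> s (s c w) t"
  by (simp add: tpure_def fun_eq_iff pw_def S.scale_left_commute)

lemma ext_sum_scalar_add: "ext_sum \<iota> s op (c + c') rss = ext_sum \<iota> s op c rss + ext_sum \<iota> s op c' rss"
  by (simp add: ext_sum_def distrib_right tpure_add_right sum_list_addf)

lemma ext_sum_op_add:
  assumes "\<And>ps. ps \<in> set (product_lists rss) \<Longrightarrow> op (map fst ps) = op1 (map fst ps) + op2 (map fst ps)"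
  shows "ext_sum \<iota> s op c rss = ext_sum \<iota> s op1 c rss + ext_sum \<iota> s op2 c rss"
proof -
  have "ext_sum \<iota> s op c rss = (\<Sum>ps\<leftarrow>product_lists rss.
      tpure \<iota> s (op1 (map fst ps)) (c * prod_list (map snd ps)) +
      tpure \<iota> s (op2 (map fst ps)) (c * prod_list (map snd ps)))"
    unfolding ext_sum_def
    by (rule arg_cong[of _ _ sum_list], rule map_cong[OF refl]) (simp add: assms tpure_add_left)
  then show ?thesis by (simp add: sum_list_addf ext_sum_def)
qed

lemma ext_sum_op_scale:
  assumes "\<And>ps. ps \<in> set (product_lists rss) \<Longrightarrow> op (map fst ps) = s a (op1 (map fst ps))"
  shows "ext_sum \<iota> s op c rss = ext_sum \<iota> s op1 (\<iota> a * c) rss"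
    and "ext_sum \<iota> s op c rss = pw s a (ext_sum \<iota> s op1 c rss)"
proof -
  show "ext_sum \<iota> s op c rss = ext_sum \<iota> s op1 (\<iota> a * c) rss"
    unfolding ext_sum_def
    by (rule arg_cong[of _ _ sum_list], rule map_cong[OF refl])
       (simp add: assms tpure_balanced mult.assoc)
  interpret T: vector_space "pw s" by (rule vector_space_pw[OF S])
  have sl: "pw s a (sum_list (map f xs)) = (\<Sum>x\<leftarrow>xs. pw s a (f x))"
    for f :: "('w \<times> 'a) list \<Rightarrow> ('a \<Rightarrow> 'k) \<Rightarrow> 'w" and xs
    by (induction xs) (simp_all only: list.map sum_list.Nil sum_list.Cons T.scale_zero_right T.scale_right_distrib)
  show "ext_sum \<iota> s op c rss = pw s a (ext_sum \<iota> s op1 c rss)"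
    unfolding ext_sum_def sl
    by (rule arg_cong[of _ _ sum_list], rule map_cong[OF refl]) (simp add: assms pw_tpure)
qed

text \<open>The extension does not depend on the chosen decompositions. They are exchanged one slot at a
  time; fixing the first argument of a multilinear operation leaves a multilinear operation.\<close>

lemma ext_sum_well_defined:
  assumes V: "S.subspace V"
    and rel: "list_all2 (\<lambda>rs rs'. \<exists>X. represents \<iota> s V \<mm> rs X \<and> represents \<iota> s V \<mm> rs' X) rss rss'"
    and op: "multilinear_on s V op"
  shows "ext_sum \<iota> s op c rss = ext_sum \<iota> s op c rss'"
  using rel op
proof (induction rss rss' arbitrary: op c rule: list_all2_induct)
  case Nil
  show ?case ..
next
  case (Cons rs rss rs' rss')
  obtain X where X: "represents \<iota> s V \<mm> rs X" "represents \<iota> s V \<mm> rs' X" using Cons.hyps(1) by blast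
  let ?Q = "\<lambda>w t. ext_sum \<iota> s (\<lambda>l. op (w # l)) (c * t) rss'"
  have rss': "set r \<subseteq> V \<times> \<mm>" if "r \<in> set rss'" for r
  proof -
    from that obtain i where "i < length rss'" "r = rss' ! i" by (auto simp: in_set_conv_nth)
    then show ?thesis using list_all2_nthD2[OF Cons.hyps(2)] by (auto simp: represents_def)
  qed
  have inV: "set (map fst ps) \<subseteq> V" if "ps \<in> set (product_lists rss')" for ps
    using in_product_lists(1)[OF that rss'] .
  have "ext_sum \<iota> s op c (rs # rss) = (\<Sum>(w, t)\<leftarrow>rs. ?Q w t)"
    unfolding ext_sum_Cons
  proof (rule arg_cong[of _ _ sum_list], rule map_cong[OF refl], clarify)
    fix w t assume "(w, t) \<in> set rs"
    then have "w \<in> V" using X(1) by (auto simp: represents_def)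
    then show "ext_sum \<iota> s (\<lambda>l. op (w # l)) (c * t) rss = ?Q w t"
      by (intro Cons.IH multilinear_on_Cons[OF Cons.prems])
  qed
  also have "\<dots> = (\<Sum>(w, t)\<leftarrow>rs'. ?Q w t)"
  proof (rule tensor_sum_well_defined[OF A S V _ _ _ X])
    fix w w' t assume "w \<in> V" "w' \<in> V"
    then show "?Q (w + w') t = ?Q w t + ?Q w' t"
      using multilinear_onD(1)[OF Cons.prems, of "[]"] inV by (intro ext_sum_op_add) simp
  next
    fix w t t' assume "w \<in> V"
    show "?Q w (t + t') = ?Q w t + ?Q w t'" by (simp add: distrib_left ext_sum_scalar_add)
  next
    fix a w t assume "w \<in> V"
    then have "op (s a w # map fst ps) = s a (op (w # map fst ps))"
      if "ps \<in> set (product_lists rss')" for ps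
      using multilinear_onD(2)[OF Cons.prems, of "[]"] inV[OF that] by simp
    then have "?Q (s a w) t = ext_sum \<iota> s (\<lambda>l. op (w # l)) (\<iota> a * (c * t)) rss'"
      by (intro ext_sum_op_scale(1)) simp
    then show "?Q (s a w) t = ?Q w (\<iota> a * t)" by (simp add: mult.left_commute)
  qed
  also have "\<dots> = ext_sum \<iota> s op c (rs' # rss')" by (simp add: ext_sum_Cons)
  finally show ?case .
qed

end

lemma sum_list_swap:
  fixes f :: "'b \<Rightarrow> 'c \<Rightarrow> 'd::ab_group_add"
  shows "(\<Sum>x\<leftarrow>xs. \<Sum>y\<leftarrow>ys. f x y) = (\<Sum>y\<leftarrow>ys. \<Sum>x\<leftarrow>xs. f x y)"
  by (induction xs) (simp_all add: sum_list_addf)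

text \<open>In the extended action the derivation comes first, whereas in the twisted bracket \<open>b\<close> stands
  behind the copies of \<open>\<xi>\<close>. The sum over the decomposition of one argument, at any position, can be
  made the outermost one.\<close>

lemma ext_sum_pull_out:
  "ext_sum \<iota> s op c (As @ rs # Bs) =
    (\<Sum>(w, t)\<leftarrow>rs. ext_sum \<iota> s (\<lambda>l. op (take (length As) l @ w # drop (length As) l)) (c * t) (As @ Bs))"
proof (induction As arbitrary: op c)
  case Nil
  show ?case by (simp add: ext_sum_Cons)
next
  case (Cons as As)
  let ?n = "length As"
  let ?F = "\<lambda>v u w t. ext_sum \<iota> s (\<lambda>l. op (v # take ?n l @ w # drop ?n l)) (c * u * t) (As @ Bs)"
  have "ext_sum \<iota> s op c ((as # As) @ rs # Bs) = (\<Sum>(v, u)\<leftarrow>as. \<Sum>(w, t)\<leftarrow>rs. ?F v u w t)"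
    by (simp only: append_Cons ext_sum_Cons Cons.IH)
  also have "\<dots> = (\<Sum>(w, t)\<leftarrow>rs. \<Sum>(v, u)\<leftarrow>as. ?F v u w t)"
    using sum_list_swap[of "\<lambda>x y. ?F (fst x) (snd x) (fst y) (snd y)" rs as]
    by (simp only: case_prod_unfold)
  also have "\<dots> = (\<Sum>(w, t)\<leftarrow>rs. ext_sum \<iota> s
      (\<lambda>l. op (take (length (as # As)) l @ w # drop (length (as # As)) l)) (c * t) ((as # As) @ Bs))"
    by (simp only: append_Cons ext_sum_Cons list.size take_Suc_Cons drop_Suc_Cons add_Suc_right add_0_right
        mult_ac)
  finally show ?case .
qed

section \<open>Linearity of the action of derivations\<close>

context split_pair
begin

sublocale Sec: vector_space "pw (scl P)" by (rule vector_space_pw[OF V.vector_space_axioms])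
sublocale Frm: vector_space "pw (pw (scl P))" by (rule vector_space_pw[OF Sec.vector_space_axioms])
sublocale Ten: vector_space "pw (pw (pw (scl P)))" by (rule vector_space_pw[OF Frm.vector_space_axioms])

lemma GamA_pw: "a \<in> GamA P \<Longrightarrow> pw (scl P) c a \<in> GamA P"
  and GamB_pw: "b \<in> GamB P \<Longrightarrow> pw (scl P) c b \<in> GamB P"
  and Gam_pw: "u \<in> Gam P \<Longrightarrow> pw (scl P) c u \<in> Gam P"
  unfolding pw_eq_smul by (intro GamA_smul GamB_smul Gam_smul Cinf_const; assumption)+

text \<open>Linearity is stated in the form \<open>op (c X + X') = c op X + op X'\<close>, which combines additivity and
  homogeneity in a single computation.\<close>

lemma pr_lin:
  assumes "u \<in> Gam P" "v \<in> Gam P"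
  shows prA_lin: "prA P (pw (scl P) c u + v) = pw (scl P) c (prA P u) + prA P v"
    and prB_lin: "prB P (pw (scl P) c u + v) = pw (scl P) c (prB P u) + prB P v"
  using prA_add[OF Gam_pw[OF assms(1)] assms(2)] prB_add[OF Gam_pw[OF assms(1)] assms(2)]
    prA_smul[OF Cinf_const assms(1)] prB_smul[OF Cinf_const assms(1)]
  by (simp_all add: pw_eq_smul)

lemma OmegaB_lin:
  assumes X: "X \<in> OmegaB P k" and Y: "Y \<in> OmegaB P k"
  shows "pw (pw (scl P)) c X + Y \<in> OmegaB P k"
  unfolding OmegaB_def alt_forms_def
proof (intro CollectI conjI allI impI ballI)
  note XY = X[unfolded OmegaB_def alt_forms_def, THEN CollectD] Y[unfolded OmegaB_def alt_forms_def, THEN CollectD]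
  have ap: "(pw (pw (scl P)) c X + Y) as = pw (scl P) c (X as) + Y as" for as by (simp add: pw_def)
  show "(pw (pw (scl P)) c X + Y) as = 0" if "\<not> (length as = k \<and> set as \<subseteq> GamA P)" for as
    unfolding ap XY(1)[THEN conjunct1, rule_format, OF that] XY(2)[THEN conjunct1, rule_format, OF that] by simp
  fix as assume as: "length as = k \<and> set as \<subseteq> GamA P"
  note XY' = XY(1)[THEN conjunct2, rule_format, OF as] XY(2)[THEN conjunct2, rule_format, OF as]
  show "(pw (pw (scl P)) c X + Y) as \<in> GamB P"
    unfolding ap using XY' by (intro GamB_add GamB_pw) blast+
  show "(pw (pw (scl P)) c X + Y) (as[i := as ! i + a]) =
      (pw (pw (scl P)) c X + Y) as + (pw (pw (scl P)) c X + Y) (as[i := a])" if "i < k" "a \<in> GamA P" for i a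
  proof -
    have "X (as[i := as ! i + a]) = X as + X (as[i := a])" "Y (as[i := as ! i + a]) = Y as + Y (as[i := a])"
      using XY' that by blast+
    then show ?thesis unfolding ap by (simp add: Sec.scale_right_distrib)
  qed
  show "(pw (pw (scl P)) c X + Y) (as[i := smul P f (as ! i)]) = smul P f ((pw (pw (scl P)) c X + Y) as)"
    if "i < k" "f \<in> Cinf P" for i f
  proof -
    have "X (as[i := smul P f (as ! i)]) = smul P f (X as)" "Y (as[i := smul P f (as ! i)]) = smul P f (Y as)"
      using XY' that by blast+
    then show ?thesis unfolding ap by (simp add: pw_eq_smul smul_add_right smul_smul mult.commute)
  qed
  show "(pw (pw (scl P)) c X + Y) as = 0" if "\<not> distinct as"
  proof -
    have "X as = 0" "Y as = 0" using XY' that by blast+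
    then show ?thesis unfolding ap by simp
  qed
qed

lemma OmegaB_total_lin:
  assumes "X \<in> OmegaB_total P" "Y \<in> OmegaB_total P"
  shows "pw (pw (scl P)) c X + Y \<in> OmegaB_total P"
proof -
  obtain N Xs where X: "X = (\<Sum>k<N. Xs k)" "\<forall>k<N. Xs k \<in> OmegaB P k"
    using assms(1) unfolding OmegaB_total_def by blast
  obtain M Ys where Y: "Y = (\<Sum>k<M. Ys k)" "\<forall>k<M. Ys k \<in> OmegaB P k"
    using assms(2) unfolding OmegaB_total_def by blast
  let ?L = "max N M"
  let ?X = "\<lambda>k. if k < N then Xs k else 0" and ?Y = "\<lambda>k. if k < M then Ys k else 0"
  have "X = (\<Sum>k<?L. ?X k)" "Y = (\<Sum>k<?L. ?Y k)"
    unfolding X(1) Y(1) by (rule sum.mono_neutral_cong_left; auto)+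
  then have "pw (pw (scl P)) c X + Y = (\<Sum>k<?L. pw (pw (scl P)) c (?X k) + ?Y k)"
    by (simp only: Frm.scale_sum_right sum.distrib)
  moreover have "\<forall>k<?L. pw (pw (scl P)) c (?X k) + ?Y k \<in> OmegaB P k"
    using X(2) Y(2) by (intro allI impI OmegaB_lin) (simp_all add: OmegaB_zero)
  ultimately show ?thesis unfolding OmegaB_total_def by blast
qed

lemma subspaceI_lin:
  assumes "vector_space s" "0 \<in> V" "\<And>c x y. x \<in> V \<Longrightarrow> y \<in> V \<Longrightarrow> s c x + y \<in> V"
  shows "module.subspace s V"
proof -
  interpret S: vector_space s by (rule assms(1))
  have "x + y \<in> V" "s c x \<in> V" if "x \<in> V" "y \<in> V" for c x y
    using assms(3)[OF that, of 1] assms(3)[OF that(1) assms(2), of c] by simp_all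
  then show ?thesis using assms(2) by (auto simp: S.subspace_def)
qed

lemma subspace_OmegaB: "Frm.subspace (OmegaB P k)"
  by (rule subspaceI_lin[OF Frm.vector_space_axioms OmegaB_zero OmegaB_lin])

lemma subspace_total: "Frm.subspace (OmegaB_total P)"
  using OmegaB_zero OmegaB_subset_total
  by (intro subspaceI_lin[OF Frm.vector_space_axioms _ OmegaB_total_lin]) auto

lemma OmegaB_total_induct [consumes 1, case_names zero add]:
  assumes "X \<in> OmegaB_total P" "Q 0" "\<And>X Y k. X \<in> OmegaB P k \<Longrightarrow> Q Y \<Longrightarrow> Q (X + Y)"
  shows "Q X"
proof -
  obtain N Xs where X: "X = (\<Sum>k<N. Xs k)" "\<forall>k<N. Xs k \<in> OmegaB P k"
    using assms(1) unfolding OmegaB_total_def by blast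
  have "Q (\<Sum>k<n. Xs k)" if "n \<le> N" for n
    using that
  proof (induction n)
    case 0 show ?case using assms(2) by (simp only: lessThan_0 sum.empty)
  next
    case (Suc n)
    then show ?case using assms(3)[of "Xs n" n "\<Sum>k<n. Xs k"] X(2)
      by (simp only: sum.lessThan_Suc add.commute Suc_leD Suc_le_lessD)
  qed
  then show ?thesis using X(1) by simp
qed

lemma OmegaB_total_in: "X \<in> OmegaB_total P \<Longrightarrow> X as \<in> GamB P"
proof (induction X rule: OmegaB_total_induct)
  case zero show ?case using GamB_zero by (simp add: zero_fun_def)
next
  case (add X Y k)
  have "X as \<in> GamB P"
  proof (cases "length as = k \<and> set as \<subseteq> GamA P")
    case True then show ?thesis using add(1) unfolding OmegaB_def alt_forms_def by blast
  next
    case False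
    then have "X as = 0" using add(1) unfolding OmegaB_def alt_forms_def by blast
    then show ?thesis by (simp add: GamB_zero)
  qed
  from GamB_add[OF this add(2)] show ?case by (subst plus_fun_apply)
qed

lemma OmegaB_total_in_Gam: "X \<in> OmegaB_total P \<Longrightarrow> X as \<in> Gam P"
  using OmegaB_total_in GamB_subset by blast

text \<open>If the remaining arguments are not sections of \<open>A\<close>, or their number does not fit the degree of a
  homogeneous component, then all three values of that component vanish.\<close>

lemma OmegaB_total_slot_lin:
  assumes "X \<in> OmegaB_total P" and a: "a \<in> GamA P" and a': "a' \<in> GamA P" and j: "j < length as"
  shows "X (as[j := pw (scl P) c a + a']) = pw (scl P) c (X (as[j := a])) + X (as[j := a'])"
  using assms(1)
proof (induction X rule: OmegaB_total_induct)
  case zero show ?case by (simp add: pw_def fun_eq_iff)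
next
  case (add X Y k)
  have "X (as[j := pw (scl P) c a + a']) = pw (scl P) c (X (as[j := a])) + X (as[j := a'])"
  proof (cases "length as = k \<and> set (as[j := a]) \<subseteq> GamA P")
    case True
    note X = add(1)[unfolded OmegaB_def alt_forms_def, THEN CollectD, THEN conjunct2, rule_format]
    let ?as = "as[j := a]"
    have jk: "j < k" using True j by simp
    have as:
      "length ?as = k \<and> set ?as \<subseteq> GamA P" using True by simp
    have 1: "X (?as[j := smul P (\<lambda>_. c) (?as ! j)]) = smul P (\<lambda>_. c) (X ?as)"
      using X[OF as] jk Cinf_const[of c P] by blast
    let ?bs = "as[j := pw (scl P) c a]"
    have "set ?bs \<subseteq> GamA P"
    proof
      fix x assume "x \<in> set ?bs"
      then obtain i where i: "i < length as" "x = ?bs ! i" by (auto simp: in_set_conv_nth)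
      have "?as ! i \<in> GamA P" using True i nth_mem[of i ?as] by auto
      then show "x \<in> GamA P" using i GamA_pw[OF a] by (cases "i = j") auto
    qed
    then have bs: "length ?bs = k \<and> set ?bs \<subseteq> GamA P" using True by simp
    have 2: "X (?bs[j := ?bs ! j + a']) = X ?bs + X (?bs[j := a'])"
      using X[OF bs] jk a' by blast
    show ?thesis using 1 2 j by (simp add: pw_eq_smul)
  next
    case False
    have "\<not> (length (as[j := v]) = k \<and> set (as[j := v]) \<subseteq> GamA P)" if v: "v \<in> GamA P" for v
    proof
      assume *: "length (as[j := v]) = k \<and> set (as[j := v]) \<subseteq> GamA P"
      have "x \<in> GamA P" if x: "x \<in> set (as[j := a])" for x
      proof -
        obtain i where i: "i < length as" "x = as[j := a] ! i"
          using x by (auto simp: in_set_conv_nth)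
        have "as[j := v] ! i \<in> GamA P" using * i nth_mem[of i "as[j := v]"] by auto
        then show ?thesis using i a by (cases "i = j") auto
      qed
      then show False using False * by auto
    qed
    then have "X (as[j := v]) = 0" if "v \<in> GamA P" for v
      using add(1) that unfolding OmegaB_def alt_forms_def by blast
    then show ?thesis using a a' GamA_add[OF GamA_pw[OF a] a'] by simp
  qed
  moreover have "(X + Y) bs = X bs + Y bs" for bs by (rule plus_fun_apply)
  ultimately show ?case using add(2) by (simp only: Sec.scale_right_distrib ac_simps)
qed

lemma OmegaB_total_Cons_lin:
  assumes "X \<in> OmegaB_total P" "a \<in> GamA P" "a' \<in> GamA P"
  shows "X ((pw (scl P) c a + a') # as) = pw (scl P) c (X (a # as)) + X (a' # as)"
  using OmegaB_total_slot_lin[OF assms, of 0 "0 # as"] by simp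

text \<open>The action formulas make sense for operators with values in \<open>\<Gamma>(L)\<close>, and they are linear in the
  forms if the operator is linear on \<open>\<Gamma>(L)\<close>. Derivations have both properties. The operators with
  the first one visibly form a linear subspace, to which the universal property of the tensor
  product can be applied.\<close>

definition gam_ops :: "(('m \<Rightarrow> 'v) \<Rightarrow> 'm \<Rightarrow> 'v) set" where
  "gam_ops = {\<delta>. \<forall>u. \<delta> u \<in> Gam P}"

definition linear_gam_ops :: "(('m \<Rightarrow> 'v) \<Rightarrow> 'm \<Rightarrow> 'v) set" where
  "linear_gam_ops = {\<delta> \<in> gam_ops. \<forall>u\<in>Gam P. \<forall>v\<in>Gam P. \<forall>c. \<delta> (pw (scl P) c u + v) = pw (scl P) c (\<delta> u) + \<delta> v}"

lemma DerL_subset: "DerL P \<subseteq> linear_gam_ops"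
proof
  fix \<delta> assume \<delta>: "\<delta> \<in> DerL P"
  then have 0: "\<And>u. u \<notin> Gam P \<Longrightarrow> \<delta> u = 0" and 1: "\<And>u. u \<in> Gam P \<Longrightarrow> \<delta> u \<in> Gam P"
    and 2: "\<And>u v. u \<in> Gam P \<Longrightarrow> v \<in> Gam P \<Longrightarrow> \<delta> (u + v) = \<delta> u + \<delta> v"
    and 3: "\<And>u c. u \<in> Gam P \<Longrightarrow> \<delta> (pw (scl P) c u) = pw (scl P) c (\<delta> u)"
    unfolding DerL_def by blast+
  have "\<delta> u \<in> Gam P" for u using 0 1 Gam_zero by (cases "u \<in> Gam P") auto
  moreover have "\<delta> (pw (scl P) c u + v) = pw (scl P) c (\<delta> u) + \<delta> v" if "u \<in> Gam P" "v \<in> Gam P" for c u v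
    unfolding 2[OF Gam_pw[OF that(1)] that(2)] 3[OF that(1)] ..
  ultimately show "\<delta> \<in> linear_gam_ops" by (simp add: linear_gam_ops_def gam_ops_def)
qed

lemma linear_gam_ops_subset: "linear_gam_ops \<subseteq> gam_ops"
  by (auto simp: linear_gam_ops_def)

lemma subspace_gam_ops: "Frm.subspace gam_ops"
  by (rule subspaceI_lin[OF Frm.vector_space_axioms])
     (auto simp: gam_ops_def Gam_zero pw_def[of "pw (scl P)"] intro!: Gam_add Gam_pw)

text \<open>The Jacobi identity; the symbol of \<open>ad\<^sub>b\<close> is \<open>\<rho>\<^sub>L(b)\<close>.\<close>

lemma ad_in_DerL:
  assumes b: "b \<in> Gam P" shows "ad P b \<in> DerL P"
proof -
  let ?s = "\<lambda>x. anchor P x (b x)"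
  have s: "?s \<in> vfields P"
    using lie Gam_in_fib[OF b] rho_in[OF b] by (simp add: vfields_def lie_algebroid_def rho_def)
  have jac: "brk P b (brk P u v) = brk P (brk P b u) v + brk P u (brk P b v)"
    if u: "u \<in> Gam P" and v: "v \<in> Gam P" for u v
  proof -
    have n: "brk P x (- y) = - brk P x y" if "x \<in> Gam P" "y \<in> Gam P" for x y
      using brk_pw_right[OF that, of "- 1"] by (simp add: pw_eq_smul smul_m1)
    have "brk P b (brk P u v) + brk P u (brk P v b) + brk P v (brk P b u) = 0"
      by (rule brk_jacobi[OF b u v])
    moreover have "brk P u (brk P v b) = - brk P u (brk P b v)"
      using brk_anti[OF v b] n[OF u brk_in[OF b v]] by simp
    moreover have "brk P v (brk P b u) = - brk P (brk P b u) v"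
      by (rule brk_anti[OF v brk_in[OF b u]])
    ultimately show ?thesis by (simp add: algebra_simps eq_neg_iff_add_eq_0)
  qed
  show ?thesis unfolding DerL_def
  proof (intro CollectI conjI allI impI ballI bexI[OF _ s])
    show "ad P b u = 0" if "u \<notin> Gam P" for u using that by (simp add: ad_def)
    fix u assume u: "u \<in> Gam P"
    show "ad P b u \<in> Gam P" using brk_in[OF b u] by (simp add: ad_apply[OF u])
    show "ad P b (pw (scl P) c u) = pw (scl P) c (ad P b u)" for c
      using brk_pw_right[OF b u] by (simp add: ad_apply[OF u] ad_apply[OF Gam_pw[OF u]])
    fix f :: "'m \<Rightarrow> 'k" assume f: "f \<in> Cinf P"
    show "ad P b (smul P f u) = smul P (\<lambda>x. anchor P x (b x) f) u + smul P f (ad P b u)"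
      using brk_smul[OF b u f] by (simp add: ad_apply[OF u] ad_apply[OF Gam_smul[OF f u]] rho_def)
    show "anchor P x (b x) (rho P u f) - rho P u (\<lambda>y. anchor P y (b y) f) x = rho P (ad P b u) f x" for x
      using rho_brk[OF b u f] by (simp add: ad_apply[OF u] rho_def fun_eq_iff)
  next
    fix u v assume u: "u \<in> Gam P" and v: "v \<in> Gam P"
    show "ad P b (u + v) = ad P b u + ad P b v"
      using brk_add_right[OF u v b] by (simp add: ad_apply[OF u] ad_apply[OF v] ad_apply[OF Gam_add[OF u v]])
    show "ad P b (brk P u v) = brk P (ad P b u) v + brk P u (ad P b v)"
      using jac[OF u v] by (simp add: ad_apply[OF u] ad_apply[OF v] ad_apply[OF brk_in[OF u v]])
  qed
qed

text \<open>The binary action is a signed sum of expressions \<open>Y(pr\<^sub>A \<delta>(X(as)), cs)\<close>. They are linear in \<open>X\<close>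
  and in \<open>\<delta>\<close>, since \<open>\<delta>\<close>, the projection and \<open>Y\<close> in its first argument are linear.\<close>

lemma insertion_lin:
  assumes "Y \<in> OmegaB_total P"
  shows "\<delta> \<in> linear_gam_ops \<Longrightarrow> X \<in> OmegaB_total P \<Longrightarrow> X' \<in> OmegaB_total P \<Longrightarrow>
      Y (prA P (\<delta> ((pw (pw (scl P)) c X + X') as)) # cs) =
      pw (scl P) c (Y (prA P (\<delta> (X as)) # cs)) + Y (prA P (\<delta> (X' as)) # cs)"
    and "\<delta> \<in> gam_ops \<Longrightarrow> \<delta>' \<in> gam_ops \<Longrightarrow>
      Y (prA P ((pw (pw (scl P)) c \<delta> + \<delta>') u) # cs) =
      pw (scl P) c (Y (prA P (\<delta> u) # cs)) + Y (prA P (\<delta>' u) # cs)"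
proof -
  assume \<delta>: "\<delta> \<in> linear_gam_ops" and X: "X \<in> OmegaB_total P" and X': "X' \<in> OmegaB_total P"
  note G = OmegaB_total_in_Gam[OF X, of as] OmegaB_total_in_Gam[OF X', of as]
  have D: "\<delta> u \<in> Gam P" for u using \<delta> by (simp add: linear_gam_ops_def gam_ops_def)
  have "(pw (pw (scl P)) c X + X') as = pw (scl P) c (X as) + X' as" by (simp add: pw_def)
  then have "\<delta> ((pw (pw (scl P)) c X + X') as) = pw (scl P) c (\<delta> (X as)) + \<delta> (X' as)"
    using \<delta> G by (simp add: linear_gam_ops_def)
  then show "Y (prA P (\<delta> ((pw (pw (scl P)) c X + X') as)) # cs) =
      pw (scl P) c (Y (prA P (\<delta> (X as)) # cs)) + Y (prA P (\<delta> (X' as)) # cs)"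
    by (simp only: prA_lin[OF D D] OmegaB_total_Cons_lin[OF assms prA_in[OF D] prA_in[OF D]])
next
  assume "\<delta> \<in> gam_ops" "\<delta>' \<in> gam_ops"
  then have D: "\<delta> u \<in> Gam P" "\<delta>' u \<in> Gam P" by (simp_all add: gam_ops_def)
  have "(pw (pw (scl P)) c \<delta> + \<delta>') u = pw (scl P) c (\<delta> u) + \<delta>' u" by (simp add: pw_def)
  then show "Y (prA P ((pw (pw (scl P)) c \<delta> + \<delta>') u) # cs) =
      pw (scl P) c (Y (prA P (\<delta> u) # cs)) + Y (prA P (\<delta>' u) # cs)"
    by (simp only: prA_lin[OF D] OmegaB_total_Cons_lin[OF assms prA_in[OF D(1)] prA_in[OF D(2)]])
qed

lemma form_lin_apply: "(pw (pw (scl P)) c X + X') as = pw (scl P) c (X as) + X' as"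
  by (simp add: pw_def)

lemmas sec_lin_simps = Sec.scale_right_distrib Sec.scale_sum_right Sec.scale_left_commute sum.distrib

lemma act2_lin:
  assumes Y: "Y \<in> OmegaB_total P" and X: "X \<in> OmegaB_total P"
  shows "\<delta> \<in> linear_gam_ops \<Longrightarrow> X' \<in> OmegaB_total P \<Longrightarrow>
      act2 P i j \<delta> (pw (pw (scl P)) c X + X') Y as = pw (scl P) c (act2 P i j \<delta> X Y as) + act2 P i j \<delta> X' Y as"
    and "\<delta> \<in> linear_gam_ops \<Longrightarrow> Y' \<in> OmegaB_total P \<Longrightarrow>
      act2 P i j \<delta> X (pw (pw (scl P)) c Y + Y') as = pw (scl P) c (act2 P i j \<delta> X Y as) + act2 P i j \<delta> X Y' as"
    and "\<delta> \<in> gam_ops \<Longrightarrow> \<delta>' \<in> gam_ops \<Longrightarrow>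
      act2 P i j (pw (pw (scl P)) c \<delta> + \<delta>') X Y as = pw (scl P) c (act2 P i j \<delta> X Y as) + act2 P i j \<delta>' X Y as"
proof -
  assume h: "\<delta> \<in> linear_gam_ops" "X' \<in> OmegaB_total P"
  show "act2 P i j \<delta> (pw (pw (scl P)) c X + X') Y as = pw (scl P) c (act2 P i j \<delta> X Y as) + act2 P i j \<delta> X' Y as"
    unfolding act2_def Let_def insertion_lin(1)[OF Y h(1) X h(2)] unfolding form_lin_apply
    by (simp add: sec_lin_simps algebra_simps del: plus_fun_apply)
next
  assume h: "\<delta> \<in> linear_gam_ops" "Y' \<in> OmegaB_total P"
  show "act2 P i j \<delta> X (pw (pw (scl P)) c Y + Y') as = pw (scl P) c (act2 P i j \<delta> X Y as) + act2 P i j \<delta> X Y' as"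
    unfolding act2_def Let_def insertion_lin(1)[OF X h(1) Y h(2)] unfolding form_lin_apply
    by (simp add: sec_lin_simps algebra_simps del: plus_fun_apply)
next
  assume h: "\<delta> \<in> gam_ops" "\<delta>' \<in> gam_ops"
  show "act2 P i j (pw (pw (scl P)) c \<delta> + \<delta>') X Y as = pw (scl P) c (act2 P i j \<delta> X Y as) + act2 P i j \<delta>' X Y as"
    unfolding act2_def Let_def insertion_lin(2)[OF X h] insertion_lin(2)[OF Y h]
    by (simp add: sec_lin_simps algebra_simps del: plus_fun_apply)
qed

lemma mu_one: "mu P \<delta> [X] as = (if set as \<subseteq> GamA P
       then - (\<Sum>j<length as. X (as[j := prA P (\<delta> (as ! j))])) + prB P (\<delta> (X as)) else 0)"
  by (simp add: mu_def)

lemma mu_two: "mu P \<delta> [X, Y] as = (\<Sum>i\<le>length as + 1. act2 P i (length as + 1 - i) \<delta> X Y as)"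
  by (simp add: mu_def)

lemma mu_many: "length Xs \<ge> 3 \<Longrightarrow> mu P \<delta> Xs = 0"
  by (cases Xs; cases "tl Xs"; cases "tl (tl Xs)") (auto simp: mu_def)

lemma mu_lin_op:
  assumes \<delta>: "\<delta> \<in> gam_ops" and \<delta>': "\<delta>' \<in> gam_ops" and Xs: "set Xs \<subseteq> OmegaB_total P"
  shows "mu P (pw (pw (scl P)) c \<delta> + \<delta>') Xs = pw (pw (scl P)) c (mu P \<delta> Xs) + mu P \<delta>' Xs"
proof
  fix as
  have D: "\<delta> u \<in> Gam P" "\<delta>' u \<in> Gam P" for u using \<delta> \<delta>' by (simp_all add: gam_ops_def)
  have dl: "(pw (pw (scl P)) c \<delta> + \<delta>') u = pw (scl P) c (\<delta> u) + \<delta>' u" for u by (simp add: pw_def)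
  consider "Xs = []" | X where "Xs = [X]" | X Y where "Xs = [X, Y]" | "length Xs \<ge> 3"
    by (cases Xs; cases "tl Xs"; cases "tl (tl Xs)") (auto simp: Suc_le_eq)
  then have "mu P (pw (pw (scl P)) c \<delta> + \<delta>') Xs as = pw (scl P) c (mu P \<delta> Xs as) + mu P \<delta>' Xs as"
  proof cases
    case 1
    then show ?thesis
      by (simp add: mu_def dl prB_lin[OF D] Sec.scale_minus_right del: plus_fun_apply)
  next
    case (2 X)
    then have X: "X \<in> OmegaB_total P" using Xs by simp
    have "X (as[j := prA P (pw (scl P) c (\<delta> u) + \<delta>' u)]) =
       pw (scl P) c (X (as[j := prA P (\<delta> u)])) + X (as[j := prA P (\<delta>' u)])" if "j < length as" for j u
      unfolding prA_lin[OF D] by (rule OmegaB_total_slot_lin[OF X prA_in[OF D(1)] prA_in[OF D(2)] that])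
    then have "(\<Sum>j<length as. X (as[j := prA P (pw (scl P) c (\<delta> (as ! j)) + \<delta>' (as ! j))])) =
       pw (scl P) c (\<Sum>j<length as. X (as[j := prA P (\<delta> (as ! j))])) +
       (\<Sum>j<length as. X (as[j := prA P (\<delta>' (as ! j))]))"
      by (simp add: sec_lin_simps del: plus_fun_apply)
    then show ?thesis
      unfolding 2 mu_one dl prB_lin[OF D]
      by (simp add: Sec.scale_right_distrib Sec.scale_right_diff_distrib Sec.scale_minus_right del: plus_fun_apply)
  next
    case (3 X Y)
    then have "X \<in> OmegaB_total P" "Y \<in> OmegaB_total P" using Xs by simp_all
    then show ?thesis
      unfolding 3 mu_two act2_lin(3)[OF \<open>Y \<in> OmegaB_total P\<close> \<open>X \<in> OmegaB_total P\<close> \<delta> \<delta>']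
      by (simp only: sec_lin_simps)
  next
    case 4
    then show ?thesis by (simp add: mu_many)
  qed
  then show "mu P (pw (pw (scl P)) c \<delta> + \<delta>') Xs as = (pw (pw (scl P)) c (mu P \<delta> Xs) + mu P \<delta>' Xs) as"
    unfolding form_lin_apply .
qed

lemma mu_lin_slot:
  assumes \<delta>: "\<delta> \<in> linear_gam_ops" and Xs: "set Xs \<subseteq> OmegaB_total P" and Ys: "set Ys \<subseteq> OmegaB_total P"
    and X: "X \<in> OmegaB_total P" and X': "X' \<in> OmegaB_total P"
  shows "mu P \<delta> (Xs @ (pw (pw (scl P)) c X + X') # Ys) =
    pw (pw (scl P)) c (mu P \<delta> (Xs @ X # Ys)) + mu P \<delta> (Xs @ X' # Ys)"
proof
  fix as
  have D: "\<delta> u \<in> Gam P" for u using \<delta> by (simp add: linear_gam_ops_def gam_ops_def)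
  consider "Xs = []" "Ys = []" | Z where "Xs = [Z]" "Ys = []" | Z where "Xs = []" "Ys = [Z]"
    | "length Xs + length Ys \<ge> 2"
    by (cases Xs; cases "tl Xs"; cases Ys; cases "tl Ys") auto
  then have "mu P \<delta> (Xs @ (pw (pw (scl P)) c X + X') # Ys) as =
    pw (scl P) c (mu P \<delta> (Xs @ X # Ys) as) + mu P \<delta> (Xs @ X' # Ys) as"
  proof cases
    case 1
    have "\<delta> (pw (scl P) c (X as) + X' as) = pw (scl P) c (\<delta> (X as)) + \<delta> (X' as)"
      using \<delta> OmegaB_total_in_Gam[OF X] OmegaB_total_in_Gam[OF X'] by (simp add: linear_gam_ops_def)
    then have "prB P (\<delta> (pw (scl P) c (X as) + X' as)) =
        pw (scl P) c (prB P (\<delta> (X as))) + prB P (\<delta> (X' as))"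
      by (simp only: prB_lin[OF D D])
    then show ?thesis
      unfolding 1 append_Nil mu_one form_lin_apply
      by (simp add: sec_lin_simps Sec.scale_right_diff_distrib Sec.scale_minus_right del: plus_fun_apply)
  next
    case (2 Z)
    then have Z: "Z \<in> OmegaB_total P" using Xs by simp
    show ?thesis
      unfolding 2 append_Cons append_Nil mu_two act2_lin(2)[OF X Z \<delta> X'] by (simp only: sec_lin_simps)
  next
    case (3 Z)
    then have Z: "Z \<in> OmegaB_total P" using Ys by simp
    show ?thesis
      unfolding 3 append_Cons append_Nil mu_two act2_lin(1)[OF Z X \<delta> X'] by (simp only: sec_lin_simps)
  next
    case 4
    then show ?thesis by (simp add: mu_many)
  qed
  then show "mu P \<delta> (Xs @ (pw (pw (scl P)) c X + X') # Ys) as =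
    (pw (pw (scl P)) c (mu P \<delta> (Xs @ X # Ys)) + mu P \<delta> (Xs @ X' # Ys)) as"
    unfolding form_lin_apply .
qed

lemma multilinear_mu:
  assumes \<delta>: "\<delta> \<in> linear_gam_ops"
  shows "multilinear_on (pw (pw (scl P))) (OmegaB_total P) (mu P \<delta>)"
  unfolding multilinear_on_def
proof (intro allI impI ballI conjI)
  fix Xs Ys X assume h: "set Xs \<subseteq> OmegaB_total P" "set Ys \<subseteq> OmegaB_total P" "X \<in> OmegaB_total P"
  have z: "0 \<in> OmegaB_total P" using subspace_total by (rule Frm.subspace_0)
  show "mu P \<delta> (Xs @ (X + Y) # Ys) = mu P \<delta> (Xs @ X # Ys) + mu P \<delta> (Xs @ Y # Ys)"
    if "Y \<in> OmegaB_total P" for Y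
    using mu_lin_slot[OF \<delta> h that, of 1] by simp
  have "mu P \<delta> (Xs @ 0 # Ys) = 0"
    using mu_lin_slot[OF \<delta> h(1,2) z z, of 1] by simp
  then show "mu P \<delta> (Xs @ pw (pw (scl P)) c X # Ys) = pw (pw (scl P)) c (mu P \<delta> (Xs @ X # Ys))" for c
    using mu_lin_slot[OF \<delta> h z, of c] by simp
qed

end

section \<open>The twisted operations and the gauge actions\<close>

lemma tensor_tpure: "w \<in> V \<Longrightarrow> t \<in> \<mm> \<Longrightarrow> tpure \<iota> s w t \<in> tensor \<iota> s V \<mm>"
  unfolding tensor_def represents_def by (intro CollectI exI[of _ "[(w, t)]"]) simp

lemma subspace_tensor:
  assumes S: "vector_space s" and V: "module.subspace s V"
  shows "module.subspace (pw s) (tensor \<iota> s V \<mm>)"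
proof -
  interpret S: vector_space s by (rule S)
  interpret T: vector_space "pw s" by (rule vector_space_pw[OF S])
  show ?thesis
  proof (rule T.subspaceI)
    show "0 \<in> tensor \<iota> s V \<mm>"
      unfolding tensor_def represents_def by (intro CollectI exI[of _ "[]"]) simp
    fix X assume "X \<in> tensor \<iota> s V \<mm>"
    then obtain ps where ps: "set ps \<subseteq> V \<times> \<mm>" "X = (\<Sum>(w, t)\<leftarrow>ps. tpure \<iota> s w t)"
      unfolding tensor_def represents_def by auto
    show "pw s c X \<in> tensor \<iota> s V \<mm>" for c
    proof -
      have "pw s c (\<Sum>(w, t)\<leftarrow>rs. tpure \<iota> s w t) = (\<Sum>(w, t)\<leftarrow>map (\<lambda>(w, t). (s c w, t)) rs. tpure \<iota> s w t)"
        for rs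
      proof (induction rs)
        case Nil
        show ?case by (simp only: list.map sum_list.Nil T.scale_zero_right)
      next
        case (Cons r rs)
        obtain w t where r: "r = (w, t)" by (cases r)
        have "pw s c (tpure \<iota> s w t) = tpure \<iota> s (s c w) t"
          by (simp add: tpure_def fun_eq_iff pw_def S.scale_left_commute)
        then show ?case unfolding r
          by (simp only: list.map sum_list.Cons T.scale_right_distrib Cons prod.case)
      qed
      moreover have "set (map (\<lambda>(w, t). (s c w, t)) ps) \<subseteq> V \<times> \<mm>"
        using ps(1) S.subspace_scale[OF V] by auto
      ultimately show ?thesis unfolding tensor_def represents_def ps(2) by blast
    qed
    fix Y assume "Y \<in> tensor \<iota> s V \<mm>"
    then obtain qs where qs: "set qs \<subseteq> V \<times> \<mm>" "Y = (\<Sum>(w, t)\<leftarrow>qs. tpure \<iota> s w t)"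
      unfolding tensor_def represents_def by auto
    have "X + Y = (\<Sum>(w, t)\<leftarrow>ps @ qs. tpure \<iota> s w t)"
      unfolding ps(2) qs(2) by (simp only: map_append sum_list_append)
    moreover have "set (ps @ qs) \<subseteq> V \<times> \<mm>" using ps(1) qs(1) by simp
    ultimately show "X + Y \<in> tensor \<iota> s V \<mm>" unfolding tensor_def represents_def by blast
  qed
qed

lemma (in module) subspace_sum_list:
  "subspace T \<Longrightarrow> (\<And>x. x \<in> set xs \<Longrightarrow> f x \<in> T) \<Longrightarrow> (\<Sum>x\<leftarrow>xs. f x) \<in> T"
  by (induction xs) (simp_all only: list.map sum_list.Nil sum_list.Cons subspace_0 subspace_add list.set_intros)

lemma (in module) subspace_Sum_any:
  "subspace T \<Longrightarrow> (\<And>k. f k \<in> T) \<Longrightarrow> Sum_any f \<in> T"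
  unfolding Sum_any.expand_set by (rule subspace_sum)

lemma (in module) scale_sum_list:
  "scale c (\<Sum>x\<leftarrow>xs. f x) = (\<Sum>x\<leftarrow>xs. scale c (f x))"
  by (induction xs) (simp_all only: list.map sum_list.Nil sum_list.Cons scale_zero_right scale_right_distrib)

text \<open>The parts of a composition of \<open>l\<close> are at most \<open>l\<close>, so the gauge term of order \<open>l + 1\<close> evaluates
  \<open>F\<close> only on gauge terms of lower order. These lie in \<open>T\<close>, where \<open>F\<close> and \<open>G\<close> agree.\<close>

lemma gauge_term_cong:
  fixes s :: "'k::field_char_0 \<Rightarrow> 't \<Rightarrow> 't::ab_group_add"
  assumes S: "vector_space s" and T: "module.subspace s T"
    and F: "\<And>gs. set gs \<subseteq> T \<Longrightarrow> F gs = G gs" and FT: "\<And>gs. set gs \<subseteq> T \<Longrightarrow> F gs \<in> T"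
  shows "gauge_term s F k = gauge_term s G k \<and> gauge_term s F k \<in> T"
proof (induction k rule: less_induct)
  case (less k)
  interpret S: vector_space s by (rule S)
  show ?case
  proof (cases k)
    case 0
    then show ?thesis using S.subspace_0[OF T] by simp
  next
    case (Suc l)
    have step: "F (map (gauge_term s F) ks) = G (map (gauge_term s G) ks) \<and> F (map (gauge_term s F) ks) \<in> T"
      if "ks \<in> compositions n l" for n ks
    proof -
      have lt: "j < k" if "j \<in> set ks" for j
        using member_le_sum_list[OF that] \<open>ks \<in> compositions n l\<close> Suc by (simp add: compositions_def)
      then have "gauge_term s F j \<in> T" if "j \<in> set ks" for j using less that by blast
      then have "set (map (gauge_term s F) ks) \<subseteq> T" by auto
      moreover have "map (gauge_term s F) ks = map (gauge_term s G) ks" using less lt by auto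
      ultimately show ?thesis using F FT by metis
    qed
    have e: "F [] = G []" "F [] \<in> T" using F[of "[]"] FT[of "[]"] by simp_all
    have "gauge_term s F (Suc l) \<in> T"
      unfolding gauge_term.simps
      using e(2) step[THEN conjunct2] by (auto intro!: S.subspace_sum[OF T] S.subspace_scale[OF T])
    moreover have "gauge_term s F (Suc l) = gauge_term s G (Suc l)"
      unfolding gauge_term.simps e(1)
      by (intro if_cong refl sum.cong arg_cong[of _ _ "s _"]) (use step in blast)
    ultimately show ?thesis using Suc by simp
  qed
qed

locale gauge_setup = split_pair_brackets P br
  for P :: "('m::{t2_space,second_countable_topology}, 'k::real_or_complex_field, 'v::ab_group_add) lie_pair"
    and br :: "(('m \<Rightarrow> 'v) list \<Rightarrow> 'm \<Rightarrow> 'v) list \<Rightarrow> ('m \<Rightarrow> 'v) list \<Rightarrow> 'm \<Rightarrow> 'v" +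
  fixes \<iota> :: "'k \<Rightarrow> 'a::comm_ring_1" and \<mm> :: "'a set"
  assumes alg: "local_artinian_algebra \<iota> \<mm>"
begin

lemma algebra_vector_space: "vector_space (\<lambda>c x. \<iota> c * x)"
  using alg unfolding local_artinian_algebra_def
  by unfold_locales (simp_all add: distrib_left distrib_right mult.assoc)

lemma ideal_mult: "t \<in> \<mm> \<Longrightarrow> t * r \<in> \<mm>"
  using alg unfolding local_artinian_algebra_def is_maximal_ideal_def is_ideal_def
  by (metis mult.commute)

abbreviation form_scale :: "'k \<Rightarrow> (('m \<Rightarrow> 'v) list \<Rightarrow> 'm \<Rightarrow> 'v) \<Rightarrow> ('m \<Rightarrow> 'v) list \<Rightarrow> 'm \<Rightarrow> 'v" where
  "form_scale \<equiv> pw (pw (scl P))"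

definition deg1 :: "(('a \<Rightarrow> 'k) \<Rightarrow> ('m \<Rightarrow> 'v) list \<Rightarrow> 'm \<Rightarrow> 'v) set" where
  "deg1 = tensor \<iota> form_scale (OmegaB P 1) \<mm>"

lemma subspace_deg1: "Ten.subspace deg1"
  unfolding deg1_def by (rule subspace_tensor[OF Frm.vector_space_axioms subspace_OmegaB])

definition rep1 :: "(('a \<Rightarrow> 'k) \<Rightarrow> ('m \<Rightarrow> 'v) list \<Rightarrow> 'm \<Rightarrow> 'v) \<Rightarrow> ((('m \<Rightarrow> 'v) list \<Rightarrow> 'm \<Rightarrow> 'v) \<times> 'a) list" where
  "rep1 = trep \<iota> form_scale (OmegaB P 1) \<mm>"

lemma rep1: "X \<in> deg1 \<Longrightarrow> represents \<iota> form_scale (OmegaB P 1) \<mm> (rep1 X) X"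
  unfolding deg1_def rep1_def by (rule represents_trep)

lemma rep1_lists:
  assumes "set Xs \<subseteq> deg1" "ps \<in> set (product_lists (map rep1 Xs))"
  shows "set (map fst ps) \<subseteq> OmegaB P 1" "set (map snd ps) \<subseteq> \<mm>" "length ps = length Xs"
proof -
  have "set rs \<subseteq> OmegaB P 1 \<times> \<mm>" if "rs \<in> set (map rep1 Xs)" for rs
    using that assms(1) rep1 by (auto simp: represents_def)
  from in_product_lists[OF assms(2) this]
  show "set (map fst ps) \<subseteq> OmegaB P 1" "set (map snd ps) \<subseteq> \<mm>" "length ps = length Xs" by simp_all
qed

lemma ext_sum_reps:
  assumes op: "multilinear_on form_scale (OmegaB_total P) op"
    and rss: "list_all2 (\<lambda>X rs. represents \<iota> form_scale (OmegaB_total P) \<mm> rs X) Xs rss"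
  shows "ext_sum \<iota> form_scale op c (map (trep \<iota> form_scale (OmegaB_total P) \<mm>) Xs) = ext_sum \<iota> form_scale op c rss"
proof (rule ext_sum_well_defined[OF algebra_vector_space Frm.vector_space_axioms subspace_total _ op])
  have "\<exists>Y. represents \<iota> form_scale (OmegaB_total P) \<mm> (trep \<iota> form_scale (OmegaB_total P) \<mm> X) Y \<and>
      represents \<iota> form_scale (OmegaB_total P) \<mm> rs Y"
    if "represents \<iota> form_scale (OmegaB_total P) \<mm> rs X" for X rs
    using that represents_trep[of X \<iota> form_scale "OmegaB_total P" \<mm>] by (auto simp: tensor_def)
  then show "list_all2 (\<lambda>rs rs'. \<exists>X. represents \<iota> form_scale (OmegaB_total P) \<mm> rs X \<and>
      represents \<iota> form_scale (OmegaB_total P) \<mm> rs' X) (map (trep \<iota> form_scale (OmegaB_total P) \<mm>) Xs) rss"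
    unfolding list_all2_map1 by (rule list_all2_mono[OF rss])
qed

lemma rep1_total:
  assumes "set Xs \<subseteq> deg1"
  shows "list_all2 (\<lambda>X rs. represents \<iota> form_scale (OmegaB_total P) \<mm> rs X) Xs (map rep1 Xs)"
  using assms by (induction Xs) (simp_all add: represents_mono[OF rep1 OmegaB_subset_total])

lemma multilinear_br: "multilinear_on form_scale (OmegaB_total P) br"
  unfolding multilinear_on_def using br_add br_scale by blast

context
  fixes b :: "('a \<Rightarrow> 'k) \<Rightarrow> 'm \<Rightarrow> 'v"
  assumes b: "b \<in> tensor \<iota> (pw (scl P)) (GamB P) \<mm>"
begin

definition repb :: "(('m \<Rightarrow> 'v) \<times> 'a) list" where
  "repb = trep \<iota> (pw (scl P)) (GamB P) \<mm> b"

lemma repb: "(w, t) \<in> set repb \<Longrightarrow> w \<in> GamB P" "(w, t) \<in> set repb \<Longrightarrow> t \<in> \<mm>"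
  using represents_trep[OF b] unfolding repb_def represents_def by auto

lemma represents_form0_ext:
  "represents \<iota> form_scale (OmegaB_total P) \<mm> (map (\<lambda>(w, t). (form0 w, t)) repb) (form0_ext P \<iota> \<mm> b)"
  unfolding represents_def
proof (intro conjI)
  show "set (map (\<lambda>(w, t). (form0 w, t)) repb) \<subseteq> OmegaB_total P \<times> \<mm>"
    using repb form0_in_OmegaB OmegaB_subset_total by fastforce
qed (simp add: form0_ext_def text1_def repb_def o_def case_prod_unfold)

lemma represents_ad_ext:
  "represents \<iota> (pw (pw (scl P))) (DerL P) \<mm> (map (\<lambda>(w, t). (ad P w, t)) repb) (ad_ext P \<iota> \<mm> b)"
  unfolding represents_def
proof (intro conjI)
  show "set (map (\<lambda>(w, t). (ad P w, t)) repb) \<subseteq> DerL P \<times> \<mm>"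
    using repb ad_in_DerL GamB_subset by fastforce
qed (simp add: ad_ext_def text1_def repb_def o_def case_prod_unfold)

text \<open>The decompositions in the definition of the extended action are exchanged for the one of \<open>ad\<^sub>b\<close>
  that comes from \<open>b\<close>, and for decompositions of the arguments into elements of degree 1, for which
  the action is known to be the bracket.\<close>

lemma mu_ext_ad:
  assumes Xs: "set Xs \<subseteq> deg1"
  shows "mu_ext P \<iota> \<mm> (ad_ext P \<iota> \<mm> b) Xs =
    (\<Sum>(w, t)\<leftarrow>repb. ext_sum \<iota> form_scale (mu P (ad P w)) t (map rep1 Xs))"
proof -
  let ?Q = "\<lambda>\<delta> t. ext_sum \<iota> form_scale (mu P \<delta>) t (map rep1 Xs)"
  note R = represents_trep[of "ad_ext P \<iota> \<mm> b" \<iota> "pw (pw (scl P))" "DerL P" \<mm>]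
  have ad: "ad_ext P \<iota> \<mm> b \<in> tensor \<iota> (pw (pw (scl P))) (DerL P) \<mm>"
    using represents_ad_ext by (auto simp: tensor_def)
  have inT: "set (map fst ps) \<subseteq> OmegaB_total P" if "ps \<in> set (product_lists (map rep1 Xs))" for ps
    using rep1_lists(1)[OF Xs that] OmegaB_subset_total by blast
  have "mu_ext P \<iota> \<mm> (ad_ext P \<iota> \<mm> b) Xs =
    (\<Sum>(\<delta>, t)\<leftarrow>trep \<iota> (pw (pw (scl P))) (DerL P) \<mm> (ad_ext P \<iota> \<mm> b).
      ext_sum \<iota> form_scale (mu P \<delta>) t (map (trep \<iota> form_scale (OmegaB_total P) \<mm>) Xs))"
    by (simp only: mu_ext_def ext_sum_def)
  also have "\<dots> = (\<Sum>(\<delta>, t)\<leftarrow>trep \<iota> (pw (pw (scl P))) (DerL P) \<mm> (ad_ext P \<iota> \<mm> b). ?Q \<delta> t)"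
  proof (rule arg_cong[of _ _ sum_list], rule map_cong[OF refl], clarify)
    fix \<delta> t assume "(\<delta>, t) \<in> set (trep \<iota> (pw (pw (scl P))) (DerL P) \<mm> (ad_ext P \<iota> \<mm> b))"
    then have "\<delta> \<in> linear_gam_ops" using R[OF ad] DerL_subset by (auto simp: represents_def)
    then show "ext_sum \<iota> form_scale (mu P \<delta>) t (map (trep \<iota> form_scale (OmegaB_total P) \<mm>) Xs) = ?Q \<delta> t"
      by (intro ext_sum_reps multilinear_mu rep1_total Xs)
  qed
  also have "\<dots> = (\<Sum>(\<delta>, t)\<leftarrow>map (\<lambda>(w, t). (ad P w, t)) repb. ?Q \<delta> t)"
  proof (rule tensor_sum_well_defined[OF algebra_vector_space Frm.vector_space_axioms subspace_gam_ops])
    have "DerL P \<subseteq> gam_ops" using DerL_subset linear_gam_ops_subset by blast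
    then show "represents \<iota> (pw (pw (scl P))) gam_ops \<mm> (trep \<iota> (pw (pw (scl P))) (DerL P) \<mm> (ad_ext P \<iota> \<mm> b)) (ad_ext P \<iota> \<mm> b)"
      "represents \<iota> (pw (pw (scl P))) gam_ops \<mm> (map (\<lambda>(w, t). (ad P w, t)) repb) (ad_ext P \<iota> \<mm> b)"
      using R[OF ad] represents_ad_ext represents_mono by blast+
  next
    fix \<delta> \<delta>' t assume "\<delta> \<in> gam_ops" "\<delta>' \<in> gam_ops"
    then show "?Q (\<delta> + \<delta>') t = ?Q \<delta> t + ?Q \<delta>' t"
      using mu_lin_op[of \<delta> \<delta>' _ 1] inT
      by (intro ext_sum_op_add[OF algebra_vector_space Frm.vector_space_axioms]) simp
  next
    fix \<delta> t t' show "?Q \<delta> (t + t') = ?Q \<delta> t + ?Q \<delta> t'"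
      by (rule ext_sum_scalar_add[OF algebra_vector_space Frm.vector_space_axioms])
  next
    fix c \<delta> t assume \<delta>: "\<delta> \<in> gam_ops"
    have z: "0 \<in> gam_ops" by (rule Frm.subspace_0[OF subspace_gam_ops])
    have "mu P (pw (pw (scl P)) c \<delta>) (map fst ps) = form_scale c (mu P \<delta> (map fst ps))"
      if ps: "ps \<in> set (product_lists (map rep1 Xs))" for ps
    proof -
      have "mu P 0 (map fst ps) = 0" using mu_lin_op[OF z z inT[OF ps], of 1] by simp
      then show ?thesis using mu_lin_op[OF \<delta> z inT[OF ps], of c] by simp
    qed
    then show "?Q (pw (pw (scl P)) c \<delta>) t = ?Q \<delta> (\<iota> c * t)"
      by (intro ext_sum_op_scale(1)[OF algebra_vector_space Frm.vector_space_axioms])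
  qed
  also have "\<dots> = (\<Sum>(w, t)\<leftarrow>repb. ext_sum \<iota> form_scale (mu P (ad P w)) t (map rep1 Xs))"
    by (simp only: map_map o_def case_prod_unfold fst_conv snd_conv)
  finally show ?thesis .
qed

lemma mu_ext_ad_in_deg1:
  assumes Xs: "set Xs \<subseteq> deg1" shows "mu_ext P \<iota> \<mm> (ad_ext P \<iota> \<mm> b) Xs \<in> deg1"
  unfolding mu_ext_ad[OF Xs] ext_sum_def case_prod_unfold
proof (intro Ten.subspace_sum_list[OF subspace_deg1])
  fix wt ps assume wt: "wt \<in> set repb" and ps: "ps \<in> set (product_lists (map rep1 Xs))"
  have w: "fst wt \<in> GamB P" "snd wt \<in> \<mm>" using repb[of "fst wt" "snd wt"] wt by simp_all
  have "mu P (ad P (fst wt)) (map fst ps) \<in> OmegaB P 1"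
    using br_in_OmegaB1[OF w(1)] bracket_eq_action[OF w(1)] rep1_lists(1)[OF Xs ps] by simp
  then show "tpure \<iota> form_scale (mu P (ad P (fst wt)) (map fst ps)) (snd wt * prod_list (map snd ps)) \<in> deg1"
    unfolding deg1_def by (rule tensor_tpure[OF _ ideal_mult[OF w(2)]])
qed

text \<open>After the same exchange of decompositions on the side of the bracket, and with the sum over the
  decomposition of \<open>b\<close> outermost, the summands are compared by \<open>bracket_eq_signed_action\<close>.\<close>

lemma br_ext_eq_mu_ext:
  assumes Xs: "set Xs \<subseteq> deg1" and Ys: "set Ys \<subseteq> deg1"
  shows "br_ext P \<iota> \<mm> br (Xs @ form0_ext P \<iota> \<mm> b # Ys) =
    pw form_scale ((- 1) ^ length Xs) (mu_ext P \<iota> \<mm> (ad_ext P \<iota> \<mm> b) (Xs @ Ys))"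
proof -
  let ?rb = "map (\<lambda>(w, t). (form0 w, t)) repb"
  have XY: "set (Xs @ Ys) \<subseteq> deg1" using Xs Ys by simp
  have "br_ext P \<iota> \<mm> br (Xs @ form0_ext P \<iota> \<mm> b # Ys) =
      ext_sum \<iota> form_scale br 1 (map (trep \<iota> form_scale (OmegaB_total P) \<mm>) (Xs @ form0_ext P \<iota> \<mm> b # Ys))"
    by (simp only: br_ext_def ext_sum_def mult_1_left)
  also have "\<dots> = ext_sum \<iota> form_scale br 1 (map rep1 Xs @ ?rb # map rep1 Ys)"
    by (intro ext_sum_reps multilinear_br list_all2_appendI list_all2_Cons[THEN iffD2] conjI
        rep1_total Xs Ys represents_form0_ext)
  also have "\<dots> = (\<Sum>(w, t)\<leftarrow>repb. ext_sum \<iota> form_scale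
      (\<lambda>l. br (take (length Xs) l @ form0 w # drop (length Xs) l)) t (map rep1 (Xs @ Ys)))"
    unfolding ext_sum_pull_out
    by (simp only: map_map o_def case_prod_unfold fst_conv snd_conv length_map mult_1_left map_append)
  also have "\<dots> = (\<Sum>(w, t)\<leftarrow>repb.
      pw form_scale ((- 1) ^ length Xs) (ext_sum \<iota> form_scale (mu P (ad P w)) t (map rep1 (Xs @ Ys))))"
  proof (rule arg_cong[of _ _ sum_list], rule map_cong[OF refl], clarify)
    fix w t assume wt: "(w, t) \<in> set repb"
    show "ext_sum \<iota> form_scale (\<lambda>l. br (take (length Xs) l @ form0 w # drop (length Xs) l)) t (map rep1 (Xs @ Ys)) =
        pw form_scale ((- 1) ^ length Xs) (ext_sum \<iota> form_scale (mu P (ad P w)) t (map rep1 (Xs @ Ys)))"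
    proof (rule ext_sum_op_scale(2)[OF algebra_vector_space Frm.vector_space_axioms])
      fix ps assume ps: "ps \<in> set (product_lists (map rep1 (Xs @ Ys)))"
      let ?l = "map fst ps" and ?n = "length Xs"
      have l: "set ?l \<subseteq> OmegaB P 1" "length ?l = length (Xs @ Ys)"
        using rep1_lists(1,3)[OF XY ps] by simp_all
      have "set (take ?n ?l) \<subseteq> OmegaB P 1" "set (drop ?n ?l) \<subseteq> OmegaB P 1"
        using l(1) set_take_subset[of ?n ?l] set_drop_subset[of ?n ?l] by blast+
      from bracket_eq_signed_action[OF repb(1)[OF wt] this]
      show "br (take ?n ?l @ form0 w # drop ?n ?l) = form_scale ((- 1) ^ ?n) (mu P (ad P w) ?l)"
        using l(2) by (simp only: append_take_drop_id length_take length_append min_absorb2 le_add1)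
    qed
  qed
  also have "\<dots> = pw form_scale ((- 1) ^ length Xs) (mu_ext P \<iota> \<mm> (ad_ext P \<iota> \<mm> b) (Xs @ Ys))"
    unfolding mu_ext_ad[OF XY] Ten.scale_sum_list case_prod_unfold ..
  finally show ?thesis .
qed

text \<open>The two twisted operations agree term by term: the sign \<open>(- 1)\<^sup>k\<close> that arises when \<open>b\<close> is moved
  past \<open>k\<close> copies of \<open>\<xi>\<close> is the sign in the \<open>\<hh>\<close>-gauge action.\<close>

lemma twisted_br_eq_twisted_mu:
  assumes \<xi>: "\<xi> \<in> deg1" and gs: "set gs \<subseteq> deg1"
  shows "twisted_br P \<iota> \<mm> br \<xi> (form0_ext P \<iota> \<mm> b # gs) = twisted_mu P \<iota> \<mm> \<xi> (ad_ext P \<iota> \<mm> b) gs"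
    and "twisted_mu P \<iota> \<mm> \<xi> (ad_ext P \<iota> \<mm> b) gs \<in> deg1"
proof -
  have r: "set (replicate k \<xi>) \<subseteq> deg1" for k using \<xi> by auto
  have "pw form_scale (1 / fact k) (br_ext P \<iota> \<mm> br (replicate k \<xi> @ form0_ext P \<iota> \<mm> b # gs)) =
      pw form_scale ((- 1) ^ k / fact k) (mu_ext P \<iota> \<mm> (ad_ext P \<iota> \<mm> b) (replicate k \<xi> @ gs))" for k
    unfolding br_ext_eq_mu_ext[OF r gs] Ten.scale_scale by simp
  then show "twisted_br P \<iota> \<mm> br \<xi> (form0_ext P \<iota> \<mm> b # gs) = twisted_mu P \<iota> \<mm> \<xi> (ad_ext P \<iota> \<mm> b) gs"
    unfolding twisted_br_def twisted_mu_def by simp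
  show "twisted_mu P \<iota> \<mm> \<xi> (ad_ext P \<iota> \<mm> b) gs \<in> deg1"
    unfolding twisted_mu_def using r gs
    by (intro Ten.subspace_Sum_any[OF subspace_deg1] Ten.subspace_scale[OF subspace_deg1] mu_ext_ad_in_deg1) auto
qed

lemma gauge_actions_agree:
  assumes \<xi>: "\<xi> \<in> deg1"
  shows "der_gauge_act P \<iota> \<mm> (ad_ext P \<iota> \<mm> b) \<xi> = gauge_act P \<iota> \<mm> br b \<xi>"
proof -
  have "gauge_term (pw form_scale) (twisted_mu P \<iota> \<mm> \<xi> (ad_ext P \<iota> \<mm> b)) k =
      gauge_term (pw form_scale) (\<lambda>gs. twisted_br P \<iota> \<mm> br \<xi> (form0_ext P \<iota> \<mm> b # gs)) k" for k
    using gauge_term_cong[OF Ten.vector_space_axioms subspace_deg1,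
        of "twisted_mu P \<iota> \<mm> \<xi> (ad_ext P \<iota> \<mm> b)" "\<lambda>gs. twisted_br P \<iota> \<mm> br \<xi> (form0_ext P \<iota> \<mm> b # gs)" k]
      twisted_br_eq_twisted_mu[OF \<xi>] by simp
  then show ?thesis unfolding der_gauge_act_def gauge_act_def by (simp cong: if_cong)
qed

end

end

theorem theorem5p4:
  fixes P :: "('m::{t2_space,second_countable_topology}, 'k::real_or_complex_field, 'v::ab_group_add) lie_pair"
    and \<iota> :: "'k \<Rightarrow> 'a::comm_ring_1" and \<mm> :: "'a set"
    and br :: "(('m \<Rightarrow> 'v) list \<Rightarrow> 'm \<Rightarrow> 'v) list \<Rightarrow> ('m \<Rightarrow> 'v) list \<Rightarrow> 'm \<Rightarrow> 'v"
    and b :: "('a \<Rightarrow> 'k) \<Rightarrow> 'm \<Rightarrow> 'v"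
  assumes "split_lie_pair P"
    and "local_artinian_algebra \<iota> \<mm>"
    and "L3_brackets P br"
    and "b \<in> tensor \<iota> (pw (scl P)) (GamB P) \<mm>"
  shows "\<forall>\<xi> \<in> MC P \<iota> \<mm> br. der_gauge_act P \<iota> \<mm> (ad_ext P \<iota> \<mm> b) \<xi> = gauge_act P \<iota> \<mm> br b \<xi>"
proof
  interpret gauge_setup P br \<iota> \<mm>
    using assms(1-3) by unfold_locales
  fix \<xi> assume "\<xi> \<in> MC P \<iota> \<mm> br"
  then have "\<xi> \<in> deg1" by (simp add: MC_def deg1_def)
  then show "der_gauge_act P \<iota> \<mm> (ad_ext P \<iota> \<mm> b) \<xi> = gauge_act P \<iota> \<mm> br b \<xi>"
    by (rule gauge_actions_agree[OF assms(4)])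
qed

end
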